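(* Let $X$ and $Y$ be locally compact paracompact spaces and let $\mathcal{P}$ be a closed hereditary topological property of compact spaces which is preserved under finite sums of subspaces and coincides with $\sigma$-compactness in the realm of locally compact paracompact spaces. The following are equivalent: (1) $\lambda_{\mathcal{P}}X\setminus X$ and $\lambda_{\mathcal{P}}Y\setminus Y$ are homeomorphic. (2) $(\mathscr{E}^{C}_{\mathcal{P}}(X),\leq)$ and $(\mathscr{E}^{C}_{\mathcal{P}}(Y),\leq)$ are order-isomorphic. (3) $(\mathscr{E}^{*}_{local-\mathcal{P}}(X),\leq)$ and $(\mathscr{E}^{*}_{local-\mathcal{P}}(Y),\leq)$ are order-isomorphic.
   Context: Conventions: compact, locally compact and paracompact spaces are Hausdorff. $\beta X$ is the Stone-Čech compactification of a Tychonoff space $X$ (with $X$ regarded as a subspace). $\mathbf{I}=[0,1]$. A topological property $\mathcal{P}$ is a homeomorphism-invariant property of topological spaces. It is "of compact spaces" if every compact space has $\mathcal{P}$. It is closed hereditary if each closed subset (subspace) of a space with $\mathcal{P}$ also has $\mathcal{P}$. It is preserved under finite sums of subspaces if a Hausdorff space has $\mathcal{P}$ whenever it is the union of a finite collection of its subspaces having $\mathcal{P}$. It coincides with $\sigma$-compactness in the realm of locally compact paracompact spaces if a locally compact paracompact space has $\mathcal{P}$ if and only if it is $\sigma$-compact. A space $T$ is locally-$\mathcal{P}$ if each $x\in T$ has an open neighborhood $U_x$ in $T$ such that $\mathrm{cl}_T U_x$ has $\mathcal{P}$. A cozero-set of $X$ is a set of the form $X\setminus f^{-1}(0)$ for a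 continuous $f:X\to\mathbf{I}$; $Coz(X)$ is the set of cozero-sets of $X$. For a Tychonoff space $X$, $$\lambda_{\mathcal{P}}X=\bigcup\{\mathrm{int}_{\beta X}\mathrm{cl}_{\beta X}C : C\in Coz(X)\text{ and }\mathrm{cl}_X C\text{ has }\mathcal{P}\}.$$ A space $T$ is an extension of $X$ if it contains $X$ as a dense subspace; it is a one-point extension if moreover $T\setminus X$ is a singleton. Two extensions of $X$ are equivalent if there is a homeomorphism between them fixing $X$ pointwise; equivalent extensions are identified. For extensions $T,T'$ of $X$, $T\leq T'$ means that there is a continuous map $T'\to T$ fixing $X$ pointwise; this is a partial order on equivalence classes. A Tychonoff space $T$ is Čech-complete if $\beta T\setminus T$ is an $F_\sigma$ in $\beta T$. $\mathscr{E}(X)$ is the set of (equivalence classes of) one-point Tychonoff extensions of $X$. $\mathscr{E}^{C}_{\mathcal{P}}(X)$ is the set of $T\in\mathscr{E}(X)$ such that $T$ is Čech-complete and has $\mathcal{P}$. $\mathscr{E}^{*}_{local-\mathcal{P}}(X)$ is the set of $T\in\mathscr{E}(X)$ such that $T$ has a countable local base at the point of $T\setminus X$ and $T$ is locally-$\mathcal{P}$. Two partially ordered sets are order-isomorphic if there is a bijection between them which, together with its inverse, preserves $\leq$. *)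

theory Defs
  imports "HOL-Analysis.Analysis"
begin

section \<open>Separation and covering properties\<close>

definition tychonoff_space :: "'a topology \<Rightarrow> bool" where
  "tychonoff_space X \<longleftrightarrow> completely_regular_space X \<and> Hausdorff_space X"

text \<open>Paracompact spaces are Hausdorff by convention.\<close>

definition paracompact_space :: "'a topology \<Rightarrow> bool" where
  "paracompact_space X \<longleftrightarrow> Hausdorff_space X \<and>
     (\<forall>\<U>. (\<forall>U\<in>\<U>. openin X U) \<and> \<Union>\<U> = topspace X \<longrightarrow>
       (\<exists>\<V>. (\<forall>V\<in>\<V>. openin X V) \<and> \<Union>\<V> = topspace X \<and>
            (\<forall>V\<in>\<V>. \<exists>U\<in>\<U>. V \<subseteq> U) \<and> locally_finite_in X \<V>))"

definition sigma_compact_space :: "'a topology \<Rightarrow> bool" where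
  "sigma_compact_space X \<longleftrightarrow> (countable union_of compactin X) (topspace X)"

section \<open>The Stone-Cech compactification\<close>

text \<open>\<open>\<beta>X\<close> is the closure of the image of \<open>X\<close> under the evaluation map into the cube
  \<open>[0,1]\<^bsup>C(X,[0,1])\<^esup>\<close>. Maps in \<open>C(X,[0,1])\<close> are taken extensional, so that each continuous map on
  \<open>topspace X\<close> gives exactly one coordinate. A subset \<open>A\<close> of \<open>X\<close>, regarded as a subset of \<open>\<beta>X\<close>,
  is \<open>sc_embed X ` A\<close>.\<close>

definition unit_maps :: "'a topology \<Rightarrow> ('a \<Rightarrow> real) set" where
  "unit_maps X = {f \<in> extensional (topspace X). continuous_map X (top_of_set {0..1}) f}"

definition unit_cube :: "'a topology \<Rightarrow> (('a \<Rightarrow> real) \<Rightarrow> real) topology" where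
  "unit_cube X = product_topology (\<lambda>_. top_of_set {0..1}) (unit_maps X)"

definition sc_embed :: "'a topology \<Rightarrow> 'a \<Rightarrow> (('a \<Rightarrow> real) \<Rightarrow> real)" where
  "sc_embed X x = (\<lambda>f\<in>unit_maps X. f x)"

definition stone_cech :: "'a topology \<Rightarrow> (('a \<Rightarrow> real) \<Rightarrow> real) topology" where
  "stone_cech X = subtopology (unit_cube X) (unit_cube X closure_of (sc_embed X ` topspace X))"

text \<open>The characteristic properties of \<open>\<beta>X\<close>.\<close>

lemma compact_stone_cech: "compact_space (stone_cech X)"
proof -
  have "compact_space (unit_cube X)"
    unfolding unit_cube_def compact_space_product_topology
    by (simp add: compact_space_subtopology)
  then show ?thesis
    unfolding stone_cech_def
    by (intro compact_space_subtopology closedin_compact_space closedin_closure_of)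
qed

lemma Hausdorff_stone_cech: "Hausdorff_space (stone_cech X)"
proof -
  have "Hausdorff_space (unit_cube X)"
    unfolding unit_cube_def Hausdorff_space_product_topology
    by (simp add: Hausdorff_space_subtopology)
  then show ?thesis
    unfolding stone_cech_def by (rule Hausdorff_space_subtopology)
qed

lemma sc_embed_in_unit_cube: "sc_embed X ` topspace X \<subseteq> topspace (unit_cube X)"
proof clarify
  fix x assume x: "x \<in> topspace X"
  have "f x \<in> {0..1}" if "f \<in> unit_maps X" for f
    using that x unfolding unit_maps_def continuous_map_def by auto
  then show "sc_embed X x \<in> topspace (unit_cube X)"
    unfolding sc_embed_def unit_cube_def topspace_product_topology PiE_def by auto
qed

lemma dense_sc_embed:
  "stone_cech X closure_of (sc_embed X ` topspace X) = topspace (stone_cech X)"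
proof -
  have sub: "sc_embed X ` topspace X \<subseteq> unit_cube X closure_of (sc_embed X ` topspace X)"
    by (rule closure_of_subset[OF sc_embed_in_unit_cube])
  have "topspace (unit_cube X) \<inter> unit_cube X closure_of (sc_embed X ` topspace X)
      = unit_cube X closure_of (sc_embed X ` topspace X)"
    using closure_of_subset_topspace by (rule Int_absorb1)
  then show ?thesis
    unfolding stone_cech_def closure_of_subtopology topspace_subtopology Int_absorb1[OF sub] by simp
qed

lemma embedding_sc_embed:
  assumes "tychonoff_space X"
  shows "embedding_map X (stone_cech X) (sc_embed X)"
proof -
  have K: "mspace (submetric (cfunspace X euclidean_metric) {f. f \<in> topspace X \<rightarrow> {0..1}})
      = unit_maps X" (is "?L = _")
  proof (rule set_eqI)
    fix f :: "'a \<Rightarrow> real"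
    have "bounded (f ` topspace X)" if "f \<in> topspace X \<rightarrow> {0..1}"
      by (rule bounded_subset[OF bounded_closed_interval[of 0 1]])
        (use that in \<open>auto simp: image_subset_iff_funcset\<close>)
    then show "f \<in> ?L \<longleftrightarrow> f \<in> unit_maps X"
      unfolding unit_maps_def continuous_map_in_subtopology by (auto simp: image_subset_iff_funcset)
  qed
  have "embedding_map X (unit_cube X) (\<lambda>x. sc_embed X x)"
    using completely_regular_space_cube_embedding_explicit[of X] assms
    unfolding K unit_cube_def sc_embed_def tychonoff_space_def by blast
  then show ?thesis
    unfolding stone_cech_def embedding_map_in_subtopology
    using closure_of_subset[OF sc_embed_in_unit_cube[of X]] by blast
qed

lemma stone_cech_extension:
  assumes f: "continuous_map X (top_of_set {0..1}) (f :: 'a \<Rightarrow> real)"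
  shows "\<exists>g. continuous_map (stone_cech X) (top_of_set {0..1}) g \<and>
             (\<forall>x\<in>topspace X. g (sc_embed X x) = f x)"
proof (intro exI conjI)
  let ?r = "restrict f (topspace X)"
  have "continuous_map X (top_of_set {0..1}) ?r"
    by (rule continuous_map_eq[OF f]) simp
  then have r: "?r \<in> unit_maps X"
    unfolding unit_maps_def by simp
  show "continuous_map (stone_cech X) (top_of_set {0..1}) (\<lambda>z. z ?r)"
    unfolding stone_cech_def unit_cube_def
    by (rule continuous_map_from_subtopology, rule continuous_map_product_projection[OF r])
  show "\<forall>x\<in>topspace X. sc_embed X x ?r = f x"
    using r by (simp add: sc_embed_def)
qed

text \<open>A Cech-complete space is Tychonoff by definition.\<close>

definition cech_complete_space :: "'a topology \<Rightarrow> bool" where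
  "cech_complete_space T \<longleftrightarrow> tychonoff_space T \<and>
     fsigma_in (stone_cech T) (topspace (stone_cech T) - sc_embed T ` topspace T)"

section \<open>Topological properties\<close>

text \<open>A topological property is represented by a predicate \<open>P\<close> on the topologies over a universe
  type \<open>'u\<close>. A space over another type has the property if it is homeomorphic to a space over
  \<open>'u\<close> that does; for homeomorphism-invariant \<open>P\<close> and spaces over \<open>'u\<close> itself this is \<open>P\<close>
  (lemma \<open>has_property_iff\<close>). It is the intended notion for all spaces having a copy over \<open>'u\<close>. Below it
  is applied only to subspaces of a space \<open>X\<close> over \<open>'a\<close> and of its one-point extensions, which are
  spaces over \<open>'a option\<close>; so \<open>'u\<close> has to be large enough to admit an injection from
  \<open>'a option\<close>.\<close>

definition has_property :: "('u topology \<Rightarrow> bool) \<Rightarrow> 'a topology \<Rightarrow> bool" where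
  "has_property P X \<longleftrightarrow> (\<exists>S. S homeomorphic_space X \<and> P S)"

definition topological_property :: "('u topology \<Rightarrow> bool) \<Rightarrow> bool" where
  "topological_property P \<longleftrightarrow> (\<forall>S T. S homeomorphic_space T \<and> P S \<longrightarrow> P T)"

lemma has_property_iff:
  "topological_property P \<Longrightarrow> has_property P S \<longleftrightarrow> P S"
  unfolding has_property_def topological_property_def
  using homeomorphic_space_refl by blast

definition property_of_compact_spaces :: "('u topology \<Rightarrow> bool) \<Rightarrow> bool" where
  "property_of_compact_spaces P \<longleftrightarrow> (\<forall>S. compact_space S \<and> Hausdorff_space S \<longrightarrow> P S)"

definition closed_hereditary :: "('u topology \<Rightarrow> bool) \<Rightarrow> bool" where
  "closed_hereditary P \<longleftrightarrow> (\<forall>S C. P S \<and> closedin S C \<longrightarrow> P (subtopology S C))"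

definition preserved_under_finite_sums :: "('u topology \<Rightarrow> bool) \<Rightarrow> bool" where
  "preserved_under_finite_sums P \<longleftrightarrow>
     (\<forall>S \<F>. Hausdorff_space S \<and> finite \<F> \<and> \<Union>\<F> = topspace S \<and>
            (\<forall>A\<in>\<F>. P (subtopology S A)) \<longrightarrow> P S)"

definition coincides_with_sigma_compactness :: "('u topology \<Rightarrow> bool) \<Rightarrow> bool" where
  "coincides_with_sigma_compactness P \<longleftrightarrow>
     (\<forall>S. locally_compact_space S \<and> paracompact_space S \<longrightarrow> (P S \<longleftrightarrow> sigma_compact_space S))"

definition locally_property :: "('u topology \<Rightarrow> bool) \<Rightarrow> 'a topology \<Rightarrow> bool" where
  "locally_property P T \<longleftrightarrow>
     (\<forall>x\<in>topspace T. \<exists>U. openin T U \<and> x \<in> U \<and> has_property P (subtopology T (T closure_of U)))"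

definition cozero_set :: "'a topology \<Rightarrow> 'a set \<Rightarrow> bool" where
  "cozero_set X C \<longleftrightarrow>
     (\<exists>f::'a \<Rightarrow> real. continuous_map X (top_of_set {0..1}) f \<and>
        C = topspace X - {x \<in> topspace X. f x = 0})"

definition lambda_set :: "('u topology \<Rightarrow> bool) \<Rightarrow> 'a topology \<Rightarrow> (('a \<Rightarrow> real) \<Rightarrow> real) set" where
  "lambda_set P X =
     \<Union>{stone_cech X interior_of (stone_cech X closure_of (sc_embed X ` C)) | C.
         cozero_set X C \<and> has_property P (subtopology X (X closure_of C))}"

definition lambda_remainder ::
  "('u topology \<Rightarrow> bool) \<Rightarrow> 'a topology \<Rightarrow> (('a \<Rightarrow> real) \<Rightarrow> real) topology" where
  "lambda_remainder P X =
     subtopology (stone_cech X) (lambda_set P X - sc_embed X ` topspace X)"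

section \<open>One-point extensions\<close>

text \<open>One-point extensions of \<open>X\<close> are represented on the carrier \<open>Some ` topspace X \<union> {None}\<close>:
  a point \<open>x\<close> of \<open>X\<close> is identified with \<open>Some x\<close>, and \<open>None\<close> is the additional point. Every
  one-point extension is equivalent to one of this form (\<open>one_point_extension_representation\<close>), and
  equivalent extensions of this form are equal (\<open>equivalent_extensions_iff\<close>), so the topologies of
  this form are a set of representatives of the equivalence classes.\<close>

definition one_point_extension :: "'a topology \<Rightarrow> 'a option topology \<Rightarrow> bool" where
  "one_point_extension X T \<longleftrightarrow>
     topspace T = insert None (Some ` topspace X) \<and>
     embedding_map X T Some \<and>
     T closure_of (Some ` topspace X) = topspace T"

definition equivalent_extensions ::
  "'a topology \<Rightarrow> 'a option topology \<Rightarrow> 'a option topology \<Rightarrow> bool" where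
  "equivalent_extensions X T T' \<longleftrightarrow>
     (\<exists>h. homeomorphic_map T T' h \<and> (\<forall>x\<in>topspace X. h (Some x) = Some x))"

lemma equivalent_extensions_iff:
  assumes T: "one_point_extension X T" and T': "one_point_extension X T'"
  shows "equivalent_extensions X T T' \<longleftrightarrow> T = T'"
proof
  assume "equivalent_extensions X T T'"
  then obtain h where h: "homeomorphic_map T T' h" "\<And>x. x \<in> topspace X \<Longrightarrow> h (Some x) = Some x"
    unfolding equivalent_extensions_def by blast
  have top: "topspace T = insert None (Some ` topspace X)"
            "topspace T' = insert None (Some ` topspace X)"
    using T T' unfolding one_point_extension_def by blast+
  have im: "h ` topspace T = topspace T'" and inj: "inj_on h (topspace T)"
    using h(1) unfolding homeomorphic_eq_everything_map by blast+
  have None: "h None = None"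
  proof (rule ccontr)
    assume n: "h None \<noteq> None"
    have "h None \<in> topspace T'" using im top(1) by blast
    then have "h None \<in> Some ` topspace X" using n top(2) by simp
    then obtain x where x: "h None = Some x" "x \<in> topspace X" by (rule imageE)
    have "h None = h (Some x)" using x h(2) by simp
    then have "None = Some x"
      by (rule inj_onD[OF inj]) (use x(2) top(1) in simp_all)
    then show False by simp
  qed
  have "homeomorphic_map T T' id"
    by (rule homeomorphic_map_eq[OF h(1)]) (use top(1) None h(2) in auto)
  then show "T = T'"
    unfolding homeomorphic_map_id by (rule sym)
next
  assume "T = T'"
  then have "homeomorphic_map T T' id"
    unfolding homeomorphic_map_id by (rule sym)
  then show "equivalent_extensions X T T'"
    unfolding equivalent_extensions_def by (intro exI[of _ id]) simp
qed

lemma one_point_extension_representation: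
  fixes X :: "'a topology" and S :: "'c topology"
  assumes e: "embedding_map X S e" and p: "p \<notin> e ` topspace X"
    and top: "topspace S = insert p (e ` topspace X)"
    and dense: "S closure_of (e ` topspace X) = topspace S"
  shows "\<exists>T h. one_point_extension X T \<and> homeomorphic_map S T h \<and>
               (\<forall>x\<in>topspace X. h (e x) = Some x)"
proof -
  define A where "A = insert None (Some ` topspace X)"
  define k where "k = case_option p e"
  define T where "T = pullback_topology A k S"
  have inj_e: "inj_on e (topspace X)"
    using e unfolding embedding_map_def homeomorphic_eq_everything_map by blast
  have kA: "k ` A = topspace S"
    unfolding A_def k_def top by (simp add: image_image)
  have inj: "inj_on k A"
    using inj_e p unfolding A_def k_def inj_on_def by auto
  have topT: "topspace T = A"
    unfolding T_def topspace_pullback_topology using kA by blast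
  have cont: "continuous_map T S k"
    unfolding continuous_map topT openin_subtopology
  proof (intro conjI allI impI)
    show "k ` A \<subseteq> topspace S" using kA by blast
    fix U assume U: "openin S U"
    have "{x \<in> A. k x \<in> U} = k -` U \<inter> A" by blast
    then show "openin T {x \<in> A. k x \<in> U}"
      unfolding T_def openin_pullback_topology using U by blast
  qed
  have "open_map T S k"
    unfolding open_map_def
  proof (intro allI impI)
    fix V assume "openin T V"
    then obtain U where U: "openin S U" "V = k -` U \<inter> A"
      unfolding T_def openin_pullback_topology by blast
    have "k ` V = U \<inter> k ` A"
      unfolding U(2) by blast
    also have "\<dots> = U"
      unfolding kA using openin_subset[OF U(1)] by (rule Int_absorb2)
    finally have "k ` V = U" .
    then show "openin S (k ` V)" using U(1) by simp
  qed
  then have "homeomorphic_map T S k"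
    using cont inj kA by (intro bijective_open_imp_homeomorphic_map) (simp_all add: topT)
  then obtain h where maps: "homeomorphic_maps T S k h"
    unfolding homeomorphic_map_maps by blast
  then have h: "homeomorphic_map S T h"
    unfolding homeomorphic_maps_map by blast
  have he: "h (e x) = Some x" if "x \<in> topspace X" for x
  proof -
    have "Some x \<in> topspace T" using that topT A_def by blast
    then have "h (k (Some x)) = Some x" using maps unfolding homeomorphic_maps_def by blast
    then show ?thesis unfolding k_def by simp
  qed
  have im: "h ` (e ` topspace X) = Some ` topspace X"
    using he by (auto simp: image_image)
  have sub: "e ` topspace X \<subseteq> topspace S" using top by blast
  have "T closure_of (Some ` topspace X) = topspace T"
    using homeomorphic_map_closure_of[OF h sub] dense im
      homeomorphic_imp_surjective_map[OF h] by simp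
  moreover have "embedding_map X T Some"
  proof (rule embedding_map_eq)
    show "embedding_map X T (h \<circ> e)"
      using e conjunct1[OF surjective_embedding_map[THEN iffD2, OF h]]
      by (rule embedding_map_compose)
  qed (simp add: he)
  ultimately have "one_point_extension X T"
    unfolding one_point_extension_def topT A_def by blast
  then show ?thesis using h he by blast
qed

text \<open>The order on extensions: \<open>T \<le> T'\<close> if some continuous map \<open>T' \<rightarrow> T\<close> fixes \<open>X\<close> pointwise.\<close>

definition extension_le ::
  "'a topology \<Rightarrow> 'a option topology \<Rightarrow> 'a option topology \<Rightarrow> bool" where
  "extension_le X T T' \<longleftrightarrow>
     (\<exists>f. continuous_map T' T f \<and> (\<forall>x\<in>topspace X. f (Some x) = Some x))"

definition ext_tychonoff :: "'a topology \<Rightarrow> 'a option topology set" where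
  "ext_tychonoff X = {T. one_point_extension X T \<and> tychonoff_space T}"

definition ext_cech :: "('u topology \<Rightarrow> bool) \<Rightarrow> 'a topology \<Rightarrow> 'a option topology set" where
  "ext_cech P X = {T \<in> ext_tychonoff X. cech_complete_space T \<and> has_property P T}"

definition countable_local_base_at :: "'a topology \<Rightarrow> 'a \<Rightarrow> bool" where
  "countable_local_base_at T p \<longleftrightarrow>
     (\<exists>\<B>. countable \<B> \<and> (\<forall>B\<in>\<B>. openin T B \<and> p \<in> B) \<and>
          (\<forall>U. openin T U \<and> p \<in> U \<longrightarrow> (\<exists>B\<in>\<B>. B \<subseteq> U)))"

definition ext_local :: "('u topology \<Rightarrow> bool) \<Rightarrow> 'a topology \<Rightarrow> 'a option topology set" where
  "ext_local P X = {T \<in> ext_tychonoff X. countable_local_base_at T None \<and> locally_property P T}"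

definition order_isomorphic ::
  "'a set \<Rightarrow> ('a \<Rightarrow> 'a \<Rightarrow> bool) \<Rightarrow> 'b set \<Rightarrow> ('b \<Rightarrow> 'b \<Rightarrow> bool) \<Rightarrow> bool" where
  "order_isomorphic A r B s \<longleftrightarrow>
     (\<exists>f. bij_betw f A B \<and> monotone_on A r s f \<and> monotone_on B s r (inv_into A f))"

end

theory Submission
  imports Defs
begin

text \<open>A one-point Tychonoff extension \<open>T\<close> of \<open>X\<close> is determined by the preimage \<open>F\<close> of its added point
  under \<open>\<beta>X \<rightarrow> \<beta>T\<close>, an arbitrary nonempty compact subset of \<open>\<beta>X - X\<close>, and \<open>T \<le> T'\<close> means \<open>F \<supseteq> F'\<close>.
  Since \<open>X\<close> is locally compact and paracompact, each \<open>\<sigma>\<close>-compact subset lies in a clopen \<open>\<sigma>\<close>-compact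
  subset \<open>S\<close>, the set \<open>\<lambda>X\<close> is the union of the clopen sets \<open>cl S\<close>, and the \<open>\<sigma>\<close>-compact subsets of
  \<open>L = \<lambda>X - X\<close> lie in compact open subsets of \<open>L\<close>. In these terms the Cech-complete extensions with the
  property correspond to the \<open>\<sigma>\<close>-compact open proper subsets \<open>(\<beta>X - X) - F\<close> of \<open>L\<close>, and the locally-\<open>P\<close> extensions with a
  countable base at the added point to the nonempty compact \<open>G\<^sub>\<delta>\<close>-sets \<open>F\<close> in \<open>L\<close>. Both posets are invariants of \<open>L\<close>, and
  each of them determines \<open>L\<close>: points of \<open>L\<close> are the maximal centred families of compact \<open>G\<^sub>\<delta>\<close>-sets, and
  compact \<open>G\<^sub>\<delta>\<close>-sets are differences of members of the first poset (complements, if \<open>L\<close> is compact).\<close>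

section \<open>Order isomorphisms\<close>

text \<open>The obstacle is the missing top of the first poset. The set \<open>L\<close> is excluded
  there because its complement in the remainder would have to be a nonempty fibre: a
  \<sigma>-compact \<open>L\<close> lies in a single closure \<open>cl S\<close>, which forces
  \<open>L\<close> to be the whole remainder and leaves the empty fibre. For noncompact
  \<open>L\<close> the exclusion removes nothing, since no \<sigma>-compact subset exhausts
  \<open>L\<close>, and the poset is a lattice of sets. For compact \<open>L\<close> it can destroy
  unions, and complementation is used instead. Which case holds must therefore be read off from the
  order alone. In the noncompact case a compact G-delta is a difference \<open>K - A\<close> of
  members with \<open>K\<close> compact, and compactness of a member is again an order property.
  Inclusion between two differences is a statement about unions and intersections of the four sets,
  so it survives any order isomorphism. Compact G-deltas are the right building blocks because they
  form a neighbourhood base in \<open>L\<close>, are closed under nonempty finite intersections, and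
  are the same whether G-delta is taken in \<open>L\<close> or in \<open>\<beta>X\<close>.\<close>

lemma order_isomorphic_iff:
  "order_isomorphic A r B s \<longleftrightarrow>
     (\<exists>f. bij_betw f A B \<and> (\<forall>x\<in>A. \<forall>y\<in>A. r x y \<longleftrightarrow> s (f x) (f y)))"
proof
  assume "order_isomorphic A r B s"
  then obtain f where f: "bij_betw f A B" "monotone_on A r s f" "monotone_on B s r (inv_into A f)"
    unfolding order_isomorphic_def by blast
  have "r x y \<longleftrightarrow> s (f x) (f y)" if "x \<in> A" "y \<in> A" for x y
  proof
    assume "s (f x) (f y)"
    then have "r (inv_into A f (f x)) (inv_into A f (f y))"
      using f(3) bij_betw_apply[OF f(1)] that unfolding monotone_on_def by blast
    then show "r x y"
      using that bij_betw_inv_into_left[OF f(1)] by simp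
  qed (use f(2) that in \<open>auto simp: monotone_on_def\<close>)
  then show "\<exists>f. bij_betw f A B \<and> (\<forall>x\<in>A. \<forall>y\<in>A. r x y \<longleftrightarrow> s (f x) (f y))"
    using f(1) by blast
next
  assume "\<exists>f. bij_betw f A B \<and> (\<forall>x\<in>A. \<forall>y\<in>A. r x y \<longleftrightarrow> s (f x) (f y))"
  then obtain f where f: "bij_betw f A B" "\<And>x y. x \<in> A \<Longrightarrow> y \<in> A \<Longrightarrow> r x y \<longleftrightarrow> s (f x) (f y)"
    by blast
  have "monotone_on B s r (inv_into A f)"
    unfolding monotone_on_def
    using f(2) bij_betw_apply[OF bij_betw_inv_into[OF f(1)]] bij_betw_inv_into_right[OF f(1)] by auto
  then show "order_isomorphic A r B s"
    unfolding order_isomorphic_def using f by (auto simp: monotone_on_def)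
qed

lemma order_isomorphicE:
  assumes "order_isomorphic A r B s"
  obtains f where "bij_betw f A B" "\<And>x y. x \<in> A \<Longrightarrow> y \<in> A \<Longrightarrow> r x y \<longleftrightarrow> s (f x) (f y)"
  using assms unfolding order_isomorphic_iff by blast

lemma order_isomorphic_sym:
  assumes "order_isomorphic A r B s"
  shows "order_isomorphic B s A r"
proof -
  obtain f where f: "bij_betw f A B" "\<And>x y. x \<in> A \<Longrightarrow> y \<in> A \<Longrightarrow> r x y \<longleftrightarrow> s (f x) (f y)"
    using assms unfolding order_isomorphic_iff by blast
  have "s x y \<longleftrightarrow> r (inv_into A f x) (inv_into A f y)" if "x \<in> B" "y \<in> B" for x y
    using that f(2) bij_betw_apply[OF bij_betw_inv_into[OF f(1)]] bij_betw_inv_into_right[OF f(1)]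
    by simp
  then show ?thesis
    unfolding order_isomorphic_iff using bij_betw_inv_into[OF f(1)] by blast
qed

lemma order_isomorphic_trans:
  assumes "order_isomorphic A r B s" and "order_isomorphic B s C t"
  shows "order_isomorphic A r C t"
proof -
  obtain f where f: "bij_betw f A B" "\<And>x y. x \<in> A \<Longrightarrow> y \<in> A \<Longrightarrow> r x y \<longleftrightarrow> s (f x) (f y)"
    using assms(1) unfolding order_isomorphic_iff by blast
  obtain g where g: "bij_betw g B C" "\<And>x y. x \<in> B \<Longrightarrow> y \<in> B \<Longrightarrow> s x y \<longleftrightarrow> t (g x) (g y)"
    using assms(2) unfolding order_isomorphic_iff by blast
  have "r x y \<longleftrightarrow> t ((g \<circ> f) x) ((g \<circ> f) y)" if "x \<in> A" "y \<in> A" for x y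
    using that f g bij_betw_apply[OF f(1)] by simp
  then show ?thesis
    unfolding order_isomorphic_iff using bij_betw_trans[OF f(1) g(1)] by blast
qed

lemma order_isomorphic_cong:
  assumes "order_isomorphic A r A' r'" and "order_isomorphic B s B' s'"
  shows "order_isomorphic A r B s \<longleftrightarrow> order_isomorphic A' r' B' s'"
  using assms by (meson order_isomorphic_sym order_isomorphic_trans)

section \<open>The two posets of a space\<close>

abbreviation sigma_compactin :: "'a topology \<Rightarrow> 'a set \<Rightarrow> bool" where
  "sigma_compactin X \<equiv> countable union_of compactin X"

section \<open>Closure properties of \<sigma>-compact subsets\<close>

lemma sigma_compactin_subset: "sigma_compactin X A \<Longrightarrow> A \<subseteq> topspace X"
  by (auto simp: union_of_def dest: compactin_subset_topspace)

lemma countable_union_ofI: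
  assumes "countable \<K>" "\<And>K. K \<in> \<K> \<Longrightarrow> Q K" "\<Union>\<K> = A"
  shows "(countable union_of Q) A"
  unfolding union_of_def by (rule exI[of _ \<K>]) (use assms in \<open>simp add: subset_eq\<close>)

lemma countable_union_ofE:
  assumes "(countable union_of Q) A"
  obtains \<K> where "countable \<K>" "\<forall>K\<in>\<K>. Q K" "\<Union>\<K> = A"
proof -
  obtain \<K> where "countable \<K>" "\<K> \<subseteq> Collect Q" "\<Union>\<K> = A"
    using assms unfolding union_of_def by (elim exE conjE)
  then show ?thesis using that[of \<K>] by (simp add: subset_eq)
qed

lemma sigma_compactin_Int_closedin:
  assumes "sigma_compactin X A" and "closedin X C"
  shows "sigma_compactin X (A \<inter> C)"
proof -
  obtain \<K> where \<K>: "countable \<K>" "\<forall>K\<in>\<K>. compactin X K" "\<Union>\<K> = A"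
    using assms(1) by (rule countable_union_ofE)
  show ?thesis
  proof (rule countable_union_ofI)
    show "countable ((\<lambda>K. K \<inter> C) ` \<K>)" using \<K>(1) by (rule countable_image)
    show "compactin X K" if "K \<in> (\<lambda>K. K \<inter> C) ` \<K>" for K
      using that \<K>(2) assms(2) compact_Int_closedin by blast
    show "\<Union>((\<lambda>K. K \<inter> C) ` \<K>) = A \<inter> C" unfolding \<K>(3)[symmetric] by simp
  qed
qed

lemma sigma_compactin_Int:
  assumes "Hausdorff_space X" "sigma_compactin X A" "sigma_compactin X B"
  shows "sigma_compactin X (A \<inter> B)"
  using assms(2,3) countable_union_of_Int[of "compactin X" A B]
  by (simp add: compactin_Int[OF assms(1)])

lemma sigma_compactin_image:
  assumes "continuous_map X Y f" "sigma_compactin X A"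
  shows "sigma_compactin Y (f ` A)"
proof -
  obtain \<K> where \<K>: "countable \<K>" "\<forall>K\<in>\<K>. compactin X K" "\<Union>\<K> = A"
    using assms(2) by (rule countable_union_ofE)
  show ?thesis
  proof (rule countable_union_ofI)
    show "countable ((`) f ` \<K>)" using \<K>(1) by (rule countable_image)
    show "compactin Y K" if "K \<in> (`) f ` \<K>" for K
      using that \<K>(2) image_compactin[OF _ assms(1)] by blast
    show "\<Union>((`) f ` \<K>) = f ` A" unfolding \<K>(3)[symmetric] by (rule image_Union[symmetric])
  qed
qed

lemma sigma_compactin_subtopology:
  "sigma_compactin (subtopology X S) A \<longleftrightarrow> sigma_compactin X A \<and> A \<subseteq> S"
proof
  assume "sigma_compactin (subtopology X S) A"
  then obtain \<K> where \<K>: "countable \<K>" "\<forall>K\<in>\<K>. compactin (subtopology X S) K" "\<Union>\<K> = A"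
    by (rule countable_union_ofE) 
  have "A \<subseteq> S"
    unfolding \<K>(3)[symmetric] using \<K>(2) by (intro Union_least) (simp add: compactin_subtopology)
  then show "sigma_compactin X A \<and> A \<subseteq> S"
    using \<K>(2) by (auto simp: compactin_subtopology intro!: countable_union_ofI[OF \<K>(1) _ \<K>(3)])
next
  assume A: "sigma_compactin X A \<and> A \<subseteq> S"
  then obtain \<K> where \<K>: "countable \<K>" "\<forall>K\<in>\<K>. compactin X K" "\<Union>\<K> = A"
    by (elim conjE countable_union_ofE)
  show "sigma_compactin (subtopology X S) A"
    by (rule countable_union_ofI[OF \<K>(1) _ \<K>(3)])
      (use A \<K>(2,3) in \<open>auto simp: compactin_subtopology\<close>)
qed

lemma sigma_compactin_eq_fsigma_in:
  assumes "compact_space X" "Hausdorff_space X"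
  shows "sigma_compactin X = fsigma_in X"
proof -
  have "compactin X = closedin X"
    using assms closedin_compact_space compactin_imp_closedin by blast
  then show ?thesis unfolding fsigma_in_def by simp
qed

lemma gdelta_in_continuous_map_preimage:
  assumes "continuous_map X Y f" "gdelta_in Y S"
  shows "gdelta_in X {x \<in> topspace X. f x \<in> S}"
proof -
  obtain C where C: "\<And>n. openin Y (C n)" "\<And>n. C (Suc n) \<subseteq> C n" "\<Inter>(range C) = S"
    using assms(2) unfolding gdelta_in_descending by blast
  show ?thesis
    unfolding gdelta_in_descending
  proof (intro exI conjI allI)
    show "openin X {x \<in> topspace X. f x \<in> C n}" for n
      using openin_continuous_map_preimage[OF assms(1) C(1)] .
    show "{x \<in> topspace X. f x \<in> C (Suc n)} \<subseteq> {x \<in> topspace X. f x \<in> C n}" for n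
      using C(2) by blast
    show "(\<Inter>n. {x \<in> topspace X. f x \<in> C n}) = {x \<in> topspace X. f x \<in> S}"
      using C(3) by blast
  qed
qed

text \<open>Leaving out the empty set, which is never the fibre of an added point, makes
  intersection visible in the order: in a Hausdorff space two members meet iff some member lies
  below both.\<close>

definition compact_gdeltas :: "'a topology \<Rightarrow> 'a set set" where
  "compact_gdeltas X = {F. F \<noteq> {} \<and> compactin X F \<and> gdelta_in X F}"

text \<open>The members are to be complements of nonempty fibres, hence the exclusion of the whole
  space.\<close>

definition proper_sigma_opens :: "'a topology \<Rightarrow> 'a set set" where
  "proper_sigma_opens X = {A. openin X A \<and> sigma_compactin X A \<and> A \<noteq> topspace X}"

text \<open>The only feature of \<open>L\<close> on which its reconstruction rests. It provides
  compact open neighbourhoods of points and makes every \<sigma>-compact space of this kind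
  compact.\<close>

definition sigma_bounded_space :: "'a topology \<Rightarrow> bool" where
  "sigma_bounded_space X \<longleftrightarrow> Hausdorff_space X \<and>
     (\<forall>A. sigma_compactin X A \<longrightarrow> (\<exists>K. compactin X K \<and> openin X K \<and> A \<subseteq> K))"

lemma homeomorphic_map_image_bij:
  assumes h: "homeomorphic_maps X Y h g"
    and fwd: "\<And>A. A \<in> \<A> \<Longrightarrow> A \<subseteq> topspace X \<and> h ` A \<in> \<B>"
    and bwd: "\<And>B. B \<in> \<B> \<Longrightarrow> B \<subseteq> topspace Y \<and> g ` B \<in> \<A>"
  shows "bij_betw ((`) h) \<A> \<B>" and "\<And>A A'. A \<in> \<A> \<Longrightarrow> A' \<in> \<A> \<Longrightarrow> A \<subseteq> A' \<longleftrightarrow> h ` A \<subseteq> h ` A'"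
proof -
  have gh: "\<And>x. x \<in> topspace X \<Longrightarrow> g (h x) = x" and hg: "\<And>y. y \<in> topspace Y \<Longrightarrow> h (g y) = y"
    using h unfolding homeomorphic_maps_def by blast+
  have gh': "g ` h ` A = A" if "A \<in> \<A>" for A
  proof -
    have "(\<lambda>x. g (h x)) ` A = (\<lambda>x. x) ` A" using fwd[OF that] gh by (intro image_cong) auto
    then show ?thesis by (simp add: image_image)
  qed
  have hg': "h ` g ` B = B" if "B \<in> \<B>" for B
  proof -
    have "(\<lambda>x. h (g x)) ` B = (\<lambda>x. x) ` B" using bwd[OF that] hg by (intro image_cong) auto
    then show ?thesis by (simp add: image_image)
  qed
  show "bij_betw ((`) h) \<A> \<B>"
    by (rule bij_betw_byWitness[where f' = "(`) g"]) (use fwd bwd gh' hg' in auto)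
  show "A \<subseteq> A' \<longleftrightarrow> h ` A \<subseteq> h ` A'" if "A \<in> \<A>" "A' \<in> \<A>" for A A'
    using gh'[OF that(1)] gh'[OF that(2)] by (metis image_mono)
qed

lemma homeomorphic_space_imp_posets_isomorphic:
  assumes "X homeomorphic_space Y"
  shows "order_isomorphic (compact_gdeltas X) (\<supseteq>) (compact_gdeltas Y) (\<supseteq>)"
    and "order_isomorphic (proper_sigma_opens X) (\<subseteq>) (proper_sigma_opens Y) (\<subseteq>)"
proof -
  obtain h g where hg: "homeomorphic_maps X Y h g"
    using assms unfolding homeomorphic_space_def by blast
  then have h: "homeomorphic_map X Y h" and g: "homeomorphic_map Y X g"
    by (auto simp: homeomorphic_maps_map)
  \<comment> \<open>Stated for arbitrary spaces, since it is needed for \<open>h\<close> and, in the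
    opposite direction, for its inverse \<open>g\<close>.\<close>
  have 1: "F \<subseteq> topspace S \<and> k ` F \<in> compact_gdeltas T"
    if "homeomorphic_map S T k" "F \<in> compact_gdeltas S"
    for S :: "'x topology" and T :: "'y topology" and k F
    using that homeomorphic_map_gdeltaness[OF that(1)]
      image_compactin[OF _ homeomorphic_imp_continuous_map[OF that(1)]]
    by (auto simp: compact_gdeltas_def gdelta_in_subset)
  have 2: "A \<subseteq> topspace S \<and> k ` A \<in> proper_sigma_opens T"
    if k: "homeomorphic_map S T k" and A: "A \<in> proper_sigma_opens S"
    for S :: "'x topology" and T :: "'y topology" and k A
  proof -
    have sub: "A \<subseteq> topspace S" "A \<noteq> topspace S" and op: "openin S A" and sc: "sigma_compactin S A"
      using A openin_subset by (auto simp: proper_sigma_opens_def)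
    have "k ` A \<noteq> k ` topspace S"
      using inj_on_image_eq_iff[OF homeomorphic_imp_injective_map[OF k] sub(1) subset_refl] sub(2) by simp
    then show ?thesis
      using sub sigma_compactin_image[OF homeomorphic_imp_continuous_map[OF k] sc]
        homeomorphic_map_openness[OF k sub(1)] op homeomorphic_imp_surjective_map[OF k]
      by (simp add: proper_sigma_opens_def)
  qed
  show "order_isomorphic (compact_gdeltas X) (\<supseteq>) (compact_gdeltas Y) (\<supseteq>)"
    unfolding order_isomorphic_iff
    using homeomorphic_map_image_bij[OF hg 1[OF h] 1[OF g]] by blast
  show "order_isomorphic (proper_sigma_opens X) (\<subseteq>) (proper_sigma_opens Y) (\<subseteq>)"
    unfolding order_isomorphic_iff
    using homeomorphic_map_image_bij[OF hg 2[OF h] 2[OF g]] by blast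
qed

section \<open>Recovering a space from its posets\<close>

lemma gdelta_in_closed_preimage:
  assumes "continuous_map X euclideanreal f" "closed C"
  shows "gdelta_in X {x \<in> topspace X. f x \<in> C}"
  using assms
  by (simp add: gdelta_in_continuous_map_preimage closed_imp_gdelta_in metrizable_space_euclidean)

lemma sigma_bounded_imp_Hausdorff: "sigma_bounded_space X \<Longrightarrow> Hausdorff_space X"
  by (simp add: sigma_bounded_space_def)

lemma sigma_bounded_imp_compact_open_superset:
  assumes "sigma_bounded_space X" "sigma_compactin X A"
  obtains K where "compactin X K" "openin X K" "A \<subseteq> K"
  using assms unfolding sigma_bounded_space_def by blast

lemma sigma_bounded_imp_completely_regular:
  assumes "sigma_bounded_space X"
  shows "completely_regular_space X"
proof -
  have "locally_compact_space X"
    unfolding locally_compact_space_def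
  proof
    fix x assume "x \<in> topspace X"
    then have "sigma_compactin X {x}" by (simp add: countable_union_of_inc)
    then obtain K where "compactin X K" "openin X K" "{x} \<subseteq> K"
      by (rule sigma_bounded_imp_compact_open_superset[OF assms])
    then show "\<exists>U K. openin X U \<and> compactin X K \<and> x \<in> U \<and> U \<subseteq> K" by blast
  qed
  then show ?thesis
    using assms sigma_bounded_imp_Hausdorff locally_compact_Hausdorff_imp_regular_space
      locally_compact_regular_imp_completely_regular_space by blast
qed

lemma completely_regular_separation:
  assumes "completely_regular_space X" "openin X U" "x \<in> U"
  obtains f where "continuous_map X euclideanreal f" "f x = 0" "\<And>y. y \<in> topspace X - U \<Longrightarrow> f y = 1"
proof -
  obtain f where "continuous_map X euclideanreal f" "f x = 0" "f ` (topspace X - U) \<subseteq> {1}"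
    using assms unfolding completely_regular_space_alt' by meson
  then show ?thesis using that[of f] by (simp add: image_subset_iff)
qed

lemma compact_gdeltas_imp_closedin:
  "Hausdorff_space X \<Longrightarrow> F \<in> compact_gdeltas X \<Longrightarrow> closedin X F"
  by (simp add: compact_gdeltas_def compactin_imp_closedin)

lemma compact_gdeltas_Int_preimage:
  assumes "F \<in> compact_gdeltas X" "continuous_map X euclideanreal f" "closed C"
    and "F \<inter> {x \<in> topspace X. f x \<in> C} \<noteq> {}"
  shows "F \<inter> {x \<in> topspace X. f x \<in> C} \<in> compact_gdeltas X"
proof -
  have "closedin X {x \<in> topspace X. f x \<in> C}"
    using assms by (simp add: closedin_continuous_map_preimage)
  then show ?thesis
    using assms gdelta_in_closed_preimage[OF assms(2,3)]
    by (simp add: compact_gdeltas_def compact_Int_closedin gdelta_in_Int)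
qed

text \<open>A compact open set around \<open>x\<close>, cut by a closed sublevel set of a continuous
  function, stays compact and is a G-delta; the strict sublevel set supplies the open neighbourhood
  inside it.\<close>

lemma compact_gdelta_nbhd:
  assumes X: "sigma_bounded_space X" and U: "openin X U" "x \<in> U"
  obtains F V where "F \<in> compact_gdeltas X" "openin X V" "x \<in> V" "V \<subseteq> F" "F \<subseteq> U"
proof -
  have xX: "x \<in> topspace X" using U openin_subset by blast
  then have "sigma_compactin X {x}" by (simp add: countable_union_of_inc)
  then obtain K where K: "compactin X K" "openin X K" "{x} \<subseteq> K"
    by (rule sigma_bounded_imp_compact_open_superset[OF X])
  obtain f where f: "continuous_map X euclideanreal f" "f x = 0" "\<And>y. y \<in> topspace X - U \<Longrightarrow> f y = 1"
    using completely_regular_separation[OF sigma_bounded_imp_completely_regular[OF X] U] by blast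
  \<comment> \<open>Any level strictly between 0 and 1 serves: \<open>f\<close> is 0 at
    \<open>x\<close> and 1 off \<open>U\<close>.\<close>
  define F where "F = K \<inter> {x \<in> topspace X. f x \<in> {..1/2}}"
  define V where "V = K \<inter> {x \<in> topspace X. f x \<in> {..<1/2}}"
  have "K \<in> compact_gdeltas X"
    using K open_imp_gdelta_in by (auto simp: compact_gdeltas_def)
  moreover have "x \<in> F" using K xX f(2) by (simp add: F_def)
  ultimately have "F \<in> compact_gdeltas X"
    unfolding F_def by (intro compact_gdeltas_Int_preimage[OF _ f(1)]) auto
  moreover have "openin X V"
    unfolding V_def by (intro openin_Int K openin_continuous_map_preimage[OF f(1)]) simp
  moreover have "x \<in> V" using K xX f(2) by (simp add: V_def)
  moreover have "V \<subseteq> F" by (auto simp: V_def F_def)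
  moreover have "F \<subseteq> U" using f(3) by (force simp: F_def)
  ultimately show ?thesis by (rule that)
qed

lemma compact_gdeltas_separate:
  assumes X: "sigma_bounded_space X" and "x \<in> topspace X" "y \<in> topspace X" "x \<noteq> y"
  obtains F G where "F \<in> compact_gdeltas X" "G \<in> compact_gdeltas X" "x \<in> F" "y \<in> G" "F \<inter> G = {}"
proof -
  obtain U V where UV: "openin X U" "openin X V" "x \<in> U" "y \<in> V" "disjnt U V"
    using sigma_bounded_imp_Hausdorff[OF X] assms(2-4) unfolding Hausdorff_space_def by blast
  obtain F where "F \<in> compact_gdeltas X" "x \<in> F" "F \<subseteq> U"
    using compact_gdelta_nbhd[OF X UV(1,3)] by (metis subsetD)
  moreover obtain G where "G \<in> compact_gdeltas X" "y \<in> G" "G \<subseteq> V"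
    using compact_gdelta_nbhd[OF X UV(2,4)] by (metis subsetD)
  ultimately show ?thesis using that UV(5) unfolding disjnt_def by blast
qed

text \<open>This is what lets an order isomorphism transport the finite intersection
  property.\<close>

lemma compact_gdeltas_finite_Inter:
  assumes X: "Hausdorff_space X" and "finite \<F>" "\<F> \<noteq> {}" "\<F> \<subseteq> compact_gdeltas X" "\<Inter>\<F> \<noteq> {}"
  shows "\<Inter>\<F> \<in> compact_gdeltas X"
proof -
  obtain F where F: "F \<in> \<F>" using assms(3) by blast
  have "closedin X (\<Inter>\<F>)"
    using assms compact_gdeltas_imp_closedin[OF X] by (intro closedin_Inter) auto
  then have "compactin X (\<Inter>\<F>)"
    using F assms(4) Inter_lower[OF F]
    by (elim closed_compactin[rotated 2]) (auto simp: compact_gdeltas_def)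
  moreover have "gdelta_in X (\<Inter>\<F>)"
    using assms by (intro gdelta_in_Inter) (auto simp: compact_gdeltas_def countable_finite)
  ultimately show ?thesis using assms(5) by (simp add: compact_gdeltas_def)
qed

text \<open>The members containing \<open>x\<close> have nonempty finite intersections, which are
  again members, so their images have the finite intersection property and, by compactness, a common
  point \<open>y\<close>. Disjointness of members is also an order property, which excludes
  \<open>y\<close> from the images of members that miss \<open>x\<close>.\<close>

lemma compact_gdeltas_iso_point:
  assumes X: "sigma_bounded_space X" and Y: "sigma_bounded_space Y"
    and \<phi>: "bij_betw \<phi> (compact_gdeltas X) (compact_gdeltas Y)"
    and mono: "\<And>F G. F \<in> compact_gdeltas X \<Longrightarrow> G \<in> compact_gdeltas X \<Longrightarrow> F \<subseteq> G \<longleftrightarrow> \<phi> F \<subseteq> \<phi> G"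
    and x: "x \<in> topspace X"
  shows "\<exists>y\<in>topspace Y. \<forall>F\<in>compact_gdeltas X. x \<in> F \<longleftrightarrow> y \<in> \<phi> F"
proof -
  have HX: "Hausdorff_space X" and HY: "Hausdorff_space Y"
    using X Y sigma_bounded_imp_Hausdorff by auto
  have \<phi>in: "\<phi> F \<in> compact_gdeltas Y" if "F \<in> compact_gdeltas X" for F
    using bij_betw_apply[OF \<phi> that] .
  define \<N> where "\<N> = {F \<in> compact_gdeltas X. x \<in> F}"
  obtain F\<^sub>0 V where "F\<^sub>0 \<in> compact_gdeltas X" "x \<in> V" "V \<subseteq> F\<^sub>0"
    using compact_gdelta_nbhd[OF X openin_topspace x] by metis
  then have F\<^sub>0: "F\<^sub>0 \<in> \<N>"
    unfolding \<N>_def by (simp add: subset_iff)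
  have "\<phi> F\<^sub>0 \<inter> \<Inter>\<F> \<noteq> {}" if \<F>: "finite \<F>" "\<F> \<subseteq> \<phi> ` \<N>" for \<F>
  proof -
    obtain \<H> where \<H>: "\<H> \<subseteq> \<N>" "finite \<H>" "\<F> = \<phi> ` \<H>"
      using finite_subset_image[OF \<F>] by blast
    \<comment> \<open>Inserting \<open>F\<^sub>0\<close> keeps the family nonempty when
      \<open>\<H>\<close> is empty.\<close>
    define H where "H = \<Inter>(insert F\<^sub>0 \<H>)"
    have H: "H \<in> compact_gdeltas X"
      unfolding H_def using HX \<H> F\<^sub>0
      by (intro compact_gdeltas_finite_Inter) (auto simp: \<N>_def)
    have "\<phi> H \<subseteq> \<phi> F" if "F \<in> insert F\<^sub>0 \<H>" for F
    proof -
      have "F \<in> compact_gdeltas X" using that \<H>(1) F\<^sub>0 by (auto simp: \<N>_def)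
      then show ?thesis using mono[OF H] that by (auto simp: H_def)
    qed
    then have "\<phi> H \<subseteq> \<phi> F\<^sub>0 \<inter> \<Inter>\<F>" using \<H>(3) by blast
    moreover have "\<phi> H \<noteq> {}" using \<phi>in[OF H] by (simp add: compact_gdeltas_def)
    ultimately show ?thesis by blast
  qed
  moreover have "\<forall>C\<in>\<phi> ` \<N>. closedin Y C"
    using \<phi>in compact_gdeltas_imp_closedin[OF HY] by (auto simp: \<N>_def)
  moreover have "compactin Y (\<phi> F\<^sub>0)"
    using F\<^sub>0 \<phi>in by (auto simp: \<N>_def compact_gdeltas_def)
  ultimately have "\<phi> F\<^sub>0 \<inter> \<Inter>(\<phi> ` \<N>) \<noteq> {}"
    unfolding compactin_fip by blast
  then obtain y where y: "y \<in> \<phi> F\<^sub>0" "\<And>F. F \<in> \<N> \<Longrightarrow> y \<in> \<phi> F" by blast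
  \<comment> \<open>If \<open>x\<close> is not in \<open>F\<close>, some member \<open>F'\<close>
    around \<open>x\<close> misses \<open>F\<close>; yet both images contain \<open>y\<close>, so
    their intersection is the image of a member below \<open>F\<close> and \<open>F'\<close>, which
    would be empty.\<close>
  have "x \<in> F" if F: "F \<in> compact_gdeltas X" "y \<in> \<phi> F" for F
  proof (rule ccontr)
    assume "x \<notin> F"
    then have "openin X (topspace X - F)" "x \<in> topspace X - F"
      using x compact_gdeltas_imp_closedin[OF HX F(1)] by auto
    then obtain F' V where F': "F' \<in> compact_gdeltas X" "x \<in> V" "V \<subseteq> F'" "F' \<subseteq> topspace X - F"
      using compact_gdelta_nbhd[OF X] by metis
    have "y \<in> \<phi> F'" using y(2) F' by (auto simp: \<N>_def)
    then have "\<Inter>{\<phi> F, \<phi> F'} \<in> compact_gdeltas Y"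
      using F \<phi>in F'(1) by (intro compact_gdeltas_finite_Inter[OF HY]) auto
    then have "\<phi> F \<inter> \<phi> F' \<in> \<phi> ` compact_gdeltas X"
      using bij_betw_imp_surj_on[OF \<phi>] by simp
    then obtain H where H: "H \<in> compact_gdeltas X" "\<phi> H = \<phi> F \<inter> \<phi> F'"
      by (metis imageE)
    have "H \<subseteq> F \<inter> F'" using mono[OF H(1)] F(1) F'(1) H(2) by simp
    then show False using F'(4) H(1) by (auto simp: compact_gdeltas_def)
  qed
  moreover have "y \<in> topspace Y"
    using y(1) \<open>compactin Y (\<phi> F\<^sub>0)\<close> compactin_subset_topspace by blast
  ultimately show ?thesis using y(2) by (auto simp: \<N>_def)
qed

text \<open>The point map pulls \<open>\<phi> F\<close> back to \<open>F\<close>, so compact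
  G-deltas have closed preimages. Continuity follows because, near any point, the part of the target
  outside \<open>U\<close> can be enclosed in such a set.\<close>

lemma compact_gdeltas_iso_continuous_map:
  assumes X: "sigma_bounded_space X" and Y: "sigma_bounded_space Y"
    and \<phi>: "bij_betw \<phi> (compact_gdeltas X) (compact_gdeltas Y)"
    and mono: "\<And>F G. F \<in> compact_gdeltas X \<Longrightarrow> G \<in> compact_gdeltas X \<Longrightarrow> F \<subseteq> G \<longleftrightarrow> \<phi> F \<subseteq> \<phi> G"
  shows "\<exists>h. continuous_map X Y h \<and>
             (\<forall>x\<in>topspace X. \<forall>F\<in>compact_gdeltas X. x \<in> F \<longleftrightarrow> h x \<in> \<phi> F)"
proof -
  have "\<forall>x\<in>topspace X. \<exists>y. y \<in> topspace Y \<and> (\<forall>F\<in>compact_gdeltas X. x \<in> F \<longleftrightarrow> y \<in> \<phi> F)"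
    using compact_gdeltas_iso_point[OF assms] by blast
  then obtain h where h: "\<And>x. x \<in> topspace X \<Longrightarrow> h x \<in> topspace Y"
    "\<And>x F. x \<in> topspace X \<Longrightarrow> F \<in> compact_gdeltas X \<Longrightarrow> x \<in> F \<longleftrightarrow> h x \<in> \<phi> F"
    by metis
  have "openin X {x \<in> topspace X. h x \<in> U}" if U: "openin Y U" for U
  proof (subst openin_subopen, intro ballI)
    fix x assume "x \<in> {x \<in> topspace X. h x \<in> U}"
    then have x: "x \<in> topspace X" "h x \<in> U" by auto
    obtain F V where F: "F \<in> compact_gdeltas X" "openin X V" "x \<in> V" "V \<subseteq> F"
      using compact_gdelta_nbhd[OF X openin_topspace x(1)] by metis
    obtain g where g: "continuous_map Y euclideanreal g" "g (h x) = 0"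
      "\<And>y. y \<in> topspace Y - U \<Longrightarrow> g y = 1"
      using completely_regular_separation[OF sigma_bounded_imp_completely_regular[OF Y] U x(2)] by blast
    \<comment> \<open>\<open>G\<close> contains every point of \<open>\<phi> F\<close> outside
      \<open>U\<close>, where \<open>g\<close> is 1, but not \<open>h x\<close>, where
      \<open>g\<close> is 0. Its preimage is therefore a closed set to be cut away from
      \<open>V\<close>.\<close>
    define G where "G = \<phi> F \<inter> {y \<in> topspace Y. g y \<in> {1/2..}}"
    have Vh: "h y \<in> U" if "y \<in> V" "h y \<notin> G" for y
    proof -
      have "y \<in> topspace X" using F(2) that(1) openin_subset by blast
      then have "h y \<in> \<phi> F" "h y \<in> topspace Y" using h F(1,4) that(1) by auto
      then show ?thesis using that(2) g(3)[of "h y"] by (auto simp: G_def)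
    qed
    have "\<exists>W. openin X W \<and> x \<in> W \<and> (\<forall>y\<in>W. y \<in> V \<and> h y \<notin> G)"
    \<comment> \<open>An empty \<open>G\<close> is no member and has no preimage under
      \<open>\<phi>\<close>; in that case \<open>V\<close> itself serves.\<close>
    proof (cases "G = {}")
      case False
      have "G \<in> compact_gdeltas Y"
        using False bij_betw_apply[OF \<phi> F(1)] unfolding G_def
        by (intro compact_gdeltas_Int_preimage[OF _ g(1)]) auto
      then obtain F' where F': "F' \<in> compact_gdeltas X" "\<phi> F' = G"
        using bij_betw_imp_surj_on[OF \<phi>] by (metis imageE)
      have sub: "V \<subseteq> topspace X" using F(2) openin_subset by blast
      have "openin X (V - F')"
        using F(2) compact_gdeltas_imp_closedin[OF sigma_bounded_imp_Hausdorff[OF X] F'(1)]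
        by (rule openin_diff)
      moreover have "x \<notin> F'" using h(2)[OF x(1) F'(1)] F'(2) g(2) by (simp add: G_def)
      ultimately show ?thesis
        using F(3) h(2)[OF _ F'(1)] F'(2) sub by (intro exI[of _ "V - F'"]) auto
    qed (use F in auto)
    then obtain W where W: "openin X W" "x \<in> W" "\<And>y. y \<in> W \<Longrightarrow> y \<in> V \<and> h y \<notin> G" by blast
    then have "W \<subseteq> {x \<in> topspace X. h x \<in> U}"
      using Vh openin_subset by fastforce
    then show "\<exists>T. openin X T \<and> x \<in> T \<and> T \<subseteq> {x \<in> topspace X. h x \<in> U}"
      using W(1,2) by blast
  qed
  then have "continuous_map X Y h"
    unfolding continuous_map_def using h(1) by auto
  then show ?thesis using h(2) by blast
qed

text \<open>The isomorphism and its inverse induce continuous maps whose composites preserve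
  membership in every compact G-delta; as these separate points, the composites are
  identities.\<close>

lemma compact_gdeltas_isomorphic_imp_homeomorphic:
  assumes X: "sigma_bounded_space X" and Y: "sigma_bounded_space Y"
    and iso: "order_isomorphic (compact_gdeltas X) (\<supseteq>) (compact_gdeltas Y) (\<supseteq>)"
  shows "X homeomorphic_space Y"
proof -
  obtain \<phi> where \<phi>: "bij_betw \<phi> (compact_gdeltas X) (compact_gdeltas Y)"
    and mono: "\<And>F G. F \<in> compact_gdeltas X \<Longrightarrow> G \<in> compact_gdeltas X \<Longrightarrow> G \<subseteq> F \<longleftrightarrow> \<phi> G \<subseteq> \<phi> F"
    using order_isomorphicE[OF iso] by blast
  define \<psi> where "\<psi> = inv_into (compact_gdeltas X) \<phi>"
  have \<psi>: "bij_betw \<psi> (compact_gdeltas Y) (compact_gdeltas X)"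
    unfolding \<psi>_def by (rule bij_betw_inv_into[OF \<phi>])
  have \<phi>\<psi>: "\<phi> (\<psi> G) = G" if "G \<in> compact_gdeltas Y" for G
    unfolding \<psi>_def by (rule bij_betw_inv_into_right[OF \<phi> that])
  have \<psi>\<phi>: "\<psi> (\<phi> F) = F" if "F \<in> compact_gdeltas X" for F
    unfolding \<psi>_def by (rule bij_betw_inv_into_left[OF \<phi> that])
  have mono': "F \<subseteq> G \<longleftrightarrow> \<psi> F \<subseteq> \<psi> G" if "F \<in> compact_gdeltas Y" "G \<in> compact_gdeltas Y" for F G
    using mono[OF bij_betw_apply[OF \<psi> that(2)] bij_betw_apply[OF \<psi> that(1)]] \<phi>\<psi> that by simp
  obtain h where h: "continuous_map X Y h"
    "\<And>x F. x \<in> topspace X \<Longrightarrow> F \<in> compact_gdeltas X \<Longrightarrow> x \<in> F \<longleftrightarrow> h x \<in> \<phi> F"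
    using compact_gdeltas_iso_continuous_map[OF X Y \<phi> mono[rotated]] by blast
  obtain k where k: "continuous_map Y X k"
    "\<And>y G. y \<in> topspace Y \<Longrightarrow> G \<in> compact_gdeltas Y \<Longrightarrow> y \<in> G \<longleftrightarrow> k y \<in> \<psi> G"
    using compact_gdeltas_iso_continuous_map[OF Y X \<psi> mono'] by blast
  have hY: "h x \<in> topspace Y" if "x \<in> topspace X" for x
    using h(1) that by (auto simp: continuous_map_def)
  have kX: "k y \<in> topspace X" if "y \<in> topspace Y" for y
    using k(1) that by (auto simp: continuous_map_def)
  have "k (h x) = x" if x: "x \<in> topspace X" for x
  proof (rule ccontr)
    assume "k (h x) \<noteq> x"
    then obtain F G where "F \<in> compact_gdeltas X" "k (h x) \<in> F" "x \<in> G" "F \<inter> G = {}"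
      using compact_gdeltas_separate[OF X kX[OF hY[OF x]] x] by metis
    then show False
      using h(2)[OF x] k(2)[OF hY[OF x] bij_betw_apply[OF \<phi>]] \<psi>\<phi> by auto
  qed
  moreover have "h (k y) = y" if y: "y \<in> topspace Y" for y
  proof (rule ccontr)
    assume "h (k y) \<noteq> y"
    then obtain F G where "F \<in> compact_gdeltas Y" "h (k y) \<in> F" "y \<in> G" "F \<inter> G = {}"
      using compact_gdeltas_separate[OF Y hY[OF kX[OF y]] y] by metis
    then show False
      using k(2)[OF y] h(2)[OF kX[OF y] bij_betw_apply[OF \<psi>]] \<phi>\<psi> by auto
  qed
  ultimately show ?thesis
    using h(1) k(1) unfolding homeomorphic_space_def homeomorphic_maps_def by blast
qed

section \<open>Passing between \<sigma>-compact open sets and compact G-deltas\<close>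

lemma sigma_compactin_Diff_gdelta:
  assumes "compactin X K" "gdelta_in X F"
  shows "sigma_compactin X (K - F)"
proof -
  have "fsigma_in X (topspace X - F)"
    using assms(2) by (simp add: gdelta_in_fsigma_in)
  then obtain \<C> where \<C>: "countable \<C>" "\<forall>C\<in>\<C>. closedin X C" "\<Union>\<C> = topspace X - F"
    unfolding fsigma_in_def by (rule countable_union_ofE)
  have K: "K \<subseteq> topspace X" using assms(1) by (rule compactin_subset_topspace)
  show ?thesis
  proof (rule countable_union_ofI)
    show "countable ((\<inter>) K ` \<C>)" using \<C>(1) by (rule countable_image)
    show "compactin X C" if "C \<in> (\<inter>) K ` \<C>" for C
      using that \<C>(2) assms(1) by (auto intro: compact_Int_closedin)
    have "\<Union>((\<inter>) K ` \<C>) = K \<inter> \<Union>\<C>" by (rule Int_Union[symmetric])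
    then show "\<Union>((\<inter>) K ` \<C>) = K - F" using K \<C>(3) by auto
  qed
qed

lemma gdelta_in_Diff_sigma_compactin:
  assumes "Hausdorff_space X" "gdelta_in X U" "sigma_compactin X A"
  shows "gdelta_in X (U - A)"
proof -
  obtain \<K> where \<K>: "countable \<K>" "\<forall>K\<in>\<K>. compactin X K" "\<Union>\<K> = A"
    using assms(3) by (rule countable_union_ofE)
  have "fsigma_in X A"
    unfolding fsigma_in_def
    by (rule countable_union_ofI[OF \<K>(1) _ \<K>(3)]) (use \<K>(2) compactin_imp_closedin[OF assms(1)] in blast)
  with assms(2) show ?thesis by (rule gdelta_in_diff)
qed

lemma sigma_bounded_noncompact_proper:
  assumes "sigma_bounded_space X" "\<not> compact_space X" "sigma_compactin X A"
  shows "A \<noteq> topspace X"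
proof
  assume "A = topspace X"
  moreover obtain K where "compactin X K" "A \<subseteq> K"
    using sigma_bounded_imp_compact_open_superset[OF assms(1,3)] by metis
  ultimately show False
    using assms(2) compactin_subset_topspace unfolding compact_space_def by (metis subset_antisym)
qed

lemma proper_sigma_opens_noncompact:
  assumes "sigma_bounded_space X" "\<not> compact_space X"
  shows "proper_sigma_opens X = {A. openin X A \<and> sigma_compactin X A}"
  using sigma_bounded_noncompact_proper[OF assms] by (auto simp: proper_sigma_opens_def)

lemma compl_compact_gdelta:
  assumes H: "Hausdorff_space X" and cpt: "compact_space X" and "F \<in> compact_gdeltas X"
  shows "topspace X - F \<in> proper_sigma_opens X"
proof -
  have F: "compactin X F" "gdelta_in X F" "F \<noteq> {}" "F \<subseteq> topspace X"
    using assms(3) gdelta_in_subset by (auto simp: compact_gdeltas_def)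
  then show ?thesis
    using cpt sigma_compactin_Diff_gdelta[of X "topspace X" F] compactin_imp_closedin[OF H F(1)]
    unfolding proper_sigma_opens_def compact_space_def by auto
qed

text \<open>In a compact Hausdorff space complementation exchanges \<sigma>-compact open sets with
  compact G-deltas, and properness with nonemptiness.\<close>

lemma proper_sigma_opens_compact:
  assumes H: "Hausdorff_space X" and cpt: "compact_space X"
  shows "order_isomorphic (proper_sigma_opens X) (\<subseteq>) (compact_gdeltas X) (\<supseteq>)"
proof -
  have 1: "topspace X - A \<in> compact_gdeltas X \<and> A \<subseteq> topspace X" if "A \<in> proper_sigma_opens X" for A
  proof -
    have A: "openin X A" "sigma_compactin X A" "A \<noteq> topspace X" "A \<subseteq> topspace X"
      using that openin_subset by (auto simp: proper_sigma_opens_def)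
    then have "compactin X (topspace X - A)"
      by (intro closedin_compact_space[OF cpt]) blast
    then show ?thesis
      using A(3,4) gdelta_in_Diff_sigma_compactin[OF H gdelta_in_topspace A(2)]
      by (auto simp: compact_gdeltas_def)
  qed
  have 2: "topspace X - F \<in> proper_sigma_opens X \<and> F \<subseteq> topspace X" if "F \<in> compact_gdeltas X" for F
    using compl_compact_gdelta[OF H cpt that] that by (simp add: compact_gdeltas_def gdelta_in_subset)
  have "bij_betw ((-) (topspace X)) (proper_sigma_opens X) (compact_gdeltas X)"
    by (rule bij_betw_byWitness[where f' = "(-) (topspace X)"])
      (use 1 2 in \<open>simp_all add: image_subset_iff double_diff\<close>)
  moreover have "A \<subseteq> B \<longleftrightarrow> topspace X - A \<supseteq> topspace X - B"
    if "A \<in> proper_sigma_opens X" "B \<in> proper_sigma_opens X" for A B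
    using 1 that by blast
  ultimately show ?thesis unfolding order_isomorphic_iff by blast
qed

text \<open>The right side mentions only the order, so it is preserved by isomorphisms. A noncompact
  space has all unions of two members, and any member can be enlarged by a further point and a
  compact open superset. In a compact space disjoint compact G-deltas have complements without a
  common proper upper bound.\<close>

lemma compact_space_iff_proper_sigma_opens:
  assumes X: "sigma_bounded_space X"
  shows "\<not> compact_space X \<longleftrightarrow> proper_sigma_opens X \<noteq> {} \<and>
           (\<forall>A\<in>proper_sigma_opens X. \<forall>B\<in>proper_sigma_opens X. \<exists>C\<in>proper_sigma_opens X. A \<subseteq> C \<and> B \<subseteq> C) \<and>
           (\<forall>A\<in>proper_sigma_opens X. \<exists>B\<in>proper_sigma_opens X. A \<subseteq> B \<and> \<not> B \<subseteq> A)"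
    (is "_ \<longleftrightarrow> ?nonempty \<and> ?directed \<and> ?nomax")
proof
  assume nc: "\<not> compact_space X"
  note pso = proper_sigma_opens_noncompact[OF X nc]
  have ?nonempty unfolding pso by (auto intro: exI[of _ "{}"])
  moreover have ?directed
  proof (intro ballI)
    fix A B assume "A \<in> proper_sigma_opens X" "B \<in> proper_sigma_opens X"
    then have "A \<union> B \<in> proper_sigma_opens X"
      unfolding pso by (simp add: openin_Un countable_union_of_Un)
    then show "\<exists>C\<in>proper_sigma_opens X. A \<subseteq> C \<and> B \<subseteq> C" by blast
  qed
  moreover have ?nomax
  proof
    fix A assume A: "A \<in> proper_sigma_opens X"
    then have "A \<subseteq> topspace X" "A \<noteq> topspace X" and sc: "sigma_compactin X A"
      using openin_subset by (auto simp: proper_sigma_opens_def)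
    then obtain x where x: "x \<in> topspace X" "x \<notin> A" by blast
    have "sigma_compactin X (A \<union> {x})"
      using sc x(1) by (intro countable_union_of_Un[OF sc] countable_union_of_inc) simp
    then obtain K where K: "compactin X K" "openin X K" "A \<union> {x} \<subseteq> K"
      by (rule sigma_bounded_imp_compact_open_superset[OF X])
    then have "K \<in> proper_sigma_opens X" unfolding pso by (simp add: countable_union_of_inc)
    then show "\<exists>B\<in>proper_sigma_opens X. A \<subseteq> B \<and> \<not> B \<subseteq> A" using K(3) x(2) by blast
  qed
  ultimately show "?nonempty \<and> ?directed \<and> ?nomax" by blast
next
  assume R: "?nonempty \<and> ?directed \<and> ?nomax"
  show "\<not> compact_space X"
  proof
    assume cpt: "compact_space X"
    have H: "Hausdorff_space X" using X by (rule sigma_bounded_imp_Hausdorff)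
    have proper: "A \<subseteq> topspace X \<and> A \<noteq> topspace X" if "A \<in> proper_sigma_opens X" for A
      using that openin_subset by (auto simp: proper_sigma_opens_def)
    \<comment> \<open>Directedness thus leaves at most one point. The poset is then empty or
      consists of the empty set alone, which nonemptiness and the absence of maximal members
      exclude.\<close>
    have single: "x = y" if xy: "x \<in> topspace X" "y \<in> topspace X" for x y
    proof (rule ccontr)
      assume "x \<noteq> y"
      then obtain F G where FG: "F \<in> compact_gdeltas X" "G \<in> compact_gdeltas X" "F \<inter> G = {}"
        using compact_gdeltas_separate[OF X xy] by metis
      then obtain C where "C \<in> proper_sigma_opens X" "topspace X - F \<subseteq> C" "topspace X - G \<subseteq> C"
        using R compl_compact_gdelta[OF H cpt] by meson
      then show False using FG(3) proper by blast
    qed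
    obtain A where A: "A \<in> proper_sigma_opens X" using conjunct1[OF R] by blast
    obtain B where B: "B \<in> proper_sigma_opens X" "A \<subseteq> B" "\<not> B \<subseteq> A"
      using bspec[OF conjunct2[OF conjunct2[OF R]] A] by blast
    then have "B = topspace X" using proper[OF B(1)] single by blast
    then show False using proper[OF B(1)] by blast
  qed
qed

lemma compact_space_proper_sigma_opens_iso:
  assumes "sigma_bounded_space X" "sigma_bounded_space Y"
    and "order_isomorphic (proper_sigma_opens X) (\<subseteq>) (proper_sigma_opens Y) (\<subseteq>)"
    and "compact_space Y"
  shows "compact_space X"
proof (rule ccontr)
  obtain \<phi> where \<phi>: "bij_betw \<phi> (proper_sigma_opens X) (proper_sigma_opens Y)"
    and mono: "\<And>A B. A \<in> proper_sigma_opens X \<Longrightarrow> B \<in> proper_sigma_opens X \<Longrightarrow> A \<subseteq> B \<longleftrightarrow> \<phi> A \<subseteq> \<phi> B"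
    using order_isomorphicE[OF assms(3)] by blast
  have surj: "\<phi> ` proper_sigma_opens X = proper_sigma_opens Y"
    by (rule bij_betw_imp_surj_on[OF \<phi>])
  assume "\<not> compact_space X"
  then have X: "proper_sigma_opens X \<noteq> {}"
    "\<forall>A\<in>proper_sigma_opens X. \<forall>B\<in>proper_sigma_opens X. \<exists>C\<in>proper_sigma_opens X. A \<subseteq> C \<and> B \<subseteq> C"
    "\<forall>A\<in>proper_sigma_opens X. \<exists>B\<in>proper_sigma_opens X. A \<subseteq> B \<and> \<not> B \<subseteq> A"
    unfolding compact_space_iff_proper_sigma_opens[OF assms(1)] by simp_all
  have "\<exists>C\<in>proper_sigma_opens X. \<phi> A \<subseteq> \<phi> C \<and> \<phi> B \<subseteq> \<phi> C"
    if "A \<in> proper_sigma_opens X" "B \<in> proper_sigma_opens X" for A B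
    using bspec[OF bspec[OF X(2) that(1)] that(2)] mono that by blast
  moreover have "\<exists>B\<in>proper_sigma_opens X. \<phi> A \<subseteq> \<phi> B \<and> \<not> \<phi> B \<subseteq> \<phi> A"
    if "A \<in> proper_sigma_opens X" for A
    using bspec[OF X(3) that] mono that by blast
  ultimately have "\<not> compact_space Y"
    using X(1) unfolding compact_space_iff_proper_sigma_opens[OF assms(2)] surj[symmetric]
    by (intro conjI) simp_all
  then show False using assms(4) by blast
qed

text \<open>In a noncompact space the compact open sets are the members that are complemented below every
  larger member, so an order isomorphism preserves them.\<close>

lemma compactin_iff_complemented:
  assumes X: "sigma_bounded_space X" and nc: "\<not> compact_space X" and K: "K \<in> proper_sigma_opens X"
  shows "compactin X K \<longleftrightarrow>
    (\<forall>C\<in>proper_sigma_opens X. K \<subseteq> C \<longrightarrow> (\<exists>D\<in>proper_sigma_opens X. D \<inter> K = {} \<and> D \<union> K = C))"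
proof
  note pso = proper_sigma_opens_noncompact[OF X nc]
  have Kop: "openin X K" using K by (simp add: pso)
  show "\<forall>C\<in>proper_sigma_opens X. K \<subseteq> C \<longrightarrow> (\<exists>D\<in>proper_sigma_opens X. D \<inter> K = {} \<and> D \<union> K = C)"
    if cK: "compactin X K"
  proof (intro ballI impI)
    fix C assume C: "C \<in> proper_sigma_opens X" "K \<subseteq> C"
    then have "openin X (C - K)"
      using compactin_imp_closedin[OF sigma_bounded_imp_Hausdorff[OF X] cK] by (simp add: pso openin_diff)
    moreover have "sigma_compactin X (C \<inter> (topspace X - K))"
      using C Kop by (intro sigma_compactin_Int_closedin) (auto simp: pso)
    moreover have "C \<inter> (topspace X - K) = C - K"
      using C openin_subset by (auto simp: pso)
    ultimately show "\<exists>D\<in>proper_sigma_opens X. D \<inter> K = {} \<and> D \<union> K = C"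
      using C by (intro bexI[of _ "C - K"]) (auto simp: pso)
  qed
  assume R: "\<forall>C\<in>proper_sigma_opens X. K \<subseteq> C \<longrightarrow> (\<exists>D\<in>proper_sigma_opens X. D \<inter> K = {} \<and> D \<union> K = C)"
  have "sigma_compactin X K" using K by (simp add: pso)
  \<comment> \<open>Testing the condition on one compact open superset suffices: the relative
    complement \<open>D\<close> of \<open>K\<close> is open, so \<open>K\<close> is a closed part of
    a compact set.\<close>
  then obtain L where L: "compactin X L" "openin X L" "K \<subseteq> L"
    by (rule sigma_bounded_imp_compact_open_superset[OF X])
  then have "L \<in> proper_sigma_opens X" by (simp add: pso countable_union_of_inc)
  then obtain D where D: "D \<in> proper_sigma_opens X" "D \<inter> K = {}" "D \<union> K = L"
    using R L(3) by meson
  have "compactin X (L \<inter> (topspace X - D))"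
    using L(1) D(1) by (intro compact_Int_closedin) (auto simp: pso)
  moreover have "L \<inter> (topspace X - D) = K"
    using D compactin_subset_topspace[OF L(1)] by blast
  ultimately show "compactin X K" by simp
qed

text \<open>The isomorphism is carried over to compact G-deltas by writing each of them as a
  difference of members, after which the reconstruction from compact G-deltas applies.\<close>

lemma proper_sigma_opens_isomorphic_imp_homeomorphic_noncompact:
  assumes X: "sigma_bounded_space X" and Y: "sigma_bounded_space Y"
    and ncX: "\<not> compact_space X" and ncY: "\<not> compact_space Y"
    and iso: "order_isomorphic (proper_sigma_opens X) (\<subseteq>) (proper_sigma_opens Y) (\<subseteq>)"
  shows "X homeomorphic_space Y"
proof -
  note psoX = proper_sigma_opens_noncompact[OF X ncX]
  note psoY = proper_sigma_opens_noncompact[OF Y ncY]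
  have HX: "Hausdorff_space X" and HY: "Hausdorff_space Y"
    using X Y sigma_bounded_imp_Hausdorff by auto
  have UnX: "A \<union> B \<in> proper_sigma_opens X" "A \<inter> B \<in> proper_sigma_opens X"
    if "A \<in> proper_sigma_opens X" "B \<in> proper_sigma_opens X" for A B
    using that HX by (simp_all add: psoX openin_Un openin_Int countable_union_of_Un sigma_compactin_Int)
  have UnY: "A \<union> B \<in> proper_sigma_opens Y" "A \<inter> B \<in> proper_sigma_opens Y"
    if "A \<in> proper_sigma_opens Y" "B \<in> proper_sigma_opens Y" for A B
    using that HY by (simp_all add: psoY openin_Un openin_Int countable_union_of_Un sigma_compactin_Int)
  have emptyX: "{} \<in> proper_sigma_opens X" and emptyY: "{} \<in> proper_sigma_opens Y"
    by (simp_all add: psoX psoY)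
  obtain \<phi> where \<phi>: "bij_betw \<phi> (proper_sigma_opens X) (proper_sigma_opens Y)"
    and mono: "\<And>A B. A \<in> proper_sigma_opens X \<Longrightarrow> B \<in> proper_sigma_opens X \<Longrightarrow> A \<subseteq> B \<longleftrightarrow> \<phi> A \<subseteq> \<phi> B"
    using order_isomorphicE[OF iso] by blast
  have \<phi>in: "\<phi> A \<in> proper_sigma_opens Y" if "A \<in> proper_sigma_opens X" for A
    using bij_betw_apply[OF \<phi> that] .
  have surj: "\<exists>A\<in>proper_sigma_opens X. \<phi> A = B" if "B \<in> proper_sigma_opens Y" for B
    using bij_betw_imp_surj_on[OF \<phi>] that by (metis imageE)
  \<comment> \<open>The poset is closed under unions and intersections, so these are its joins and
    meets and are preserved by \<open>\<phi>\<close>.\<close>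
  have \<phi>Un: "\<phi> (A \<union> B) = \<phi> A \<union> \<phi> B" if AB: "A \<in> proper_sigma_opens X" "B \<in> proper_sigma_opens X" for A B
  proof
    obtain C where C: "C \<in> proper_sigma_opens X" "\<phi> C = \<phi> A \<union> \<phi> B"
      using surj[OF UnY(1)[OF \<phi>in[OF AB(1)] \<phi>in[OF AB(2)]]] by blast
    then have "A \<union> B \<subseteq> C" using mono[OF AB(1) C(1)] mono[OF AB(2) C(1)] by simp
    then show "\<phi> (A \<union> B) \<subseteq> \<phi> A \<union> \<phi> B"
      using mono[OF UnX(1)[OF AB] C(1)] C(2) by simp
    show "\<phi> A \<union> \<phi> B \<subseteq> \<phi> (A \<union> B)"
      using mono[OF AB(1) UnX(1)[OF AB]] mono[OF AB(2) UnX(1)[OF AB]] by simp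
  qed
  have \<phi>Int: "\<phi> (A \<inter> B) = \<phi> A \<inter> \<phi> B" if AB: "A \<in> proper_sigma_opens X" "B \<in> proper_sigma_opens X" for A B
  proof
    obtain C where C: "C \<in> proper_sigma_opens X" "\<phi> C = \<phi> A \<inter> \<phi> B"
      using surj[OF UnY(2)[OF \<phi>in[OF AB(1)] \<phi>in[OF AB(2)]]] by blast
    then have "C \<subseteq> A \<inter> B" using mono[OF C(1) AB(1)] mono[OF C(1) AB(2)] by simp
    then show "\<phi> A \<inter> \<phi> B \<subseteq> \<phi> (A \<inter> B)"
      using mono[OF C(1) UnX(2)[OF AB]] C(2) by simp
    show "\<phi> (A \<inter> B) \<subseteq> \<phi> A \<inter> \<phi> B"
      using mono[OF UnX(2)[OF AB] AB(1)] mono[OF UnX(2)[OF AB] AB(2)] by simp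
  qed
  have \<phi>empty: "\<phi> {} = {}"
    using surj[OF emptyY] mono[OF emptyX] by fastforce
  have \<phi>eq: "A = B \<longleftrightarrow> \<phi> A = \<phi> B" if "A \<in> proper_sigma_opens X" "B \<in> proper_sigma_opens X" for A B
    using bij_betw_imp_inj_on[OF \<phi>] that by (auto dest: inj_onD)
  have \<phi>compact: "compactin X K \<longleftrightarrow> compactin Y (\<phi> K)" if K: "K \<in> proper_sigma_opens X" for K
  proof -
    have *: "D \<inter> K = {} \<longleftrightarrow> \<phi> D \<inter> \<phi> K = {}" "D \<union> K = C \<longleftrightarrow> \<phi> D \<union> \<phi> K = \<phi> C" 
      if "C \<in> proper_sigma_opens X" "D \<in> proper_sigma_opens X" for C D
      using \<phi>eq[OF UnX(2)[OF that(2) K] emptyX] \<phi>eq[OF UnX(1)[OF that(2) K] that(1)]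
        \<phi>Int[OF that(2) K] \<phi>Un[OF that(2) K] \<phi>empty by simp_all
    have "compactin Y (\<phi> K) \<longleftrightarrow> (\<forall>C\<in>proper_sigma_opens X. \<phi> K \<subseteq> \<phi> C \<longrightarrow>
            (\<exists>D\<in>proper_sigma_opens X. \<phi> D \<inter> \<phi> K = {} \<and> \<phi> D \<union> \<phi> K = \<phi> C))"
      unfolding compactin_iff_complemented[OF Y ncY \<phi>in[OF K]]
        bij_betw_imp_surj_on[OF \<phi>, symmetric] by simp
    also have "\<dots> \<longleftrightarrow> compactin X K"
      unfolding compactin_iff_complemented[OF X ncX K] using * mono[OF K] by simp
    finally show ?thesis by simp
  qed
  \<comment> \<open>Inclusion of differences is a lattice statement. Hence a difference of images
    depends only on the difference, not on the sets that represent it.\<close>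
  have key: "K - A \<subseteq> L - B \<longleftrightarrow> \<phi> K - \<phi> A \<subseteq> \<phi> L - \<phi> B"
    if "K \<in> proper_sigma_opens X" "A \<in> proper_sigma_opens X"
       "L \<in> proper_sigma_opens X" "B \<in> proper_sigma_opens X" for K A L B
  proof -
    have "K - A \<subseteq> L - B \<longleftrightarrow> K \<subseteq> A \<union> L \<and> K \<inter> B \<subseteq> A" by blast
    also have "\<dots> \<longleftrightarrow> \<phi> K \<subseteq> \<phi> A \<union> \<phi> L \<and> \<phi> K \<inter> \<phi> B \<subseteq> \<phi> A"
      using mono[OF that(1) UnX(1)[OF that(2,3)]] mono[OF UnX(2)[OF that(1,4)] that(2)]
        \<phi>Un[OF that(2,3)] \<phi>Int[OF that(1,4)] by simp
    also have "\<dots> \<longleftrightarrow> \<phi> K - \<phi> A \<subseteq> \<phi> L - \<phi> B" by blast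
    finally show ?thesis .
  qed
  have diff: "K - A \<in> compact_gdeltas Z"
    if "Hausdorff_space Z" "compactin Z K" "openin Z K" "openin Z A" "sigma_compactin Z A" "K - A \<noteq> {}"
    for Z :: "'z topology" and K A
  proof -
    have "compactin Z (K \<inter> (topspace Z - A))"
      using that by (intro compact_Int_closedin) auto
    moreover have "K \<inter> (topspace Z - A) = K - A"
      using compactin_subset_topspace[OF that(2)] by blast
    ultimately show ?thesis
      using gdelta_in_Diff_sigma_compactin[OF that(1) open_imp_gdelta_in[OF that(3)] that(5)] that(6)
      by (simp add: compact_gdeltas_def)
  qed
  have cover: "\<exists>K. compactin Z K \<and> openin Z K \<and> openin Z (K - F) \<and> sigma_compactin Z (K - F) \<and> F \<subseteq> K"
    if Z: "sigma_bounded_space Z" and F: "F \<in> compact_gdeltas Z"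
    for Z :: "'z topology" and F
  proof -
    have F': "compactin Z F" "gdelta_in Z F" using F by (auto simp: compact_gdeltas_def)
    obtain K where K: "compactin Z K" "openin Z K" "F \<subseteq> K"
      by (rule sigma_bounded_imp_compact_open_superset[OF Z countable_union_of_inc[of "compactin Z", OF F'(1)]])
    moreover have "openin Z (K - F)"
      using K(2) compactin_imp_closedin[OF sigma_bounded_imp_Hausdorff[OF Z] F'(1)] by (rule openin_diff)
    ultimately show ?thesis using sigma_compactin_Diff_gdelta[OF K(1) F'(2)] by blast
  qed
  have "\<forall>F\<in>compact_gdeltas X. \<exists>K. compactin X K \<and> K \<in> proper_sigma_opens X \<and> K - F \<in> proper_sigma_opens X \<and> F \<subseteq> K"
  proof
    fix F assume "F \<in> compact_gdeltas X"
    from cover[OF X this] show "\<exists>K. compactin X K \<and> K \<in> proper_sigma_opens X \<and> K - F \<in> proper_sigma_opens X \<and> F \<subseteq> K"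
      unfolding psoX using countable_union_of_inc[of "compactin X"] by blast
  qed
  then obtain \<kappa> where \<kappa>: "\<And>F. F \<in> compact_gdeltas X \<Longrightarrow> compactin X (\<kappa> F)"
    "\<And>F. F \<in> compact_gdeltas X \<Longrightarrow> \<kappa> F \<in> proper_sigma_opens X"
    "\<And>F. F \<in> compact_gdeltas X \<Longrightarrow> \<kappa> F - F \<in> proper_sigma_opens X"
    "\<And>F. F \<in> compact_gdeltas X \<Longrightarrow> F \<subseteq> \<kappa> F" by metis
  \<comment> \<open>The choice of \<open>\<kappa> F\<close> is immaterial by \<open>key\<close>; it
    merely provides one representation of \<open>F\<close> as a difference.\<close>
  define \<psi> where "\<psi> F = \<phi> (\<kappa> F) - \<phi> (\<kappa> F - F)" for F
  have \<kappa>id: "\<kappa> F - (\<kappa> F - F) = F" if "F \<in> compact_gdeltas X" for F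
    using \<kappa>(4)[OF that] by blast
  have \<psi>mono: "F \<subseteq> G \<longleftrightarrow> \<psi> F \<subseteq> \<psi> G" if "F \<in> compact_gdeltas X" "G \<in> compact_gdeltas X" for F G
    using key[OF \<kappa>(2,3)[OF that(1)] \<kappa>(2,3)[OF that(2)]] \<kappa>id[OF that(1)] \<kappa>id[OF that(2)]
    by (simp add: \<psi>_def)
  have \<psi>in: "\<psi> F \<in> compact_gdeltas Y" if F: "F \<in> compact_gdeltas X" for F
    unfolding \<psi>_def
  proof (rule diff[OF HY])
    show "compactin Y (\<phi> (\<kappa> F))" using \<phi>compact[OF \<kappa>(2)[OF F]] \<kappa>(1)[OF F] by simp
    show "openin Y (\<phi> (\<kappa> F))" using \<phi>in[OF \<kappa>(2)[OF F]] by (simp add: psoY)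
    show "openin Y (\<phi> (\<kappa> F - F))" "sigma_compactin Y (\<phi> (\<kappa> F - F))"
      using \<phi>in[OF \<kappa>(3)[OF F]] by (simp_all add: psoY)
    have "F \<noteq> {}" using F by (simp add: compact_gdeltas_def)
    then have "\<not> \<kappa> F \<subseteq> \<kappa> F - F" using \<kappa>(4)[OF F] by blast
    then show "\<phi> (\<kappa> F) - \<phi> (\<kappa> F - F) \<noteq> {}"
      using mono[OF \<kappa>(2,3)[OF F]] by blast
  qed
  have \<psi>surj: "\<exists>F\<in>compact_gdeltas X. \<psi> F = G" if G: "G \<in> compact_gdeltas Y" for G
  proof -
    obtain K' where K': "compactin Y K'" "openin Y K'" "openin Y (K' - G)" "sigma_compactin Y (K' - G)" "G \<subseteq> K'"
      using cover[OF Y G] by blast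
    then have "K' \<in> proper_sigma_opens Y" "K' - G \<in> proper_sigma_opens Y"
      by (auto simp: psoY countable_union_of_inc)
    then obtain K A where K: "K \<in> proper_sigma_opens X" "\<phi> K = K'"
      and A: "A \<in> proper_sigma_opens X" "\<phi> A = K' - G"
      using surj by metis
    have \<phi>KA: "\<phi> K - \<phi> A = G" using K A K'(5) by blast
    have "\<not> K \<subseteq> A"
      using mono[OF K(1) A(1)] \<phi>KA G by (auto simp: compact_gdeltas_def)
    then have F: "K - A \<in> compact_gdeltas X"
      using K A K'(1) \<phi>compact[OF K(1)] by (intro diff[OF HX]) (auto simp: psoX)
    \<comment> \<open>The chosen representation of \<open>K - A\<close> need not be \<open>K\<close>
      and \<open>A\<close> themselves; applying \<open>key\<close> in both directions identifies the
      two images.\<close>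
    have "\<psi> (K - A) = \<phi> K - \<phi> A"
    proof
      show "\<psi> (K - A) \<subseteq> \<phi> K - \<phi> A"
        unfolding \<psi>_def using key[OF \<kappa>(2,3)[OF F] K(1) A(1)] \<kappa>id[OF F] by simp
      show "\<phi> K - \<phi> A \<subseteq> \<psi> (K - A)"
        unfolding \<psi>_def using key[OF K(1) A(1) \<kappa>(2,3)[OF F]] \<kappa>id[OF F] by simp
    qed
    then show ?thesis using F \<phi>KA by blast
  qed
  have "bij_betw \<psi> (compact_gdeltas X) (compact_gdeltas Y)"
    unfolding bij_betw_def
  proof
    show "inj_on \<psi> (compact_gdeltas X)"
      by (rule inj_onI) (metis \<psi>mono subset_antisym subset_refl)
    show "\<psi> ` compact_gdeltas X = compact_gdeltas Y"
    proof
      show "\<psi> ` compact_gdeltas X \<subseteq> compact_gdeltas Y" using \<psi>in by (rule image_subsetI)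
      show "compact_gdeltas Y \<subseteq> \<psi> ` compact_gdeltas X" using \<psi>surj by (metis imageI subsetI)
    qed
  qed
  then have "order_isomorphic (compact_gdeltas X) (\<supseteq>) (compact_gdeltas Y) (\<supseteq>)"
    unfolding order_isomorphic_iff using \<psi>mono by (intro exI[of _ \<psi>]) simp
  then show ?thesis by (rule compact_gdeltas_isomorphic_imp_homeomorphic[OF X Y])
qed

lemma proper_sigma_opens_isomorphic_imp_homeomorphic:
  assumes X: "sigma_bounded_space X" and Y: "sigma_bounded_space Y"
    and iso: "order_isomorphic (proper_sigma_opens X) (\<subseteq>) (proper_sigma_opens Y) (\<subseteq>)"
  shows "X homeomorphic_space Y"
proof (cases "compact_space X")
  case True
  then have "compact_space Y"
    using compact_space_proper_sigma_opens_iso[OF Y X order_isomorphic_sym[OF iso]] by blast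
  then have "order_isomorphic (proper_sigma_opens Y) (\<subseteq>) (compact_gdeltas Y) (\<supseteq>)"
    by (rule proper_sigma_opens_compact[OF sigma_bounded_imp_Hausdorff[OF Y]])
  with iso have "order_isomorphic (proper_sigma_opens X) (\<subseteq>) (compact_gdeltas Y) (\<supseteq>)"
    by (rule order_isomorphic_trans)
  with order_isomorphic_sym[OF proper_sigma_opens_compact[OF sigma_bounded_imp_Hausdorff[OF X] True]]
  have "order_isomorphic (compact_gdeltas X) (\<supseteq>) (compact_gdeltas Y) (\<supseteq>)"
    by (rule order_isomorphic_trans)
  then show ?thesis by (rule compact_gdeltas_isomorphic_imp_homeomorphic[OF X Y])
next
  case False
  then have "\<not> compact_space Y"
    using compact_space_proper_sigma_opens_iso[OF X Y iso] by blast
  then show ?thesis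
    using proper_sigma_opens_isomorphic_imp_homeomorphic_noncompact[OF X Y False _ iso] by blast
qed

section \<open>Locally compact paracompact spaces\<close>

lemma locally_finite_meets_compactin:
  assumes lf: "locally_finite_in X \<V>" and K: "compactin X K"
  shows "finite {V \<in> \<V>. V \<inter> K \<noteq> {}}"
proof -
  define \<N> where "\<N> = {N. openin X N \<and> finite {V \<in> \<V>. V \<inter> N \<noteq> {}}}"
  have "K \<subseteq> \<Union>\<N>"
  proof
    fix x assume "x \<in> K"
    then have "x \<in> topspace X" using compactin_subset_topspace[OF K] by blast
    then obtain N where "openin X N" "x \<in> N" "finite {V \<in> \<V>. V \<inter> N \<noteq> {}}"
      using lf unfolding locally_finite_in_def by meson
    then show "x \<in> \<Union>\<N>" unfolding \<N>_def by blast
  qed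
  then obtain \<F> where \<F>: "finite \<F>" "\<F> \<subseteq> \<N>" "K \<subseteq> \<Union>\<F>"
    using compactinD[OF K, of \<N>] unfolding \<N>_def by blast
  have "{V \<in> \<V>. V \<inter> K \<noteq> {}} \<subseteq> (\<Union>N\<in>\<F>. {V \<in> \<V>. V \<inter> N \<noteq> {}})"
    using \<F>(3) by blast
  moreover have "finite (\<Union>N\<in>\<F>. {V \<in> \<V>. V \<inter> N \<noteq> {}})"
    using \<F>(1,2) by (intro finite_UN_I) (auto simp: \<N>_def)
  ultimately show ?thesis by (rule finite_subset)
qed

lemma locally_finite_meets_sigma_compactin:
  assumes lf: "locally_finite_in X \<V>" and A: "sigma_compactin X A"
  shows "countable {V \<in> \<V>. V \<inter> A \<noteq> {}}"
proof -
  obtain \<K> where \<K>: "countable \<K>" "\<forall>K\<in>\<K>. compactin X K" "\<Union>\<K> = A"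
    using A by (rule countable_union_ofE)
  have "{V \<in> \<V>. V \<inter> A \<noteq> {}} = (\<Union>K\<in>\<K>. {V \<in> \<V>. V \<inter> K \<noteq> {}})"
    unfolding \<K>(3)[symmetric] by auto
  moreover have "countable (\<Union>K\<in>\<K>. {V \<in> \<V>. V \<inter> K \<noteq> {}})"
    using \<K>(1,2) locally_finite_meets_compactin[OF lf] by (intro countable_UN) (auto simp: countable_finite)
  ultimately show ?thesis by simp
qed

lemma paracompact_refinement:
  assumes "paracompact_space X" "\<forall>U\<in>\<U>. openin X U" "\<Union>\<U> = topspace X"
  obtains \<V> where "\<forall>V\<in>\<V>. openin X V" "\<Union>\<V> = topspace X" "\<forall>V\<in>\<V>. \<exists>U\<in>\<U>. V \<subseteq> U"
    "locally_finite_in X \<V>"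
proof -
  have "\<forall>\<U>. (\<forall>U\<in>\<U>. openin X U) \<and> \<Union>\<U> = topspace X \<longrightarrow>
       (\<exists>\<V>. (\<forall>V\<in>\<V>. openin X V) \<and> \<Union>\<V> = topspace X \<and>
            (\<forall>V\<in>\<V>. \<exists>U\<in>\<U>. V \<subseteq> U) \<and> locally_finite_in X \<V>)"
    using assms(1) unfolding paracompact_space_def by (rule conjunct2)
  from mp[OF spec[OF this] conjI[OF assms(2,3)]] show ?thesis
    by (elim exE conjE) (rule that)
qed

lemma relatively_compact_locally_finite_cover:
  assumes lc: "locally_compact_space X" and pc: "paracompact_space X"
  obtains \<V> where "\<forall>V\<in>\<V>. openin X V \<and> compactin X (X closure_of V)" "\<Union>\<V> = topspace X"
    "locally_finite_in X \<V>"
proof -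
  have H: "Hausdorff_space X" using pc by (simp add: paracompact_space_def)
  define \<U> where "\<U> = {U. openin X U \<and> compactin X (X closure_of U)}"
  have "\<forall>U\<in>\<U>. openin X U" by (simp add: \<U>_def)
  moreover have "\<Union>\<U> = topspace X"
  proof
    show "\<Union>\<U> \<subseteq> topspace X" unfolding \<U>_def using openin_subset by blast
    show "topspace X \<subseteq> \<Union>\<U>"
      using lc locally_compact_space_compact_closure_of[of X] H unfolding \<U>_def by blast
  qed
  ultimately
  obtain \<V> where \<V>: "\<forall>V\<in>\<V>. openin X V" "\<Union>\<V> = topspace X"
    "\<forall>V\<in>\<V>. \<exists>U\<in>\<U>. V \<subseteq> U" "locally_finite_in X \<V>"
    by (rule paracompact_refinement[OF pc])
  have "compactin X (X closure_of V)" if V: "V \<in> \<V>" for V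
  proof -
    obtain U where U: "U \<in> \<U>" "V \<subseteq> U" using \<V>(3) V by blast
    show ?thesis
      by (rule closed_compactin[OF _ closure_of_mono[OF U(2)] closedin_closure_of])
        (use U(1) in \<open>simp add: \<U>_def\<close>)
  qed
  then show ?thesis using that[of \<V>] \<V> by simp
qed

text \<open>Each member of the cover lies inside \<open>S\<close> or misses \<open>S\<close>, so
  both \<open>S\<close> and its complement are unions of open members.\<close>

lemma saturated_imp_clopen:
  assumes \<V>: "\<forall>V\<in>\<V>. openin X V" "\<Union>\<V> = topspace X"
    and S: "S \<subseteq> topspace X" "\<And>V. V \<in> \<V> \<Longrightarrow> V \<inter> S \<noteq> {} \<Longrightarrow> V \<subseteq> S"
  shows "openin X S" and "closedin X S"
proof -
  have "S = \<Union>{V \<in> \<V>. V \<inter> S \<noteq> {}}"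
  proof
    show "S \<subseteq> \<Union>{V \<in> \<V>. V \<inter> S \<noteq> {}}" using S(1) \<V>(2) by fast
    show "\<Union>{V \<in> \<V>. V \<inter> S \<noteq> {}} \<subseteq> S" using S(2) by blast
  qed
  moreover have "openin X (\<Union>{V \<in> \<V>. V \<inter> S \<noteq> {}})" using \<V>(1) by (intro openin_Union) simp
  ultimately show "openin X S" by simp
  have "topspace X - S = \<Union>{V \<in> \<V>. V \<inter> S = {}}"
  proof
    show "topspace X - S \<subseteq> \<Union>{V \<in> \<V>. V \<inter> S = {}}" using S(2) \<V>(2) by fast
    show "\<Union>{V \<in> \<V>. V \<inter> S = {}} \<subseteq> topspace X - S" using \<V>(2) by fast
  qed
  moreover have "openin X (\<Union>{V \<in> \<V>. V \<inter> S = {}})" using \<V>(1) by (intro openin_Union) simp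
  ultimately show "closedin X S" using S(1) by (simp add: closedin_def)
qed

text \<open>A \<sigma>-compact set meets only countably many members of a locally finite cover.
  Absorbing all members that are met, countably often, yields a saturated set that is still
  \<sigma>-compact.\<close>

lemma sigma_compact_clopen_superset:
  assumes lc: "locally_compact_space X" and pc: "paracompact_space X" and A: "sigma_compactin X A"
  obtains S where "openin X S" "closedin X S" "sigma_compactin X S" "A \<subseteq> S"
proof -
  obtain \<V> where \<V>: "\<forall>V\<in>\<V>. openin X V \<and> compactin X (X closure_of V)" "\<Union>\<V> = topspace X"
    "locally_finite_in X \<V>"
    using relatively_compact_locally_finite_cover[OF lc pc] .
  \<comment> \<open>Closures are added rather than the members themselves because they are
    compact.\<close>
  define step where "step = (\<lambda>B. B \<union> \<Union>((\<lambda>V. X closure_of V) ` {V \<in> \<V>. V \<inter> B \<noteq> {}}))"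
  define K where "K n = (step ^^ n) A" for n
  have K: "sigma_compactin X (K n)" for n
  proof (induction n)
    case (Suc n)
    have "sigma_compactin X (\<Union>((\<lambda>V. X closure_of V) ` {V \<in> \<V>. V \<inter> K n \<noteq> {}}))"
      using locally_finite_meets_sigma_compactin[OF \<V>(3) Suc] \<V>(1)
      by (intro countable_union_ofI[OF _ _ refl]) auto
    with Suc have "sigma_compactin X (step (K n))"
      unfolding step_def by (rule countable_union_of_Un)
    then show ?case by (simp add: K_def)
  qed (simp add: K_def A)
  define S where "S = (\<Union>n. K n)"
  have sc: "sigma_compactin X S"
    unfolding S_def using K by (intro countable_union_of_Union) auto
  have sat: "V \<subseteq> S" if V: "V \<in> \<V>" "V \<inter> S \<noteq> {}" for V
  proof -
    obtain n where n: "V \<inter> K n \<noteq> {}" using V(2) unfolding S_def by blast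
    have "V \<subseteq> X closure_of V" using V(1) \<V>(1) by (simp add: closure_of_subset openin_subset)
    also have "\<dots> \<subseteq> step (K n)" unfolding step_def using V(1) n by blast
    also have "step (K n) = K (Suc n)" by (simp add: K_def)
    finally show ?thesis unfolding S_def by blast
  qed
  have "S \<subseteq> topspace X" by (rule sigma_compactin_subset[OF sc])
  with sat \<V> have "openin X S" "closedin X S"
    using saturated_imp_clopen[of \<V> X S] by auto
  moreover have "A \<subseteq> S" unfolding S_def K_def by (rule SUP_upper2[of 0]) auto
  ultimately show ?thesis using that sc by blast
qed

text \<open>By relative compactness of the members, a noncompact closed set meets infinitely many of
  them. A countable choice of points in such members is \<sigma>-compact and so lies in a clopen
  \<open>S\<close>; there the infinitely many members met prevent compactness.\<close>

lemma noncompact_sigma_compact_clopen: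
  assumes lc: "locally_compact_space X" and pc: "paracompact_space X"
    and Q: "closedin X Q" "\<not> compactin X Q"
  obtains S where "openin X S" "closedin X S" "sigma_compactin X S" "\<not> compactin X (S \<inter> Q)"
proof -
  obtain \<V> where \<V>: "\<forall>V\<in>\<V>. openin X V \<and> compactin X (X closure_of V)" "\<Union>\<V> = topspace X"
    "locally_finite_in X \<V>"
    using relatively_compact_locally_finite_cover[OF lc pc] .
  have "infinite {V \<in> \<V>. V \<inter> Q \<noteq> {}}"
  proof
    assume fin: "finite {V \<in> \<V>. V \<inter> Q \<noteq> {}}"
    have "Q \<subseteq> \<Union>((\<lambda>V. X closure_of V) ` {V \<in> \<V>. V \<inter> Q \<noteq> {}})"
    proof
      fix x assume x: "x \<in> Q"
      then obtain V where V: "V \<in> \<V>" "x \<in> V" using closedin_subset[OF Q(1)] \<V>(2) by blast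
      then have "x \<in> X closure_of V" using \<V>(1) by (meson closure_of_subset openin_subset subsetD)
      then show "x \<in> \<Union>((\<lambda>V. X closure_of V) ` {V \<in> \<V>. V \<inter> Q \<noteq> {}})" using V x by blast
    qed
    moreover have "compactin X (\<Union>((\<lambda>V. X closure_of V) ` {V \<in> \<V>. V \<inter> Q \<noteq> {}}))"
      using fin \<V>(1) by (intro compactin_Union) auto
    ultimately have "compactin X Q" using closed_compactin[OF _ _ Q(1)] by blast
    with Q(2) show False ..
  qed
  from infinite_countable_subset'[OF this]
  obtain \<W> where \<W>: "\<W> \<subseteq> {V \<in> \<V>. V \<inter> Q \<noteq> {}}" "infinite \<W>" "countable \<W>"
    by (elim bexE exE conjE) (rule that)
  \<comment> \<open>The chosen points may coincide for different members; only the number of members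
    met is counted later.\<close>
  have "\<forall>V\<in>\<W>. \<exists>x. x \<in> V \<inter> Q" using \<W>(1) by blast
  then obtain v where v: "\<forall>V\<in>\<W>. v V \<in> V \<inter> Q" by metis
  have "sigma_compactin X (v ` \<W>)"
  proof (rule countable_union_ofI)
    show "countable ((\<lambda>V. {v V}) ` \<W>)" using \<W>(3) by (rule countable_image)
    show "compactin X K" if "K \<in> (\<lambda>V. {v V}) ` \<W>" for K
      using that v closedin_subset[OF Q(1)] by auto
  qed auto
  then obtain S where S: "openin X S" "closedin X S" "sigma_compactin X S" "v ` \<W> \<subseteq> S"
    by (rule sigma_compact_clopen_superset[OF lc pc])
  have "\<W> \<subseteq> {V \<in> \<V>. V \<inter> (S \<inter> Q) \<noteq> {}}" using \<W>(1) v S(4) by fast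
  then have "\<not> compactin X (S \<inter> Q)"
    using locally_finite_meets_compactin[OF \<V>(3)] \<W>(2) finite_subset by blast
  then show ?thesis using that S by blast
qed

section \<open>Paracompactness of closed subspaces and of homeomorphic images\<close>

lemma paracompact_space_closed_subset:
  assumes pc: "paracompact_space X" and C: "closedin X C"
  shows "paracompact_space (subtopology X C)"
  unfolding paracompact_space_def
proof (intro conjI allI impI)
  show "Hausdorff_space (subtopology X C)"
    using pc by (simp add: paracompact_space_def Hausdorff_space_subtopology)
  fix \<U> assume \<U>: "(\<forall>U\<in>\<U>. openin (subtopology X C) U) \<and> \<Union>\<U> = topspace (subtopology X C)"
  have CX: "C \<subseteq> topspace X" using C by (rule closedin_subset)
  then have U\<U>: "\<Union>\<U> = C" using \<U> by (simp add: Int_absorb1)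
  define \<U>' where "\<U>' = insert (topspace X - C) {W. openin X W \<and> W \<inter> C \<in> \<U>}"
  have "C \<subseteq> \<Union>\<U>'"
  proof
    fix x assume "x \<in> C"
    then obtain U where U: "U \<in> \<U>" "x \<in> U" using U\<U> by blast
    then obtain W where "openin X W" "U = W \<inter> C" using \<U> unfolding openin_subtopology by blast
    then show "x \<in> \<Union>\<U>'" using U unfolding \<U>'_def by blast
  qed
  then have "topspace X \<subseteq> \<Union>\<U>'" unfolding \<U>'_def by blast
  moreover have op: "\<forall>U\<in>\<U>'. openin X U" using C by (auto simp: \<U>'_def)
  ultimately have "\<Union>\<U>' = topspace X" using openin_subset by blast
  with op obtain \<V>' where \<V>': "\<forall>V\<in>\<V>'. openin X V" "\<Union>\<V>' = topspace X"
    "\<forall>V\<in>\<V>'. \<exists>U\<in>\<U>'. V \<subseteq> U" "locally_finite_in X \<V>'"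
    by (rule paracompact_refinement[OF pc])
  \<comment> \<open>Only members meeting \<open>C\<close> are kept: they cannot lie in the
    complement of \<open>C\<close>, so the set of \<open>\<U>'\<close> around such a member traces
    to a member of \<open>\<U>\<close>.\<close>
  define \<V> where "\<V> = (\<lambda>V. V \<inter> C) ` {V \<in> \<V>'. V \<inter> C \<noteq> {}}"
  show "\<exists>\<V>. (\<forall>V\<in>\<V>. openin (subtopology X C) V) \<and> \<Union>\<V> = topspace (subtopology X C) \<and>
            (\<forall>V\<in>\<V>. \<exists>U\<in>\<U>. V \<subseteq> U) \<and> locally_finite_in (subtopology X C) \<V>"
  proof (intro exI[of _ \<V>] conjI)
    show "\<forall>V\<in>\<V>. openin (subtopology X C) V"
      unfolding \<V>_def using \<V>'(1) by (auto simp: openin_subtopology)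
    have "\<Union>\<V> = \<Union>\<V>' \<inter> C" unfolding \<V>_def by auto
    then show "\<Union>\<V> = topspace (subtopology X C)" using \<V>'(2) by simp
    show "\<forall>V\<in>\<V>. \<exists>U\<in>\<U>. V \<subseteq> U"
    proof
      fix V assume "V \<in> \<V>"
      then obtain V' where V': "V' \<in> \<V>'" "V' \<inter> C \<noteq> {}" "V = V' \<inter> C" unfolding \<V>_def by blast
      then obtain U' where "U' \<in> \<U>'" "V' \<subseteq> U'" using \<V>'(3) by blast
      then have "U' \<inter> C \<in> \<U>" "V \<subseteq> U' \<inter> C" using V'(2,3) unfolding \<U>'_def by auto
      then show "\<exists>U\<in>\<U>. V \<subseteq> U" by blast
    qed
    have "locally_finite_in X \<V>"
      unfolding \<V>_def
      by (rule locally_finite_in_refinement[OF locally_finite_in_subset[OF \<V>'(4)]]) auto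
    then show "locally_finite_in (subtopology X C) \<V>"
      by (rule locally_finite_in_subtopology) (auto simp: \<V>_def)
  qed
qed

lemma homeomorphic_paracompact_space:
  assumes "X homeomorphic_space Y" and pc: "paracompact_space X"
  shows "paracompact_space Y"
  unfolding paracompact_space_def
proof (intro conjI allI impI)
  show "Hausdorff_space Y"
    using assms homeomorphic_Hausdorff_space by (auto simp: paracompact_space_def)
  obtain f g where fg: "homeomorphic_maps X Y f g" using assms(1) unfolding homeomorphic_space_def by blast
  then have f: "homeomorphic_map X Y f" and g: "homeomorphic_map Y X g"
    by (auto simp: homeomorphic_maps_map)
  have f_g: "f (g y) = y" if "y \<in> topspace Y" for y
    using fg that unfolding homeomorphic_maps_def by blast
  have f_im: "f ` g ` U = U" if "U \<subseteq> topspace Y" for U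
  proof -
    have "(\<lambda>y. f (g y)) ` U = (\<lambda>y. y) ` U" using that f_g by (intro image_cong) auto
    then show ?thesis by (simp add: image_image)
  qed
  fix \<U> assume \<U>: "(\<forall>U\<in>\<U>. openin Y U) \<and> \<Union>\<U> = topspace Y"
  have "\<forall>U\<in>(`) g ` \<U>. openin X U"
    using \<U> homeomorphic_map_openness_eq[OF g] by blast
  moreover have "\<Union>((`) g ` \<U>) = topspace X"
    using \<U> homeomorphic_imp_surjective_map[OF g] by (metis image_Union)
  ultimately obtain \<V> where \<V>: "\<forall>V\<in>\<V>. openin X V" "\<Union>\<V> = topspace X"
    "\<forall>V\<in>\<V>. \<exists>U\<in>(`) g ` \<U>. V \<subseteq> U" "locally_finite_in X \<V>"
    by (rule paracompact_refinement[OF pc])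
  have \<V>sub: "V \<subseteq> topspace X" if "V \<in> \<V>" for V using \<V>(2) that by blast
  show "\<exists>\<V>. (\<forall>V\<in>\<V>. openin Y V) \<and> \<Union>\<V> = topspace Y \<and> (\<forall>V\<in>\<V>. \<exists>U\<in>\<U>. V \<subseteq> U) \<and> locally_finite_in Y \<V>"
  proof (intro exI[of _ "(`) f ` \<V>"] conjI)
    show "\<forall>V\<in>(`) f ` \<V>. openin Y V"
      using \<V>(1) homeomorphic_map_openness_eq[OF f] by blast
    show top: "\<Union>((`) f ` \<V>) = topspace Y"
      using \<V>(2) homeomorphic_imp_surjective_map[OF f] by (metis image_Union)
    show "\<forall>V\<in>(`) f ` \<V>. \<exists>U\<in>\<U>. V \<subseteq> U"
    proof
      fix V assume "V \<in> (`) f ` \<V>"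
      then obtain V' where V': "V' \<in> \<V>" "V = f ` V'" by blast
      then obtain U where U: "U \<in> \<U>" "V' \<subseteq> g ` U" using \<V>(3) by blast
      then have "V \<subseteq> f ` g ` U" using V'(2) by blast
      also have "f ` g ` U = U" using U(1) \<U> by (intro f_im) blast
      finally show "\<exists>U\<in>\<U>. V \<subseteq> U" using U(1) by blast
    qed
    show "locally_finite_in Y ((`) f ` \<V>)"
      unfolding locally_finite_in_def
    proof (intro conjI ballI)
      show "\<Union>((`) f ` \<V>) \<subseteq> topspace Y" using top by simp
      fix y assume y: "y \<in> topspace Y"
      then have "g y \<in> topspace X" using homeomorphic_imp_surjective_map[OF g] by blast
      then obtain N where N: "openin X N" "g y \<in> N" "finite {V \<in> \<V>. V \<inter> N \<noteq> {}}"
        using \<V>(4) unfolding locally_finite_in_def by meson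
      have "{V \<in> (`) f ` \<V>. V \<inter> f ` N \<noteq> {}} \<subseteq> (`) f ` {V \<in> \<V>. V \<inter> N \<noteq> {}}"
      proof
        fix W assume "W \<in> {V \<in> (`) f ` \<V>. V \<inter> f ` N \<noteq> {}}"
        then obtain V where V: "V \<in> \<V>" "W = f ` V" "f ` V \<inter> f ` N \<noteq> {}" by blast
        have "f ` (V \<inter> N) = f ` V \<inter> f ` N"
          by (rule inj_on_image_Int[OF homeomorphic_imp_injective_map[OF f] \<V>sub[OF V(1)] openin_subset[OF N(1)]])
        then have "V \<inter> N \<noteq> {}" using V(3) by auto
        then show "W \<in> (`) f ` {V \<in> \<V>. V \<inter> N \<noteq> {}}" using V(1,2) by blast
      qed
      then have "finite {V \<in> (`) f ` \<V>. V \<inter> f ` N \<noteq> {}}"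
        by (rule finite_subset) (simp add: N(3))
      moreover have "openin Y (f ` N)" using N(1) homeomorphic_map_openness_eq[OF f] by blast
      moreover have "y \<in> f ` N" using N(2) f_g[OF y] by force
      ultimately show "\<exists>V. openin Y V \<and> y \<in> V \<and> finite {U \<in> (`) f ` \<V>. U \<inter> V \<noteq> {}}" by blast
    qed
  qed
qed

section \<open>Spaces with a property\<close>

text \<open>The property \<open>P\<close> speaks only of spaces over \<open>'u\<close>; an injection
  transports a topology onto its image there.\<close>

lemma homeomorphic_copy:
  fixes X :: "'a topology" and i :: "'a \<Rightarrow> 'u"
  assumes "inj i"
  shows "\<exists>S :: 'u topology. S homeomorphic_space X"
proof -
  define T where "T = pullback_topology (i ` topspace X) (inv i) X"
  have top: "topspace T = i ` topspace X"
    unfolding T_def topspace_pullback_topology using assms by auto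
  have op: "openin T V \<longleftrightarrow> (\<exists>U. openin X U \<and> V = i ` U)" for V
  proof -
    have "inv i -` U \<inter> i ` topspace X = i ` U" if "openin X U" for U
      using openin_subset[OF that] assms by (auto simp: inv_f_f)
    then show ?thesis unfolding T_def openin_pullback_topology by metis
  qed
  have "homeomorphic_map X T i"
  proof (rule bijective_open_imp_homeomorphic_map)
    show "continuous_map X T i"
      unfolding continuous_map_def
    proof (intro conjI allI impI)
      show "i \<in> topspace X \<rightarrow> topspace T" by (simp add: top)
      fix V assume "openin T V"
      then obtain U where U: "openin X U" "V = i ` U" using op by blast
      have "{x \<in> topspace X. i x \<in> V} = U" 
        using openin_subset[OF U(1)] assms U(2) by (auto simp: inj_image_mem_iff)
      then show "openin X {x \<in> topspace X. i x \<in> V}" using U(1) by simp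
    qed
    show "open_map X T i" unfolding open_map_def using op by blast
    show "i ` topspace X = topspace T" by (simp add: top)
    show "inj_on i (topspace X)" using assms by (rule inj_on_subset) simp
  qed
  then have "X homeomorphic_space T" by (rule homeomorphic_map_imp_homeomorphic_space)
  then show ?thesis using homeomorphic_space_sym by blast
qed

lemma homeomorphic_map_subtopology_image:
  assumes "homeomorphic_map X Y f" "C \<subseteq> topspace X"
  shows "homeomorphic_map (subtopology X C) (subtopology Y (f ` C)) f"
proof (rule homeomorphic_map_subtopologies[OF assms(1)])
  show "f ` (topspace X \<inter> C) = topspace Y \<inter> f ` C"
    using assms(2) homeomorphic_imp_surjective_map[OF assms(1)] by blast
qed

lemma has_property_homeomorphic:
  assumes "X homeomorphic_space Y" "has_property P X"
  shows "has_property P Y"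
  using assms homeomorphic_space_trans unfolding has_property_def by blast

text \<open>Invariance allows the copy chosen in \<open>has_property\<close> to be replaced by any
  other one.\<close>

lemma has_property_copyD:
  assumes "topological_property P" "has_property P X" "S homeomorphic_space X"
  shows "P S"
  using assms homeomorphic_space_sym homeomorphic_space_trans
  unfolding has_property_def topological_property_def by metis

lemma has_property_compact:
  fixes X :: "'a topology" and i :: "'a \<Rightarrow> 'u" and P :: "'u topology \<Rightarrow> bool"
  assumes "inj i" "property_of_compact_spaces P" "compact_space X" "Hausdorff_space X"
  shows "has_property P X"
proof -
  obtain S :: "'u topology" where S: "S homeomorphic_space X" using homeomorphic_copy[OF assms(1)] by blast
  then have "compact_space S" "Hausdorff_space S"
    using assms homeomorphic_compact_space homeomorphic_Hausdorff_space by blast+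
  then show ?thesis using assms(2) S unfolding property_of_compact_spaces_def has_property_def by blast
qed

lemma sigma_compact_space_homeomorphic:
  assumes "X homeomorphic_space Y" "sigma_compact_space X"
  shows "sigma_compact_space Y"
proof -
  obtain f where f: "homeomorphic_map X Y f"
    using assms(1) unfolding homeomorphic_space by blast
  show ?thesis
    using sigma_compactin_image[OF homeomorphic_imp_continuous_map[OF f], of "topspace X"] assms(2)
    by (simp add: sigma_compact_space_def homeomorphic_imp_surjective_map[OF f])
qed

lemma has_property_iff_sigma_compact:
  fixes X :: "'a topology" and i :: "'a \<Rightarrow> 'u" and P :: "'u topology \<Rightarrow> bool"
  assumes "inj i" "topological_property P" "coincides_with_sigma_compactness P"
    and X: "locally_compact_space X" "paracompact_space X"
  shows "has_property P X \<longleftrightarrow> sigma_compact_space X"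
proof -
  obtain S :: "'u topology" where S: "S homeomorphic_space X" using homeomorphic_copy[OF assms(1)] by blast
  then have S': "X homeomorphic_space S" by (rule homeomorphic_space_sym[THEN iffD1])
  have "locally_compact_space S" "paracompact_space S"
    using S S' X homeomorphic_locally_compact_space homeomorphic_paracompact_space by blast+
  then have "P S \<longleftrightarrow> sigma_compact_space S"
    using assms(3) unfolding coincides_with_sigma_compactness_def by blast
  moreover have "P S \<longleftrightarrow> has_property P X"
    using has_property_copyD[OF assms(2) _ S] S unfolding has_property_def by blast
  moreover have "sigma_compact_space S \<longleftrightarrow> sigma_compact_space X"
    using sigma_compact_space_homeomorphic[OF S] sigma_compact_space_homeomorphic[OF S'] by blast
  ultimately show ?thesis by simp
qed

lemma has_property_closedin:
  assumes "topological_property P" "closed_hereditary P" "has_property P X" "closedin X C"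
  shows "has_property P (subtopology X C)"
proof -
  obtain S where S: "S homeomorphic_space X" "P S" using assms(3) unfolding has_property_def by blast
  then obtain f where f: "homeomorphic_map X S f"
    using homeomorphic_space homeomorphic_space_sym by blast
  have sub: "C \<subseteq> topspace X" using assms(4) by (rule closedin_subset)
  have "closedin S (f ` C)" using assms(4) homeomorphic_map_closedness[OF f sub] by simp
  then have "P (subtopology S (f ` C))"
    using assms(2) S(2) unfolding closed_hereditary_def by blast
  moreover have "homeomorphic_map (subtopology X C) (subtopology S (f ` C)) f"
    using f sub by (rule homeomorphic_map_subtopology_image)
  ultimately show ?thesis
    unfolding has_property_def
    using homeomorphic_map_imp_homeomorphic_space homeomorphic_space_sym by blast
qed

lemma has_property_Un:
  fixes X :: "'a topology" and i :: "'a \<Rightarrow> 'u" and P :: "'u topology \<Rightarrow> bool"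
  assumes "inj i" "topological_property P" "preserved_under_finite_sums P" "Hausdorff_space X"
    and AB: "A \<union> B = topspace X"
    and A: "has_property P (subtopology X A)" and B: "has_property P (subtopology X B)"
  shows "has_property P X"
proof -
  obtain S :: "'u topology" where S: "S homeomorphic_space X" using homeomorphic_copy[OF assms(1)] by blast
  then obtain f where f: "homeomorphic_map X S f"
    using homeomorphic_space homeomorphic_space_sym by blast
  have "P (subtopology S (f ` C))" if C: "C \<subseteq> topspace X" "has_property P (subtopology X C)" for C
  proof (rule has_property_copyD[OF assms(2) C(2)])
    have "homeomorphic_map (subtopology X C) (subtopology S (f ` C)) f"
      using f C(1) by (rule homeomorphic_map_subtopology_image)
    then show "subtopology S (f ` C) homeomorphic_space subtopology X C"
      using homeomorphic_map_imp_homeomorphic_space homeomorphic_space_sym by blast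
  qed
  then have "P (subtopology S (f ` A))" "P (subtopology S (f ` B))"
    using A B AB by auto
  moreover have "\<Union>{f ` A, f ` B} = topspace S"
    using AB homeomorphic_imp_surjective_map[OF f] by (simp flip: image_Un)
  moreover have "Hausdorff_space S" using S assms(4) homeomorphic_Hausdorff_space by blast
  ultimately have "P S"
    using assms(3) unfolding preserved_under_finite_sums_def
    by (metis (no_types, lifting) finite.emptyI finite_insert insert_iff singletonD)
  then show ?thesis using S unfolding has_property_def by blast
qed

section \<open>One-point extensions and subsets of the Stone-Cech remainder\<close>

definition ext_trace :: "'a topology \<Rightarrow> 'a option set \<Rightarrow> 'a set" where
  "ext_trace X U = {x \<in> topspace X. Some x \<in> U}"

definition sc_trace :: "'a topology \<Rightarrow> (('a \<Rightarrow> real) \<Rightarrow> real) set \<Rightarrow> 'a set" where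
  "sc_trace X W = {x \<in> topspace X. sc_embed X x \<in> W}"

text \<open>The preimage of the added point under the extension \<open>\<beta>X \<rightarrow> \<beta>T\<close> of the inclusion.\<close>

definition ext_fibre :: "'a topology \<Rightarrow> 'a option topology \<Rightarrow> (('a \<Rightarrow> real) \<Rightarrow> real) set" where
  "ext_fibre X T = (\<Inter>U\<in>{U. openin T U \<and> None \<in> U}.
     stone_cech X closure_of (sc_embed X ` ext_trace X U))"

text \<open>For a compact \<open>F\<close> in the remainder this is the quotient of the subspace of
  \<open>\<beta>X\<close> on \<open>X\<close> and \<open>F\<close> that collapses \<open>F\<close>
  to the point \<open>None\<close>, given directly by its open sets.\<close>

definition fibre_extension :: "'a topology \<Rightarrow> (('a \<Rightarrow> real) \<Rightarrow> real) set \<Rightarrow> 'a option topology" where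
  "fibre_extension X F = topology (\<lambda>U. U \<subseteq> insert None (Some ` topspace X) \<and> openin X (ext_trace X U) \<and>
     (None \<in> U \<longrightarrow> (\<exists>W. openin (stone_cech X) W \<and> F \<subseteq> W \<and> sc_trace X W \<subseteq> ext_trace X U)))"

definition remainder_compacts :: "'a topology \<Rightarrow> (('a \<Rightarrow> real) \<Rightarrow> real) set set" where
  "remainder_compacts X =
     {F. F \<noteq> {} \<and> compactin (stone_cech X) F \<and> F \<inter> sc_embed X ` topspace X = {}}"

lemma ext_trace_subset: "ext_trace X U \<subseteq> topspace X"
  by (auto simp: ext_trace_def)

lemma ext_trace_Int: "ext_trace X (U \<inter> V) = ext_trace X U \<inter> ext_trace X V"
  by (auto simp: ext_trace_def)

lemma ext_trace_Some: "ext_trace X (Some ` V) = topspace X \<inter> V"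
  "ext_trace X (insert None (Some ` V)) = topspace X \<inter> V"
  by (auto simp: ext_trace_def)

lemma sc_trace_mono: "W \<subseteq> W' \<Longrightarrow> sc_trace X W \<subseteq> sc_trace X W'"
  by (auto simp: sc_trace_def)

lemma image_sc_trace: "sc_embed X ` sc_trace X W = W \<inter> sc_embed X ` topspace X"
  by (auto simp: sc_trace_def)

lemma istopology_fibre_extension:
  "istopology (\<lambda>U. U \<subseteq> insert None (Some ` topspace X) \<and> openin X (ext_trace X U) \<and>
     (None \<in> U \<longrightarrow> (\<exists>W. openin (stone_cech X) W \<and> F \<subseteq> W \<and> sc_trace X W \<subseteq> ext_trace X U)))"
  (is "istopology ?O")
  unfolding istopology_def
proof (intro conjI allI impI)
  fix U V assume U: "?O U" and V: "?O V"
  show "U \<inter> V \<subseteq> insert None (Some ` topspace X)" using U by blast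
  show "openin X (ext_trace X (U \<inter> V))"
    using U V by (simp add: ext_trace_Int openin_Int)
  assume n: "None \<in> U \<inter> V"
  obtain W where W: "openin (stone_cech X) W" "F \<subseteq> W" "sc_trace X W \<subseteq> ext_trace X U"
    using U n by blast
  obtain W' where W': "openin (stone_cech X) W'" "F \<subseteq> W'" "sc_trace X W' \<subseteq> ext_trace X V"
    using V n by blast
  show "\<exists>W. openin (stone_cech X) W \<and> F \<subseteq> W \<and> sc_trace X W \<subseteq> ext_trace X (U \<inter> V)"
  proof (intro exI conjI)
    show "openin (stone_cech X) (W \<inter> W')" using W(1) W'(1) by (rule openin_Int)
    show "F \<subseteq> W \<inter> W'" using W(2) W'(2) by simp
    show "sc_trace X (W \<inter> W') \<subseteq> ext_trace X (U \<inter> V)"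
      using W(3) W'(3) sc_trace_mono[of "W \<inter> W'" W X] sc_trace_mono[of "W \<inter> W'" W' X]
      by (auto simp: ext_trace_Int)
  qed
next
  fix \<U> assume \<U>: "\<forall>U\<in>\<U>. ?O U"
  show "\<Union>\<U> \<subseteq> insert None (Some ` topspace X)" using \<U> by blast
  have "ext_trace X (\<Union>\<U>) = (\<Union>U\<in>\<U>. ext_trace X U)" by (auto simp: ext_trace_def)
  then show "openin X (ext_trace X (\<Union>\<U>))" using \<U> by auto
  assume "None \<in> \<Union>\<U>"
  then obtain U where U: "U \<in> \<U>" "None \<in> U" by blast
  then obtain W where W: "openin (stone_cech X) W" "F \<subseteq> W" "sc_trace X W \<subseteq> ext_trace X U"
    using \<U> by meson
  have "ext_trace X U \<subseteq> ext_trace X (\<Union>\<U>)" using U(1) by (auto simp: ext_trace_def)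
  with W show "\<exists>W. openin (stone_cech X) W \<and> F \<subseteq> W \<and> sc_trace X W \<subseteq> ext_trace X (\<Union>\<U>)"
    by (meson subset_trans)
qed

lemma openin_fibre_extension:
  "openin (fibre_extension X F) U \<longleftrightarrow>
     U \<subseteq> insert None (Some ` topspace X) \<and> openin X (ext_trace X U) \<and>
     (None \<in> U \<longrightarrow> (\<exists>W. openin (stone_cech X) W \<and> F \<subseteq> W \<and> sc_trace X W \<subseteq> ext_trace X U))"
  unfolding fibre_extension_def topology_inverse'[OF istopology_fibre_extension] ..

section \<open>The space \<open>\<beta>X\<close> and the extension determined by a compact set in
  its remainder\<close>

locale tychonoff =
  fixes X :: "'a topology"
  assumes tychonoff: "tychonoff_space X"
begin

abbreviation "bX \<equiv> stone_cech X"
abbreviation "e \<equiv> sc_embed X"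
abbreviation "eX \<equiv> sc_embed X ` topspace X"

lemma normal_bX: "normal_space bX"
  using compact_stone_cech Hausdorff_stone_cech compact_Hausdorff_or_regular_imp_normal_space by blast

lemma closedin_bX_sing: "z \<in> topspace bX \<Longrightarrow> closedin bX {z}"
  by (simp add: compactin_imp_closedin[OF Hausdorff_stone_cech])

lemma embedding_e: "embedding_map X bX e"
  by (rule embedding_sc_embed[OF tychonoff])

lemma homeomorphic_e: "homeomorphic_map X (subtopology bX eX) e"
  using embedding_e unfolding embedding_map_def .

lemma continuous_e: "continuous_map X bX e"
  using homeomorphic_imp_continuous_map[OF homeomorphic_e] by (simp add: continuous_map_in_subtopology)

lemma e_in: "x \<in> topspace X \<Longrightarrow> e x \<in> topspace bX"
  using continuous_e by (auto simp: continuous_map_def)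

lemma inj_e: "inj_on e (topspace X)"
  using homeomorphic_imp_injective_map[OF homeomorphic_e] .

lemma openin_sc_trace: "openin bX W \<Longrightarrow> openin X (sc_trace X W)"
  unfolding sc_trace_def by (rule openin_continuous_map_preimage[OF continuous_e])

lemma open_extends:
  assumes "openin X U"
  obtains W where "openin bX W" "sc_trace X W = U"
proof -
  have "openin (subtopology bX eX) (e ` U)"
    using assms homeomorphic_map_openness_eq[OF homeomorphic_e] by blast
  then obtain W where W: "openin bX W" "e ` U = W \<inter> eX" unfolding openin_subtopology by blast
  have "sc_trace X W = U"
  proof
    show "sc_trace X W \<subseteq> U"
    proof
      fix x assume "x \<in> sc_trace X W"
      then have x: "x \<in> topspace X" "e x \<in> W" by (auto simp: sc_trace_def)
      then have "e x \<in> e ` U" using W(2) by blast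
      then show "x \<in> U" using inj_on_image_mem_iff[OF inj_e x(1) openin_subset[OF assms]] by simp
    qed
    show "U \<subseteq> sc_trace X W" using W(2) openin_subset[OF assms] by (auto simp: sc_trace_def)
  qed
  with W(1) show ?thesis by (rule that)
qed

lemma dense: "bX closure_of eX = topspace bX"
  by (rule dense_sc_embed)

lemma open_subset_closure_trace:
  assumes "openin bX W"
  shows "W \<subseteq> bX closure_of (e ` sc_trace X W)"
  using openin_Int_closure_of_subset[OF assms, of eX] openin_subset[OF assms]
  unfolding dense image_sc_trace by (simp add: Int_absorb2)

lemma sc_trace_nonempty:
  assumes "openin bX W" "W \<noteq> {}"
  shows "sc_trace X W \<noteq> {}"
  using open_subset_closure_trace[OF assms(1)] assms(2) by auto

lemma urysohn:
  assumes "closedin bX A" "closedin bX C" "A \<inter> C = {}"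
  obtains g where "continuous_map bX (top_of_set {0..1::real}) g" "\<And>z. z \<in> A \<Longrightarrow> g z = 0" "\<And>z. z \<in> C \<Longrightarrow> g z = 1"
proof -
  have "disjnt A C" using assms(3) by (simp add: disjnt_def)
  then obtain g where "continuous_map bX (top_of_set {0..1::real}) g" "g ` A \<subseteq> {0}" "g ` C \<subseteq> {1}"
    using Urysohn_lemma[OF normal_bX assms(1,2), of 0 1] by auto
  then show ?thesis using that[of g] by (simp add: image_subset_iff)
qed

lemma extensions_agree:
  assumes "continuous_map bX euclideanreal g" "continuous_map bX euclideanreal h"
    and "\<And>x. x \<in> topspace X \<Longrightarrow> g (e x) = h (e x)" and "z \<in> topspace bX"
  shows "g z = h z"
proof (rule forall_in_closure_of_eq[of z bX eX euclideanreal g h])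
  show "z \<in> bX closure_of eX" using assms(4) dense by simp
qed (use assms in auto)

lemma remainder_compactsD:
  assumes "F \<in> remainder_compacts X"
  shows "F \<noteq> {}" "compactin bX F" "closedin bX F" "F \<inter> eX = {}" "F \<subseteq> topspace bX"
proof -
  show "F \<noteq> {}" "compactin bX F" "F \<inter> eX = {}" using assms by (auto simp: remainder_compacts_def)
  then show "closedin bX F" using compactin_imp_closedin[OF Hausdorff_stone_cech] by blast
  then show "F \<subseteq> topspace bX" by (rule closedin_subset)
qed

lemma topspace_fibre_extension:
  assumes "F \<in> remainder_compacts X"
  shows "topspace (fibre_extension X F) = insert None (Some ` topspace X)"
proof
  have "ext_trace X (insert None (Some ` topspace X)) = topspace X" by (simp add: ext_trace_Some)
  then have "openin (fibre_extension X F) (insert None (Some ` topspace X))"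
    unfolding openin_fibre_extension
    using remainder_compactsD(5)[OF assms] by (auto simp: sc_trace_def intro: exI[of _ "topspace bX"])
  then show "insert None (Some ` topspace X) \<subseteq> topspace (fibre_extension X F)" by (rule openin_subset)
  show "topspace (fibre_extension X F) \<subseteq> insert None (Some ` topspace X)"
    using openin_topspace[of "fibre_extension X F"] unfolding openin_fibre_extension by blast
qed

text \<open>A continuous function that is constant on the collapsed set descends to the
  quotient.\<close>

lemma continuous_map_fibre_extension:
  fixes g :: "(('a \<Rightarrow> real) \<Rightarrow> real) \<Rightarrow> real"
  assumes F: "F \<in> remainder_compacts X" and g: "continuous_map bX euclideanreal g"
    and c: "\<And>z. z \<in> F \<Longrightarrow> g z = c"
  shows "continuous_map (fibre_extension X F) euclideanreal (case_option c (\<lambda>x. g (e x)))"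
    (is "continuous_map _ _ ?f")
  unfolding continuous_map_def
proof (intro conjI allI impI)
  show "?f \<in> topspace (fibre_extension X F) \<rightarrow> topspace euclideanreal" by simp
  fix V :: "real set" assume V: "openin euclideanreal V"
  let ?U = "{t \<in> topspace (fibre_extension X F). ?f t \<in> V}"
  define W where "W = {z \<in> topspace bX. g z \<in> V}"
  have W: "openin bX W" unfolding W_def by (rule openin_continuous_map_preimage[OF g V])
  have tr: "ext_trace X ?U = sc_trace X W"
    using e_in by (auto simp: ext_trace_def sc_trace_def W_def topspace_fibre_extension[OF F])
  have "F \<subseteq> W" if "None \<in> ?U"
    using that c remainder_compactsD(5)[OF F] by (auto simp: W_def)
  then show "openin (fibre_extension X F) ?U"
    unfolding openin_fibre_extension tr
    using W openin_sc_trace[OF W] topspace_fibre_extension[OF F] by auto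
qed

lemma one_point_extension_fibre_extension:
  assumes F: "F \<in> remainder_compacts X"
  shows "one_point_extension X (fibre_extension X F)"
  unfolding one_point_extension_def
proof (intro conjI)
  let ?T = "fibre_extension X F"
  show top: "topspace ?T = insert None (Some ` topspace X)" by (rule topspace_fibre_extension[OF F])
  show "embedding_map X ?T Some"
  proof (rule injective_open_imp_embedding_map)
    show "continuous_map X ?T Some"
      unfolding continuous_map_def
    proof (intro conjI allI impI)
      show "Some \<in> topspace X \<rightarrow> topspace ?T" by (simp add: top)
      show "openin X {x \<in> topspace X. Some x \<in> U}" if "openin ?T U" for U
        using that unfolding openin_fibre_extension ext_trace_def by blast
    qed
    show "open_map X ?T Some"
      unfolding open_map_def
    proof (intro allI impI)
      fix V assume V: "openin X V"
      then have "V \<subseteq> topspace X" by (rule openin_subset)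
      then show "openin ?T (Some ` V)"
        unfolding openin_fibre_extension ext_trace_Some using V by (auto simp: Int_absorb1)
    qed
  qed simp
  show "?T closure_of (Some ` topspace X) = topspace ?T"
    unfolding dense_intersects_open
  proof (intro allI impI)
    fix U assume "openin ?T U \<and> U \<noteq> {}"
    then have U: "openin ?T U" "U \<noteq> {}" by auto
    show "Some ` topspace X \<inter> U \<noteq> {}"
    proof (cases "None \<in> U")
      case True
      then obtain W where W: "openin bX W" "F \<subseteq> W" "sc_trace X W \<subseteq> ext_trace X U"
        using U(1) unfolding openin_fibre_extension by meson
      then have "sc_trace X W \<noteq> {}"
        using remainder_compactsD(1)[OF F] by (intro sc_trace_nonempty) auto
      then obtain x where "x \<in> ext_trace X U" using W(3) by blast
      then show ?thesis by (auto simp: ext_trace_def)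
    next
      case False
      obtain t where t: "t \<in> U" using U(2) by blast
      then have "t \<in> Some ` topspace X"
        using openin_subset[OF U(1)] False top by (metis insertE subsetD)
      with t show ?thesis by blast
    qed
  qed
qed

lemma tychonoff_fibre_extension:
  assumes F: "F \<in> remainder_compacts X"
  shows "tychonoff_space (fibre_extension X F)"
proof -
  let ?T = "fibre_extension X F"
  note top = topspace_fibre_extension[OF F]
  note Fcl = remainder_compactsD(3)[OF F]
  have HX: "Hausdorff_space X" using tychonoff by (simp add: tychonoff_space_def)
  have cr: "completely_regular_space ?T"
    unfolding completely_regular_space_alt'
  proof (intro allI impI)
    fix S p assume S: "openin ?T S" and p: "p \<in> S"
    show "\<exists>f. continuous_map ?T euclideanreal f \<and> f p = 0 \<and> f ` (topspace ?T - S) \<subseteq> {1}"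
    proof (cases p)
      case None
      then obtain W where W: "openin bX W" "F \<subseteq> W" "sc_trace X W \<subseteq> ext_trace X S"
        using S p unfolding openin_fibre_extension by meson
      obtain g where g: "continuous_map bX (top_of_set {0..1::real}) g"
        "\<And>z. z \<in> F \<Longrightarrow> g z = 0" "\<And>z. z \<in> topspace bX - W \<Longrightarrow> g z = 1"
        using urysohn[OF Fcl, of "topspace bX - W"] W by blast
      have "continuous_map ?T euclideanreal (case_option 0 (\<lambda>x. g (e x)))"
        using continuous_map_fibre_extension[OF F _ g(2)] g(1) by (auto simp: continuous_map_in_subtopology)
      moreover have "(case t of None \<Rightarrow> 0 | Some x \<Rightarrow> g (e x)) = 1" if t: "t \<in> topspace ?T - S" for t
      proof -
        obtain x where x: "t = Some x" "x \<in> topspace X" using t top p None by auto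
        then have "e x \<notin> W" using W(3) t by (auto simp: sc_trace_def ext_trace_def)
        then show ?thesis using x g(3) e_in by simp
      qed
      ultimately show ?thesis using None by (intro exI[of _ "case_option 0 (\<lambda>x. g (e x))"]) auto
    next
      case (Some x)
      then have x: "x \<in> topspace X" using openin_subset[OF S] p top by auto
      have "openin X (ext_trace X S)" using S unfolding openin_fibre_extension by blast
      then obtain W where W: "openin bX W" "sc_trace X W = ext_trace X S" by (rule open_extends)
      have "e x \<in> W" using W(2) x p Some by (auto simp: ext_trace_def sc_trace_def)
      moreover have "e x \<notin> F" using remainder_compactsD(4)[OF F] x by blast
      moreover have "closedin bX {e x}"
        by (rule closedin_bX_sing[OF e_in[OF x]])
      \<comment> \<open>Adding \<open>F\<close> to the closed set makes the separating function
        constant on \<open>F\<close>, so that it descends. The value 1 at \<open>None\<close> is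
        harmless even if \<open>None\<close> lies in \<open>S\<close>.\<close>
      moreover have "closedin bX ((topspace bX - W) \<union> F)" using W(1) Fcl by (intro closedin_Un) auto
      ultimately obtain g where g: "continuous_map bX (top_of_set {0..1::real}) g"
        "\<And>z. z \<in> {e x} \<Longrightarrow> g z = 0" "\<And>z. z \<in> (topspace bX - W) \<union> F \<Longrightarrow> g z = 1"
        using urysohn[of "{e x}" "(topspace bX - W) \<union> F"] by blast
      have "continuous_map ?T euclideanreal (case_option 1 (\<lambda>x. g (e x)))"
        using continuous_map_fibre_extension[OF F, of g 1] g by (auto simp: continuous_map_in_subtopology)
      moreover have "(case t of None \<Rightarrow> 1 | Some y \<Rightarrow> g (e y)) = 1" if t: "t \<in> topspace ?T - S" for t
      proof (cases t)
        case (Some y)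
        then have y: "y \<in> topspace X" using t top by auto
        then have "e y \<notin> W" using W(2) t Some by (auto simp: sc_trace_def ext_trace_def)
        then show ?thesis using Some y g(3) e_in by simp
      qed simp
      ultimately show ?thesis
        using Some g(2) by (intro exI[of _ "case_option 1 (\<lambda>x. g (e x))"]) auto
    qed
  qed
  have "t1_space ?T"
    unfolding t1_space_closedin_singleton
  proof
    fix t assume t: "t \<in> topspace ?T"
    have "openin ?T (topspace ?T - {t})"
    proof (cases t)
      case None
      then have "ext_trace X (topspace ?T - {t}) = topspace X" by (auto simp: ext_trace_def top)
      then show ?thesis unfolding openin_fibre_extension using None top by auto
    next
      case (Some x)
      then have x: "x \<in> topspace X" using t top by auto
      have tr: "ext_trace X (topspace ?T - {t}) = topspace X - {x}"
        using Some by (auto simp: ext_trace_def top)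
      have "openin X (topspace X - {x})"
        using compactin_imp_closedin[OF HX, of "{x}"] x by (intro openin_diff) simp_all
      moreover have "openin bX (topspace bX - {e x})"
        using closedin_bX_sing[OF e_in[OF x]] by (intro openin_diff) simp_all
      moreover have "F \<subseteq> topspace bX - {e x}"
        using remainder_compactsD(4,5)[OF F] x by blast
      moreover have "sc_trace X (topspace bX - {e x}) \<subseteq> topspace X - {x}" by (auto simp: sc_trace_def)
      ultimately show ?thesis unfolding openin_fibre_extension tr using top by blast
    qed
    then show "closedin ?T {t}" using t by (simp add: closedin_def)
  qed
  then have "Hausdorff_space ?T"
    by (rule regular_t1_imp_Hausdorff_space[OF completely_regular_imp_regular_space[OF cr]])
  with cr show ?thesis by (simp add: tychonoff_space_def)
qed

text \<open>Every open \<open>W\<close> around \<open>F\<close> lies in the closure of its own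
  trace, so \<open>F\<close> is in the fibre; any other point is excluded by separating it from
  \<open>F\<close> in the normal space \<open>\<beta>X\<close>.\<close>

lemma ext_fibre_fibre_extension:
  assumes F: "F \<in> remainder_compacts X"
  shows "ext_fibre X (fibre_extension X F) = F"
proof
  note Fcl = remainder_compactsD(3)[OF F]
  show "F \<subseteq> ext_fibre X (fibre_extension X F)"
    unfolding ext_fibre_def
  proof (rule INT_greatest)
    fix U assume "U \<in> {U. openin (fibre_extension X F) U \<and> None \<in> U}"
    then obtain W where W: "openin bX W" "F \<subseteq> W" "sc_trace X W \<subseteq> ext_trace X U"
      unfolding openin_fibre_extension mem_Collect_eq by meson
    have "F \<subseteq> bX closure_of (e ` sc_trace X W)"
      using open_subset_closure_trace[OF W(1)] W(2) by (rule subset_trans[rotated])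
    also have "\<dots> \<subseteq> bX closure_of (e ` ext_trace X U)"
      by (intro closure_of_mono image_mono W(3))
    finally show "F \<subseteq> bX closure_of (e ` ext_trace X U)" .
  qed
  show "ext_fibre X (fibre_extension X F) \<subseteq> F"
  proof
    fix z assume z: "z \<in> ext_fibre X (fibre_extension X F)"
    have op: "openin (fibre_extension X F) (insert None (Some ` sc_trace X W))" if W: "openin bX W" "F \<subseteq> W" for W
    proof -
      have "topspace X \<inter> sc_trace X W = sc_trace X W" by (auto simp: sc_trace_def)
      then show ?thesis
        unfolding openin_fibre_extension ext_trace_Some
        using W openin_sc_trace[OF W(1)] by (auto simp: sc_trace_def)
    qed
    have zcl: "z \<in> bX closure_of (e ` sc_trace X W)" if W: "openin bX W" "F \<subseteq> W" for W
    proof -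
      have "ext_trace X (insert None (Some ` sc_trace X W)) = sc_trace X W"
        by (auto simp: sc_trace_def ext_trace_def)
      then show ?thesis using z op[OF W] unfolding ext_fibre_def by auto
    qed
    have "z \<in> bX closure_of (e ` sc_trace X (topspace bX))"
      by (rule zcl) (use remainder_compactsD(5)[OF F] in auto)
    then have zb: "z \<in> topspace bX" by (simp add: in_closure_of)
    show "z \<in> F"
    proof (rule ccontr)
      assume "z \<notin> F"
      moreover have "closedin bX {z}"
        by (rule closedin_bX_sing[OF zb])
      ultimately obtain W V where WV: "openin bX W" "openin bX V" "F \<subseteq> W" "{z} \<subseteq> V" "disjnt W V"
        using normal_bX Fcl unfolding normal_space_def by (metis disjnt_insert2 disjnt_empty2)
      have "V \<inter> (e ` sc_trace X W) = {}" using WV(5) by (auto simp: disjnt_def sc_trace_def)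
      then have "V \<inter> bX closure_of (e ` sc_trace X W) = {}"
        using openin_Int_closure_of_eq_empty[OF WV(2)] by blast
      then show False using zcl[OF WV(1,3)] WV(4) by blast
    qed
  qed
qed

end

section \<open>Neighbourhoods of the added point\<close>

lemma ext_tychonoffD:
  assumes "T \<in> ext_tychonoff X"
  shows "topspace T = insert None (Some ` topspace X)" "embedding_map X T Some"
    "T closure_of (Some ` topspace X) = topspace T" "completely_regular_space T" "Hausdorff_space T"
  using assms by (auto simp: ext_tychonoff_def one_point_extension_def tychonoff_space_def)

text \<open>The added point is closed in a Hausdorff extension, so \<open>X\<close> is open in
  it.\<close>

lemma openin_ext_Some:
  assumes T: "T \<in> ext_tychonoff X" and V: "openin X V"
  shows "openin T (Some ` V)"
proof -
  note top = ext_tychonoffD(1)[OF T]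
  have "homeomorphic_map X (subtopology T (Some ` topspace X)) Some"
    using ext_tychonoffD(2)[OF T] unfolding embedding_map_def .
  then have "openin (subtopology T (Some ` topspace X)) (Some ` V)"
    using V homeomorphic_map_openness_eq by blast
  moreover have "openin T (Some ` topspace X)"
  proof -
    have "closedin T {None}"
      using compactin_imp_closedin[OF ext_tychonoffD(5)[OF T], of "{None}"] top by simp
    then have "openin T (topspace T - {None})" by (intro openin_diff) simp_all
    moreover have "topspace T - {None} = Some ` topspace X" using top by auto
    ultimately show ?thesis by simp
  qed
  ultimately show ?thesis by (simp add: openin_open_subtopology)
qed

lemma continuous_map_ext_Some:
  assumes T: "T \<in> ext_tychonoff X"
  shows "continuous_map X T Some"
  using ext_tychonoffD(2)[OF T] unfolding embedding_map_def
  by (auto dest!: homeomorphic_imp_continuous_map simp: continuous_map_in_subtopology)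

lemma openin_ext_trace:
  assumes T: "T \<in> ext_tychonoff X" and U: "openin T U"
  shows "openin X (ext_trace X U)"
  unfolding ext_trace_def using continuous_map_ext_Some[OF T] U by (rule openin_continuous_map_preimage)

lemma openin_ext_superset:
  assumes T: "T \<in> ext_tychonoff X" and U: "openin T U" "None \<in> U"
    and V: "openin X V" "ext_trace X U \<subseteq> V"
  shows "openin T (insert None (Some ` V))"
proof -
  have "U \<subseteq> insert None (Some ` V)"
  proof
    fix t assume t: "t \<in> U"
    then have "t \<in> topspace T" using openin_subset[OF U(1)] by blast
    then show "t \<in> insert None (Some ` V)"
      using t V(2) ext_tychonoffD(1)[OF T] by (auto simp: ext_trace_def)
  qed
  then have "insert None (Some ` V) = U \<union> Some ` V" using U(2) by blast
  then show ?thesis using U(1) openin_ext_Some[OF T V(1)] by (simp add: openin_Un)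
qed

lemma ext_trace_nonempty:
  assumes T: "T \<in> ext_tychonoff X" and U: "openin T U" "None \<in> U"
  shows "ext_trace X U \<noteq> {}"
proof -
  have "Some ` topspace X \<inter> U \<noteq> {}"
    using ext_tychonoffD(3)[OF T] U unfolding dense_intersects_open by blast
  then show ?thesis by (auto simp: ext_trace_def)
qed

lemma ext_separate_None:
  assumes T: "T \<in> ext_tychonoff X" and x: "x \<in> topspace X"
  obtains U V where "openin T U" "openin T V" "Some x \<in> U" "None \<in> V" "disjnt U V"
proof -
  have "Some x \<in> topspace T" "None \<in> topspace T" using ext_tychonoffD(1)[OF T] x by auto
  moreover have "Some x \<noteq> None" by simp
  ultimately show ?thesis
    using ext_tychonoffD(5)[OF T] that unfolding Hausdorff_space_def by blast
qed

section \<open>The fibre of an arbitrary one-point Tychonoff extension\<close>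

context tychonoff
begin

lemma closedin_ext_fibre:
  assumes T: "T \<in> ext_tychonoff X"
  shows "closedin bX (ext_fibre X T)"
proof -
  have "None \<in> topspace T" using ext_tychonoffD(1)[OF T] by simp
  then have "topspace T \<in> {U. openin T U \<and> None \<in> U}" by blast
  then show ?thesis unfolding ext_fibre_def by (intro closedin_Inter) auto
qed

lemma ext_fibre_subset_closure:
  assumes "openin T U" "None \<in> U"
  shows "ext_fibre X T \<subseteq> bX closure_of (e ` ext_trace X U)"
  unfolding ext_fibre_def using assms by blast

text \<open>Complete regularity of \<open>T\<close> gives a function that is 0 at the added point
  and 1 off \<open>U\<close>; the open set \<open>W\<close> is where the extension of this function
  to \<open>\<beta>X\<close> is below 1.\<close>

lemma ext_fibre_nbhd_trace:
  assumes T: "T \<in> ext_tychonoff X" and U: "openin T U" "None \<in> U"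
  obtains W where "openin bX W" "ext_fibre X T \<subseteq> W" "sc_trace X W \<subseteq> ext_trace X U"
proof -
  note top = ext_tychonoffD(1)[OF T]
  have "closedin T (topspace T - U)" using U(1) by blast
  moreover have "None \<in> topspace T - (topspace T - U)" using U top by simp
  ultimately obtain f where f: "continuous_map T (top_of_set {0..1::real}) f" "f None = 0"
    "f ` (topspace T - U) \<subseteq> {1}"
    using ext_tychonoffD(4)[OF T] unfolding completely_regular_space_def by meson
  have "continuous_map X (top_of_set {0..1}) (f \<circ> Some)"
    using continuous_map_ext_Some[OF T] f(1) by (rule continuous_map_compose)
  then obtain g where g: "continuous_map bX (top_of_set {0..1}) g" "\<And>x. x \<in> topspace X \<Longrightarrow> g (e x) = f (Some x)"
    using stone_cech_extension by (metis comp_apply)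
  have gc: "continuous_map bX euclideanreal g" using g(1) by (simp add: continuous_map_in_subtopology)
  have fc: "continuous_map T euclideanreal f" using f(1) by (simp add: continuous_map_in_subtopology)
  define W where "W = {z \<in> topspace bX. g z \<in> {..<1}}"
  have "openin bX W" unfolding W_def by (rule openin_continuous_map_preimage[OF gc]) simp
  moreover have "ext_fibre X T \<subseteq> W"
  proof -
    \<comment> \<open>The level 1/2 leaves room for the closure: it only gives
      \<open>g \<le> 1/2\<close> on the fibre, which is still below 1.\<close>
    define U' where "U' = {t \<in> topspace T. f t \<in> {..<1/2}}"
    have U': "openin T U'" unfolding U'_def by (rule openin_continuous_map_preimage[OF fc]) simp
    have "None \<in> U'" using top f(2) by (simp add: U'_def)
    then have "ext_fibre X T \<subseteq> bX closure_of (e ` ext_trace X U')"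
      by (rule ext_fibre_subset_closure[OF U'])
    also have "\<dots> \<subseteq> {z \<in> topspace bX. g z \<in> {..1/2}}"
    proof (rule closure_of_minimal)
      show "e ` ext_trace X U' \<subseteq> {z \<in> topspace bX. g z \<in> {..1/2}}"
        using e_in g(2) by (auto simp: ext_trace_def U'_def)
      show "closedin bX {z \<in> topspace bX. g z \<in> {..1/2}}"
        by (rule closedin_continuous_map_preimage[OF gc]) simp
    qed
    also have "\<dots> \<subseteq> W" by (auto simp: W_def)
    finally show ?thesis .
  qed
  moreover have "sc_trace X W \<subseteq> ext_trace X U"
  proof
    fix x assume "x \<in> sc_trace X W"
    then have x: "x \<in> topspace X" "f (Some x) < 1" using g(2) by (auto simp: sc_trace_def W_def)
    have "Some x \<in> topspace T" using x(1) top by simp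
    then have "Some x \<in> U"
      using subsetD[OF f(3), OF imageI[of "Some x"]] x(2) by (cases "Some x \<in> U") auto
    then show "x \<in> ext_trace X U" using x(1) by (simp add: ext_trace_def)
  qed
  ultimately show ?thesis by (rule that)
qed

text \<open>By compactness of \<open>C\<close>, finitely many of the closures that define the fibre
  already have no common point in \<open>C\<close>; the corresponding neighbourhoods are
  intersected.\<close>

lemma closed_avoiding_ext_fibre:
  assumes T: "T \<in> ext_tychonoff X" and C: "closedin bX C" "C \<inter> ext_fibre X T = {}"
  obtains U where "openin T U" "None \<in> U" "C \<inter> e ` ext_trace X U = {}"
proof -
  define \<N> where "\<N> = {U. openin T U \<and> None \<in> U}"
  define cl where "cl U = bX closure_of (e ` ext_trace X U)" for U
  have "compactin bX C" using C(1) by (rule closedin_compact_space[OF compact_stone_cech])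
  moreover have "C \<inter> \<Inter>(cl ` \<N>) = {}" using C(2) unfolding ext_fibre_def cl_def \<N>_def by simp
  moreover have "\<forall>D\<in>cl ` \<N>. closedin bX D" by (auto simp: cl_def)
  ultimately obtain \<F> where \<F>: "finite \<F>" "\<F> \<subseteq> cl ` \<N>" "C \<inter> \<Inter>\<F> = {}"
    unfolding compactin_fip by meson
  from finite_subset_image[OF \<F>(1,2)]
  obtain \<U> where \<U>: "\<U> \<subseteq> \<N>" "finite \<U>" "\<F> = cl ` \<U>"
    by (elim bexE exE conjE) (rule that)
  \<comment> \<open>Inserting \<open>topspace T\<close> covers the case of an empty
    subfamily.\<close>
  define U where "U = \<Inter>(insert (topspace T) \<U>)"
  have "openin T U" unfolding U_def using \<U> by (intro openin_Inter) (auto simp: \<N>_def)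
  moreover have "None \<in> U" using \<U>(1) ext_tychonoffD(1)[OF T] by (auto simp: U_def \<N>_def)
  moreover have "e ` ext_trace X U \<subseteq> \<Inter>\<F>"
    unfolding \<U>(3)
  proof (rule INT_greatest)
    fix V assume V: "V \<in> \<U>"
    have "e ` ext_trace X U \<subseteq> e ` ext_trace X V" using V by (auto simp: U_def ext_trace_def)
    also have "\<dots> \<subseteq> cl V"
      unfolding cl_def by (intro closure_of_subset) (auto simp: ext_trace_def e_in)
    finally show "e ` ext_trace X U \<subseteq> cl V" .
  qed
  ultimately show ?thesis using that \<F>(3) by blast
qed

lemma openin_ext_of_nbhd:
  assumes T: "T \<in> ext_tychonoff X" and W: "openin bX W" "ext_fibre X T \<subseteq> W"
  shows "openin T (insert None (Some ` sc_trace X W))"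
proof -
  obtain U where U: "openin T U" "None \<in> U" "(topspace bX - W) \<inter> e ` ext_trace X U = {}"
    using closed_avoiding_ext_fibre[OF T, of "topspace bX - W"] W by blast
  have "ext_trace X U \<subseteq> sc_trace X W"
    using U(3) e_in by (auto simp: ext_trace_def sc_trace_def)
  then show ?thesis using openin_ext_superset[OF T U(1,2) openin_sc_trace[OF W(1)]] by blast
qed

text \<open>Density of \<open>X\<close> in \<open>T\<close> makes the fibre nonempty, and Hausdorff
  separation of \<open>None\<close> from the points of \<open>X\<close> keeps it in the
  remainder.\<close>

lemma ext_fibre_remainder_compact:
  assumes T: "T \<in> ext_tychonoff X"
  shows "ext_fibre X T \<in> remainder_compacts X"
  unfolding remainder_compacts_def
proof (intro CollectI conjI)
  note top = ext_tychonoffD(1)[OF T]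
  show "ext_fibre X T \<noteq> {}"
  proof
    assume "ext_fibre X T = {}"
    then obtain U where "openin T U" "None \<in> U" "topspace bX \<inter> e ` ext_trace X U = {}"
      using closed_avoiding_ext_fibre[OF T closedin_topspace] by blast
    then show False using ext_trace_nonempty[OF T] e_in ext_trace_subset[of X U] by blast
  qed
  show "compactin bX (ext_fibre X T)"
    using closedin_ext_fibre[OF T] by (rule closedin_compact_space[OF compact_stone_cech])
  show "ext_fibre X T \<inter> eX = {}"
  proof (rule ccontr)
    assume "ext_fibre X T \<inter> eX \<noteq> {}"
    then obtain x where x: "x \<in> topspace X" "e x \<in> ext_fibre X T" by blast
    obtain U V where UV: "openin T U" "openin T V" "Some x \<in> U" "None \<in> V" "disjnt U V"
      using ext_separate_None[OF T x(1)] .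
    obtain W where W: "openin bX W" "sc_trace X W = ext_trace X U"
      using open_extends[OF openin_ext_trace[OF T UV(1)]] .
    have "e x \<in> W" using W(2) x(1) UV(3) by (auto simp: ext_trace_def sc_trace_def)
    moreover have "e x \<in> bX closure_of (e ` ext_trace X V)"
      using ext_fibre_subset_closure[OF UV(2,4)] x(2) by blast
    ultimately obtain y where y: "y \<in> ext_trace X V" "e y \<in> W"
      using W(1) unfolding in_closure_of by blast
    then have "y \<in> ext_trace X U" using W(2) by (auto simp: ext_trace_def sc_trace_def)
    then show False using y(1) UV(5) by (auto simp: ext_trace_def disjnt_def)
  qed
qed

text \<open>Traces of neighbourhoods of the fibre and traces of neighbourhoods of
  \<open>None\<close> are cofinal in each other; away from \<open>None\<close> both topologies are
  that of \<open>X\<close>.\<close>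

lemma fibre_extension_ext_fibre:
  assumes T: "T \<in> ext_tychonoff X"
  shows "fibre_extension X (ext_fibre X T) = T"
  unfolding topology_eq
proof
  fix U
  note top = ext_tychonoffD(1)[OF T]
  have U_eq: "U = (if None \<in> U then insert None (Some ` ext_trace X U) else Some ` ext_trace X U)"
    if "U \<subseteq> insert None (Some ` topspace X)"
    using that by (auto simp: ext_trace_def)
  show "openin (fibre_extension X (ext_fibre X T)) U \<longleftrightarrow> openin T U"
  proof
    assume L: "openin (fibre_extension X (ext_fibre X T)) U"
    then have sub: "U \<subseteq> insert None (Some ` topspace X)" and tr: "openin X (ext_trace X U)"
      unfolding openin_fibre_extension by auto
    show "openin T U"
    proof (cases "None \<in> U")
      case True
      then obtain W where W: "openin bX W" "ext_fibre X T \<subseteq> W" "sc_trace X W \<subseteq> ext_trace X U"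
        using L unfolding openin_fibre_extension by meson
      have tr_eq: "ext_trace X (insert None (Some ` sc_trace X W)) = sc_trace X W"
        by (auto simp: ext_trace_def sc_trace_def)
      have "openin T (insert None (Some ` ext_trace X U))"
        using openin_ext_superset[OF T openin_ext_of_nbhd[OF T W(1,2)] insertI1 tr] W(3) tr_eq by simp
      then show ?thesis using U_eq[OF sub] True by simp
    next
      case False
      then show ?thesis using U_eq[OF sub] openin_ext_Some[OF T tr] by simp
    qed
  next
    assume R: "openin T U"
    show "openin (fibre_extension X (ext_fibre X T)) U"
      unfolding openin_fibre_extension
    proof (intro conjI impI)
      show "U \<subseteq> insert None (Some ` topspace X)" using openin_subset[OF R] top by simp
      show "openin X (ext_trace X U)" by (rule openin_ext_trace[OF T R])
      assume "None \<in> U"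
      then show "\<exists>W. openin bX W \<and> ext_fibre X T \<subseteq> W \<and> sc_trace X W \<subseteq> ext_trace X U"
        using ext_fibre_nbhd_trace[OF T R] by metis
    qed
  qed
qed

lemma bij_betw_ext_fibre: "bij_betw (ext_fibre X) (ext_tychonoff X) (remainder_compacts X)"
proof (rule bij_betw_byWitness[where f' = "fibre_extension X"])
  show "\<forall>T\<in>ext_tychonoff X. fibre_extension X (ext_fibre X T) = T"
    using fibre_extension_ext_fibre by blast
  show "\<forall>F\<in>remainder_compacts X. ext_fibre X (fibre_extension X F) = F"
    using ext_fibre_fibre_extension by blast
  show "ext_fibre X ` ext_tychonoff X \<subseteq> remainder_compacts X"
    using ext_fibre_remainder_compact by blast
  show "fibre_extension X ` remainder_compacts X \<subseteq> ext_tychonoff X"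
    using one_point_extension_fibre_extension tychonoff_fibre_extension
    by (auto simp: ext_tychonoff_def)
qed

text \<open>A map fixing \<open>X\<close> must also fix the added point, so the order compares
  topologies on one carrier; a larger fibre leaves fewer neighbourhoods of
  \<open>None\<close>.\<close>

lemma extension_le_iff_ext_fibre:
  assumes T: "T \<in> ext_tychonoff X" and T': "T' \<in> ext_tychonoff X"
  shows "extension_le X T T' \<longleftrightarrow> ext_fibre X T' \<subseteq> ext_fibre X T"
proof
  note top = ext_tychonoffD(1)[OF T] and top' = ext_tychonoffD(1)[OF T']
  assume "extension_le X T T'"
  then obtain f where f: "continuous_map T' T f" "\<And>x. x \<in> topspace X \<Longrightarrow> f (Some x) = Some x"
    unfolding extension_le_def by blast
  \<comment> \<open>If \<open>None\<close> went to \<open>Some x\<close>, then by density some point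
    of \<open>X\<close> near \<open>None\<close> would be mapped close to \<open>Some x\<close>.
    Being fixed by the map, it would lie in both of two disjoint neighbourhoods.\<close>
  have "f None = None"
  proof (rule ccontr)
    assume n: "f None \<noteq> None"
    have "f None \<in> topspace T" using f(1) top' by (auto simp: continuous_map_def)
    then obtain x where x: "f None = Some x" "x \<in> topspace X" using n top by auto
    obtain U V where UV: "openin T' U" "openin T' V" "Some x \<in> U" "None \<in> V" "disjnt U V"
      using ext_separate_None[OF T' x(2)] .
    define V' where "V' = V \<inter> {t \<in> topspace T'. f t \<in> Some ` ext_trace X U}"
    have "openin T' V'"
      unfolding V'_def
      by (intro openin_Int UV openin_continuous_map_preimage[OF f(1)] openin_ext_Some[OF T] openin_ext_trace[OF T'])
    moreover have "None \<in> V'" using UV(3,4) x top' by (auto simp: V'_def ext_trace_def)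
    ultimately obtain y where "y \<in> ext_trace X V'" using ext_trace_nonempty[OF T'] by blast
    then have "y \<in> topspace X" "Some y \<in> V" "f (Some y) \<in> Some ` ext_trace X U"
      by (auto simp: ext_trace_def V'_def)
    then have "Some y \<in> U \<inter> V" using f(2) by (auto simp: ext_trace_def)
    then show False using UV(5) by (auto simp: disjnt_def)
  qed
  show "ext_fibre X T' \<subseteq> ext_fibre X T"
    unfolding ext_fibre_def[of X T]
  proof (rule INT_greatest)
    fix U assume "U \<in> {U. openin T U \<and> None \<in> U}"
    then have U: "openin T U" "None \<in> U" by auto
    define U' where "U' = {t \<in> topspace T'. f t \<in> U}"
    have "openin T' U'" unfolding U'_def by (rule openin_continuous_map_preimage[OF f(1) U(1)])
    moreover have "None \<in> U'" using U(2) \<open>f None = None\<close> top' by (simp add: U'_def)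
    ultimately have "ext_fibre X T' \<subseteq> bX closure_of (e ` ext_trace X U')"
      by (rule ext_fibre_subset_closure)
    moreover have "ext_trace X U' = ext_trace X U"
      using f(2) top' by (auto simp: ext_trace_def U'_def)
    ultimately show "ext_fibre X T' \<subseteq> bX closure_of (e ` ext_trace X U)" by simp
  qed
next
  assume sub: "ext_fibre X T' \<subseteq> ext_fibre X T"
  have top: "topspace T' = topspace T" using ext_tychonoffD(1)[OF T] ext_tychonoffD(1)[OF T'] by simp
  have "openin T' U" if U: "openin T U" for U
  proof -
    have "openin (fibre_extension X (ext_fibre X T)) U"
      using U fibre_extension_ext_fibre[OF T] by simp
    then have "openin (fibre_extension X (ext_fibre X T')) U"
      unfolding openin_fibre_extension using sub by (meson subset_trans)
    then show ?thesis using fibre_extension_ext_fibre[OF T'] by simp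
  qed
  then have "continuous_map T' T (\<lambda>t. t)"
    using top openin_subset by (fastforce simp: continuous_map_def Int_def[symmetric] Int_absorb1)
  then show "extension_le X T T'" unfolding extension_le_def by blast
qed

lemma continuous_map_ext_tychonoff:
  fixes g :: "(('a \<Rightarrow> real) \<Rightarrow> real) \<Rightarrow> real"
  assumes T: "T \<in> ext_tychonoff X" and g: "continuous_map bX (top_of_set {0..1}) g"
    and c: "\<And>z. z \<in> ext_fibre X T \<Longrightarrow> g z = c"
  shows "continuous_map T (top_of_set {0..1}) (case_option c (\<lambda>x. g (e x)))"
proof -
  have g01: "g z \<in> {0..1}" if "z \<in> topspace bX" for z using g that by (auto simp: continuous_map_def)
  note F = ext_fibre_remainder_compact[OF T]
  obtain z where "z \<in> ext_fibre X T" using remainder_compactsD(1)[OF F] by blast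
  then have "c \<in> {0..1}" using g01 c remainder_compactsD(5)[OF F] by blast
  moreover have "continuous_map T euclideanreal (case_option c (\<lambda>x. g (e x)))"
    using continuous_map_fibre_extension[OF F, of g c] c g fibre_extension_ext_fibre[OF T]
    by (simp add: continuous_map_in_subtopology)
  ultimately show ?thesis
    using g01 e_in ext_tychonoffD(1)[OF T] by (auto simp: continuous_map_in_subtopology)
qed

end

text \<open>The canonical map from \<open>\<beta>X\<close> to \<open>\<beta>T\<close> in
  coordinates: precomposition with the inclusion of \<open>X\<close>. The restriction is present
  because coordinates are indexed by extensional maps.\<close>

definition sc_lift :: "'a topology \<Rightarrow> 'a option topology \<Rightarrow> (('a \<Rightarrow> real) \<Rightarrow> real) \<Rightarrow> (('a option \<Rightarrow> real) \<Rightarrow> real)" where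
  "sc_lift X T z = (\<lambda>f\<in>unit_maps T. z (restrict (f \<circ> Some) (topspace X)))"

section \<open>The lift to \<open>\<beta>T\<close>, Cech-completeness and countable local
  bases\<close>

context tychonoff
begin

lemma continuous_map_coordinate:
  assumes "f \<in> unit_maps X"
  shows "continuous_map bX (top_of_set {0..1}) (\<lambda>z. z f)"
  unfolding stone_cech_def unit_cube_def
  by (rule continuous_map_from_subtopology, rule continuous_map_product_projection[OF assms])

lemma unit_maps_restrict_Some:
  assumes T: "T \<in> ext_tychonoff X" and f: "f \<in> unit_maps T"
  shows "restrict (f \<circ> Some) (topspace X) \<in> unit_maps X"
proof -
  have "continuous_map X (top_of_set {0..1}) (f \<circ> Some)"
    using f continuous_map_ext_Some[OF T] unfolding unit_maps_def by (auto intro: continuous_map_compose)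
  then have "continuous_map X (top_of_set {0..1}) (restrict (f \<circ> Some) (topspace X))"
    by (rule continuous_map_eq) simp
  then show ?thesis by (simp add: unit_maps_def)
qed

lemma sc_lift_e:
  assumes T: "T \<in> ext_tychonoff X" and x: "x \<in> topspace X"
  shows "sc_lift X T (e x) = sc_embed T (Some x)"
  using x unit_maps_restrict_Some[OF T] by (auto simp: sc_lift_def sc_embed_def restrict_def)

lemma continuous_map_sc_lift:
  assumes T: "T \<in> ext_tychonoff X"
  shows "continuous_map bX (unit_cube T) (sc_lift X T)"
  unfolding unit_cube_def continuous_map_componentwise
proof (intro conjI ballI)
  show "sc_lift X T ` topspace bX \<subseteq> extensional (unit_maps T)" by (auto simp: sc_lift_def)
  fix f assume f: "f \<in> unit_maps T"
  show "continuous_map bX (top_of_set {0..1}) (\<lambda>z. sc_lift X T z f)"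
    using continuous_map_coordinate[OF unit_maps_restrict_Some[OF T f]] f by (simp add: sc_lift_def)
qed

text \<open>A point of the fibre lies in the closure of the trace of every set where
  \<open>f\<close> is within \<open>r\<close> of \<open>f None\<close>, so its coordinate is within
  \<open>r\<close> of that value for all positive \<open>r\<close>.\<close>

lemma sc_lift_fibre:
  assumes T: "T \<in> ext_tychonoff X" and z: "z \<in> ext_fibre X T"
  shows "sc_lift X T z = sc_embed T None"
proof -
  note top = ext_tychonoffD(1)[OF T]
  have "z (restrict (f \<circ> Some) (topspace X)) = f None" if f: "f \<in> unit_maps T" for f
  proof -
    let ?g = "restrict (f \<circ> Some) (topspace X)"
    have gc: "continuous_map bX euclideanreal (\<lambda>z. z ?g)"
      using continuous_map_coordinate[OF unit_maps_restrict_Some[OF T f]]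
      by (simp add: continuous_map_in_subtopology)
    have fc: "continuous_map T euclideanreal f"
      using f by (simp add: unit_maps_def continuous_map_in_subtopology)
    have "z ?g \<in> cball (f None) r" if r: "r > 0" for r
    proof -
      define U where "U = {t \<in> topspace T. f t \<in> ball (f None) r}"
      have U: "openin T U" unfolding U_def by (rule openin_continuous_map_preimage[OF fc]) simp
      have "None \<in> U" using top r by (simp add: U_def)
      then have "z \<in> bX closure_of (e ` ext_trace X U)" using ext_fibre_subset_closure[OF U] z by blast
      also have "\<dots> \<subseteq> {z \<in> topspace bX. z ?g \<in> cball (f None) r}"
      proof (rule closure_of_minimal)
        show "closedin bX {z \<in> topspace bX. z ?g \<in> cball (f None) r}"
          by (rule closedin_continuous_map_preimage[OF gc]) simp
        show "e ` ext_trace X U \<subseteq> {z \<in> topspace bX. z ?g \<in> cball (f None) r}"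
        proof
          fix w assume "w \<in> e ` ext_trace X U"
          then obtain x where x: "w = e x" "x \<in> topspace X" "Some x \<in> U" by (auto simp: ext_trace_def)
          have "e x ?g = f (Some x)"
            using unit_maps_restrict_Some[OF T f] x(2) by (simp add: sc_embed_def)
          then show "w \<in> {z \<in> topspace bX. z ?g \<in> cball (f None) r}"
            using x e_in by (simp add: U_def)
        qed
      qed
      finally show ?thesis by blast
    qed
    then have "dist (f None) (z ?g) \<le> r" if "r > 0" for r using that by (simp add: mem_cball)
    then have "dist (f None) (z ?g) \<le> 0" by (rule field_le_epsilon) simp
    then show ?thesis by simp
  qed
  then show ?thesis by (auto simp: sc_lift_def sc_embed_def restrict_def)
qed

text \<open>The image is compact, hence closed in the cube, and contains the embedded copy of
  \<open>T\<close>.\<close>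

lemma sc_lift_image:
  assumes T: "T \<in> ext_tychonoff X"
  shows "sc_lift X T ` topspace bX = topspace (stone_cech T)"
proof
  note top = ext_tychonoffD(1)[OF T]
  note cont = continuous_map_sc_lift[OF T]
  have im: "sc_lift X T ` eX \<subseteq> sc_embed T ` topspace T"
    using sc_lift_e[OF T] top by auto
  have topT: "topspace (stone_cech T) = unit_cube T closure_of (sc_embed T ` topspace T)"
    unfolding stone_cech_def by (simp add: closure_of_subset_topspace Int_absorb1)
  have "sc_lift X T ` (bX closure_of eX) \<subseteq> unit_cube T closure_of (sc_lift X T ` eX)"
    by (rule continuous_map_image_closure_subset[OF cont])
  also have "\<dots> \<subseteq> unit_cube T closure_of (sc_embed T ` topspace T)" by (rule closure_of_mono[OF im])
  finally show "sc_lift X T ` topspace bX \<subseteq> topspace (stone_cech T)" unfolding dense topT .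
  have "Hausdorff_space (unit_cube T)"
    unfolding unit_cube_def Hausdorff_space_product_topology by (simp add: Hausdorff_space_subtopology)
  moreover have "compactin (unit_cube T) (sc_lift X T ` topspace bX)"
    using compact_stone_cech[of X] cont unfolding compact_space_def by (rule image_compactin)
  ultimately have "closedin (unit_cube T) (sc_lift X T ` topspace bX)"
    by (rule compactin_imp_closedin)
  moreover have "sc_embed T ` topspace T \<subseteq> sc_lift X T ` topspace bX"
  proof
    fix w assume "w \<in> sc_embed T ` topspace T"
    then consider "w = sc_embed T None" | x where "x \<in> topspace X" "w = sc_embed T (Some x)"
      using top by auto
    then show "w \<in> sc_lift X T ` topspace bX"
    proof cases
      case 1
      note F = ext_fibre_remainder_compact[OF T]
      obtain z where z: "z \<in> ext_fibre X T" using remainder_compactsD(1)[OF F] by blast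
      then have "z \<in> topspace bX" using remainder_compactsD(5)[OF F] by blast
      then show ?thesis using sc_lift_fibre[OF T z] 1 by force
    next
      case 2
      then show ?thesis using sc_lift_e[OF T] e_in by force
    qed
  qed
  ultimately show "topspace (stone_cech T) \<subseteq> sc_lift X T ` topspace bX"
    unfolding topT by (intro closure_of_minimal)
qed

lemma sc_lift_remainder:
  assumes T: "T \<in> ext_tychonoff X" and z: "z \<in> topspace bX" "z \<notin> eX" "z \<notin> ext_fibre X T"
  shows "sc_lift X T z \<notin> sc_embed T ` topspace T"
proof
  note top = ext_tychonoffD(1)[OF T]
  note F = ext_fibre_remainder_compact[OF T]
  assume "sc_lift X T z \<in> sc_embed T ` topspace T"
  then obtain t where t: "t \<in> topspace T" "sc_lift X T z = sc_embed T t" by blast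
  \<comment> \<open>A function on \<open>\<beta>X\<close> that is constant on the fibre descends to
    \<open>T\<close> and so gives a coordinate of \<open>\<beta>T\<close>. If it distinguishes
    \<open>z\<close> from \<open>t\<close>, their images differ there.\<close>
  have key: False if g: "continuous_map bX (top_of_set {0..1::real}) g" "\<And>z. z \<in> ext_fibre X T \<Longrightarrow> g z = c"
    and ne: "case_option c (\<lambda>x. g (e x)) t \<noteq> g z" for g c
  proof -
    define f where "f = restrict (case_option c (\<lambda>x. g (e x))) (topspace T)"
    have "continuous_map T (top_of_set {0..1}) f"
      unfolding f_def by (rule continuous_map_eq[OF continuous_map_ext_tychonoff[OF T g]]) auto
    then have f: "f \<in> unit_maps T" by (simp add: unit_maps_def f_def)
    let ?g = "restrict (f \<circ> Some) (topspace X)"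
    have g': "?g \<in> unit_maps X" by (rule unit_maps_restrict_Some[OF T f])
    have "z ?g = g z"
    proof (rule extensions_agree[OF _ _ _ z(1)])
      show "continuous_map bX euclideanreal (\<lambda>z. z ?g)" "continuous_map bX euclideanreal g"
        using continuous_map_coordinate[OF g'] g(1) by (simp_all add: continuous_map_in_subtopology)
      show "e x ?g = g (e x)" if "x \<in> topspace X" for x
      proof -
        have "e x ?g = ?g x" unfolding sc_embed_def using g' by (rule restrict_apply')
        also have "\<dots> = f (Some x)" using that by simp
        also have "\<dots> = g (e x)" unfolding f_def using that top by (subst restrict_apply') auto
        finally show ?thesis .
      qed
    qed
    moreover have "sc_lift X T z f = z ?g" using f by (simp add: sc_lift_def)
    moreover have "sc_embed T t f = case_option c (\<lambda>x. g (e x)) t" 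
    proof -
      have "sc_embed T t f = f t" unfolding sc_embed_def using f by (rule restrict_apply')
      also have "\<dots> = case_option c (\<lambda>x. g (e x)) t" unfolding f_def using t(1) by (rule restrict_apply')
      finally show ?thesis .
    qed
    ultimately show False using t(2) ne by simp
  qed
  have zcl: "closedin bX {z}" by (rule closedin_bX_sing[OF z(1)])
  show False
  proof (cases t)
    case None
    obtain g where g: "continuous_map bX (top_of_set {0..1::real}) g" "\<And>w. w \<in> ext_fibre X T \<Longrightarrow> g w = 0"
      "\<And>w. w \<in> {z} \<Longrightarrow> g w = 1"
      using urysohn[OF remainder_compactsD(3)[OF F] zcl] z(3) by blast
    show False by (rule key[OF g(1,2)]) (use None g(3) in auto)
  next
    case (Some x)
    then have x: "x \<in> topspace X" using t(1) top by auto
    have "closedin bX {e x}" by (rule closedin_bX_sing[OF e_in[OF x]])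
    moreover have "closedin bX (ext_fibre X T \<union> {z})"
      using remainder_compactsD(3)[OF F] zcl by (rule closedin_Un)
    moreover have "{e x} \<inter> (ext_fibre X T \<union> {z}) = {}"
      using remainder_compactsD(4)[OF F] x z(2) by blast
    ultimately obtain g where g: "continuous_map bX (top_of_set {0..1::real}) g" "\<And>w. w \<in> {e x} \<Longrightarrow> g w = 0"
      "\<And>w. w \<in> ext_fibre X T \<union> {z} \<Longrightarrow> g w = 1"
      using urysohn by blast
    show False by (rule key[OF g(1), of 1]) (use Some g(2,3) in auto)
  qed
qed

text \<open>The lift sends exactly \<open>X\<close> and the fibre into \<open>T\<close>, so the rest
  of \<open>\<beta>X\<close> is the full preimage of the remainder of \<open>\<beta>T\<close> and is
  mapped onto it. Compact sets are pushed forward; conversely the complementary G-delta is pulled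
  back.\<close>

lemma cech_complete_iff_ext_fibre:
  assumes T: "T \<in> ext_tychonoff X"
  shows "cech_complete_space T \<longleftrightarrow> sigma_compactin bX (topspace bX - eX - ext_fibre X T)"
proof -
  note top = ext_tychonoffD(1)[OF T]
  let ?R = "topspace bX - eX - ext_fibre X T" and ?S = "topspace (stone_cech T) - sc_embed T ` topspace T"
  have tT: "tychonoff_space T" using T by (simp add: ext_tychonoff_def)
  have cont: "continuous_map bX (stone_cech T) (sc_lift X T)"
    using continuous_map_sc_lift[OF T] sc_lift_image[OF T]
    unfolding stone_cech_def[of T] continuous_map_in_subtopology by auto
  have in_iff: "sc_lift X T z \<in> sc_embed T ` topspace T \<longleftrightarrow> z \<in> eX \<union> ext_fibre X T" if "z \<in> topspace bX" for z
  proof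
    assume "z \<in> eX \<union> ext_fibre X T"
    then show "sc_lift X T z \<in> sc_embed T ` topspace T"
      using sc_lift_e[OF T] sc_lift_fibre[OF T] top by auto
  qed (use sc_lift_remainder[OF T that] in blast)
  have im: "sc_lift X T ` ?R = ?S"
  proof
    show "sc_lift X T ` ?R \<subseteq> ?S"
    proof (rule image_subsetI)
      fix z assume z: "z \<in> ?R"
      then have "sc_lift X T z \<in> topspace (stone_cech T)" using sc_lift_image[OF T] by blast
      moreover have "sc_lift X T z \<notin> sc_embed T ` topspace T" using z in_iff by simp
      ultimately show "sc_lift X T z \<in> ?S" by simp
    qed
    show "?S \<subseteq> sc_lift X T ` ?R"
    proof
      fix w assume w: "w \<in> ?S"
      then obtain z where "z \<in> topspace bX" "w = sc_lift X T z" using sc_lift_image[OF T] by blast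
      then show "w \<in> sc_lift X T ` ?R" using w in_iff by blast
    qed
  qed
  have "cech_complete_space T \<longleftrightarrow> sigma_compactin (stone_cech T) ?S"
    using tT sigma_compactin_eq_fsigma_in[OF compact_stone_cech[of T] Hausdorff_stone_cech[of T]]
    by (simp add: cech_complete_space_def)
  also have "\<dots> \<longleftrightarrow> sigma_compactin bX ?R"
  proof
    assume "sigma_compactin bX ?R"
    then show "sigma_compactin (stone_cech T) ?S" using sigma_compactin_image[OF cont] im by metis
  next
    assume "sigma_compactin (stone_cech T) ?S"
    then have "fsigma_in (stone_cech T) ?S"
      using sigma_compactin_eq_fsigma_in[OF compact_stone_cech[of T] Hausdorff_stone_cech[of T]] by simp
    moreover have sub: "sc_embed T ` topspace T \<subseteq> topspace (stone_cech T)"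
      using sc_lift_e[OF T] sc_embed_in_unit_cube[of T] closure_of_subset[OF sc_embed_in_unit_cube[of T]]
      by (simp add: stone_cech_def)
    ultimately have "gdelta_in (stone_cech T) (sc_embed T ` topspace T)"
      by (simp add: gdelta_in_fsigma_in)
    then have "gdelta_in bX {z \<in> topspace bX. sc_lift X T z \<in> sc_embed T ` topspace T}"
      by (rule gdelta_in_continuous_map_preimage[OF cont])
    then have "fsigma_in bX (topspace bX - {z \<in> topspace bX. sc_lift X T z \<in> sc_embed T ` topspace T})"
      by (simp add: gdelta_in_fsigma_in)
    moreover have "topspace bX - {z \<in> topspace bX. sc_lift X T z \<in> sc_embed T ` topspace T} = ?R"
      using in_iff by blast
    ultimately show "sigma_compactin bX ?R"
      using sigma_compactin_eq_fsigma_in[OF compact_stone_cech[of X] Hausdorff_stone_cech[of X]] by simp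
  qed
  finally show ?thesis .
qed

text \<open>Neighbourhoods of the added point correspond to neighbourhoods of the fibre, and in a
  compact Hausdorff space a closed set has a countable neighbourhood base iff it is a
  G-delta.\<close>

lemma countable_local_base_iff_ext_fibre:
  assumes T: "T \<in> ext_tychonoff X"
  shows "countable_local_base_at T None \<longleftrightarrow> gdelta_in bX (ext_fibre X T)"
proof
  note top = ext_tychonoffD(1)[OF T]
  note F = ext_fibre_remainder_compact[OF T]
  assume "countable_local_base_at T None"
  then obtain \<B> where \<B>: "countable \<B>" "\<forall>B\<in>\<B>. openin T B \<and> None \<in> B"
    "\<forall>U. openin T U \<and> None \<in> U \<longrightarrow> (\<exists>B\<in>\<B>. B \<subseteq> U)"
    unfolding countable_local_base_at_def by (elim exE conjE) (rule that)
  have "\<forall>B\<in>\<B>. \<exists>W. openin bX W \<and> ext_fibre X T \<subseteq> W \<and> sc_trace X W \<subseteq> ext_trace X B"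
  proof
    fix B assume "B \<in> \<B>"
    then have B: "openin T B" "None \<in> B" using \<B>(2) by simp_all
    show "\<exists>W. openin bX W \<and> ext_fibre X T \<subseteq> W \<and> sc_trace X W \<subseteq> ext_trace X B"
      by (rule ext_fibre_nbhd_trace[OF T B]) (intro exI conjI)
  qed
  then obtain W where W: "\<And>B. B \<in> \<B> \<Longrightarrow> openin bX (W B)" "\<And>B. B \<in> \<B> \<Longrightarrow> ext_fibre X T \<subseteq> W B"
    "\<And>B. B \<in> \<B> \<Longrightarrow> sc_trace X (W B) \<subseteq> ext_trace X B"
    by metis
  have "None \<in> topspace T" using top by simp
  then obtain B\<^sub>0 where B\<^sub>0: "B\<^sub>0 \<in> \<B>" using \<B>(3) openin_topspace by meson
  have "ext_fibre X T = \<Inter>(W ` \<B>)"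
  proof
    show "ext_fibre X T \<subseteq> \<Inter>(W ` \<B>)" using W(2) by blast
    show "\<Inter>(W ` \<B>) \<subseteq> ext_fibre X T"
      unfolding ext_fibre_def
    proof (rule INT_greatest)
      fix U assume "U \<in> {U. openin T U \<and> None \<in> U}"
      then obtain B where B: "B \<in> \<B>" "B \<subseteq> U" using \<B>(3) by blast
      have "\<Inter>(W ` \<B>) \<subseteq> W B" using B(1) by blast
      also have "\<dots> \<subseteq> bX closure_of (e ` sc_trace X (W B))"
        by (rule open_subset_closure_trace[OF W(1)[OF B(1)]])
      also have "\<dots> \<subseteq> bX closure_of (e ` ext_trace X U)"
        using W(3)[OF B(1)] B(2) by (intro closure_of_mono image_mono) (auto simp: ext_trace_def)
      finally show "\<Inter>(W ` \<B>) \<subseteq> bX closure_of (e ` ext_trace X U)" .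
    qed
  qed
  moreover have "gdelta_in bX (\<Inter>(W ` \<B>))"
    using \<B>(1) B\<^sub>0 W(1) by (intro gdelta_in_Inter) (auto intro: open_imp_gdelta_in)
  ultimately show "gdelta_in bX (ext_fibre X T)" by simp
next
  note F = ext_fibre_remainder_compact[OF T]
  let ?F = "ext_fibre X T"
  assume "gdelta_in bX ?F"
  then obtain C where C: "\<And>n. openin bX (C n)" "\<And>n. C (Suc n) \<subseteq> C n" "\<Inter>(range C) = ?F"
    unfolding gdelta_in_descending by blast
  \<comment> \<open>Shrinking with closures turns the G-delta into an intersection of closed
    neighbourhoods, to which the compactness argument below applies.\<close>
  have "\<forall>n. \<exists>V. openin bX V \<and> ?F \<subseteq> V \<and> bX closure_of V \<subseteq> C n"
  proof
    fix n
    have "?F \<subseteq> C n" using C(3) by blast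
    then show "\<exists>V. openin bX V \<and> ?F \<subseteq> V \<and> bX closure_of V \<subseteq> C n"
      using normal_bX remainder_compactsD(3)[OF F] C(1)[of n] unfolding normal_space_alt by blast
  qed
  then obtain V where V: "\<And>n. openin bX (V n)" "\<And>n. ?F \<subseteq> V n" "\<And>n. bX closure_of (V n) \<subseteq> C n"
    by metis
  \<comment> \<open>The sets \<open>V n\<close> need not decrease; after intersecting them one index
    takes care of finitely many.\<close>
  define Vn where "Vn n = (\<Inter>i\<le>n. V i)" for n :: nat
  have Vn: "openin bX (Vn n)" "?F \<subseteq> Vn n" for n
    using V(1,2) by (auto simp: Vn_def)
  define B where "B n = insert None (Some ` sc_trace X (Vn n))" for n
  show "countable_local_base_at T None"
    unfolding countable_local_base_at_def
  proof (intro exI conjI ballI allI impI)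
    show "countable (range B)" by simp
    show "openin T U" "None \<in> U" if "U \<in> range B" for U
      using that openin_ext_of_nbhd[OF T Vn] by (auto simp: B_def)
    fix U assume U: "openin T U \<and> None \<in> U"
    then obtain W where W: "openin bX W" "?F \<subseteq> W" "sc_trace X W \<subseteq> ext_trace X U"
      using ext_fibre_nbhd_trace[OF T] by metis
    have "compactin bX (topspace bX - W)"
      using W(1) by (intro closedin_compact_space[OF compact_stone_cech] closedin_diff) auto
    moreover have "\<forall>D\<in>range (\<lambda>n. bX closure_of (V n)). closedin bX D" by auto
    moreover have "(topspace bX - W) \<inter> \<Inter>(range (\<lambda>n. bX closure_of (V n))) = {}"
    proof -
      have "\<Inter>(range (\<lambda>n. bX closure_of (V n))) \<subseteq> \<Inter>(range C)"
        using V(3) by (rule INF_superset_mono[OF subset_refl])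
      also have "\<dots> \<subseteq> W" using C(3) W(2) by simp
      finally show ?thesis by blast
    qed
    ultimately obtain \<F> where \<F>: "finite \<F>" "\<F> \<subseteq> range (\<lambda>n. bX closure_of (V n))"
      "(topspace bX - W) \<inter> \<Inter>\<F> = {}"
      unfolding compactin_fip by meson
    from finite_subset_image[OF \<F>(1,2)]
    obtain N where N: "finite N" "\<F> = (\<lambda>n. bX closure_of (V n)) ` N"
      by (elim bexE exE conjE) (rule that)
    obtain m where m: "\<And>n. n \<in> N \<Longrightarrow> n \<le> m" using N(1) finite_nat_set_iff_bounded_le by meson
    have "Vn m \<subseteq> W"
    proof
      fix z assume z: "z \<in> Vn m"
      then have zb: "z \<in> topspace bX" using openin_subset[OF Vn(1)] by blast
      have "z \<in> bX closure_of (V n)" if "n \<in> N" for n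
        using z m[OF that] closure_of_subset[OF openin_subset[OF V(1)[of n]]] by (auto simp: Vn_def)
      then show "z \<in> W" using \<F>(3) N(2) zb by blast
    qed
    then have "sc_trace X (Vn m) \<subseteq> ext_trace X U" by (rule subset_trans[OF sc_trace_mono W(3)])
    then have "Some ` sc_trace X (Vn m) \<subseteq> U" by (auto simp: ext_trace_def)
    then have "B m \<subseteq> U" using U by (simp add: B_def)
    then show "\<exists>B\<in>range B. B \<subseteq> U" by blast
  qed
qed

end

section \<open>The set lambda and its remainder\<close>

locale sigma_compact_property = tychonoff X for X :: "'a topology" +
  fixes P :: "'u topology \<Rightarrow> bool" and i :: "'a option \<Rightarrow> 'u"
  assumes lc: "locally_compact_space X" and pc: "paracompact_space X"
    and inj_i: "inj i"
    and P: "topological_property P" "property_of_compact_spaces P" "closed_hereditary P"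
      "preserved_under_finite_sums P" "coincides_with_sigma_compactness P"
begin

abbreviation "R \<equiv> topspace bX - eX"
abbreviation "L \<equiv> lambda_set P X - eX"

definition clopen_sigma :: "'a set \<Rightarrow> bool" where
  "clopen_sigma S \<longleftrightarrow> openin X S \<and> closedin X S \<and> sigma_compactin X S"

definition cl :: "'a set \<Rightarrow> (('a \<Rightarrow> real) \<Rightarrow> real) set" where
  "cl A = bX closure_of (e ` A)"

lemma inj_i_Some: "inj (i \<circ> Some)"
  using inj_i by (auto simp: inj_on_def)

lemma cl_mono: "A \<subseteq> B \<Longrightarrow> cl A \<subseteq> cl B"
  unfolding cl_def by (intro closure_of_mono image_mono)

lemma closedin_cl: "closedin bX (cl A)"
  by (simp add: cl_def)

lemma compactin_cl: "compactin bX (cl A)"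
  using closedin_cl by (rule closedin_compact_space[OF compact_stone_cech])

lemma image_subset_cl: "A \<subseteq> topspace X \<Longrightarrow> e ` A \<subseteq> cl A"
  unfolding cl_def by (intro closure_of_subset) (auto simp: e_in)

lemma cl_topspace: "cl (topspace X) = topspace bX"
  by (simp add: cl_def dense)

lemma sc_trace_cl:
  assumes "closedin X A"
  shows "sc_trace X (cl A) = A"
proof
  have A: "A \<subseteq> topspace X" using assms by (rule closedin_subset)
  show "A \<subseteq> sc_trace X (cl A)" using image_subset_cl[OF A] A by (auto simp: sc_trace_def)
  show "sc_trace X (cl A) \<subseteq> A"
  proof
    fix x assume "x \<in> sc_trace X (cl A)"
    then have x: "x \<in> topspace X" "e x \<in> cl A" by (auto simp: sc_trace_def)
    show "x \<in> A"
    proof (rule ccontr)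
      assume "x \<notin> A"
      obtain W where W: "openin bX W" "sc_trace X W = topspace X - A"
        using open_extends[of "topspace X - A"] assms by blast
      have "W \<inter> e ` A = {}" using W(2) A by (auto simp: sc_trace_def)
      then have "W \<inter> cl A = {}" unfolding cl_def using openin_Int_closure_of_eq_empty[OF W(1)] by blast
      moreover have "e x \<in> W" using W(2) x(1) \<open>x \<notin> A\<close> by (auto simp: sc_trace_def)
      ultimately show False using x(2) by blast
    qed
  qed
qed

text \<open>The characteristic function of a clopen set is continuous; its extension to
  \<open>\<beta>X\<close> keeps the closures of the set and of its complement apart.\<close>

lemma cl_clopen:
  assumes "openin X S" "closedin X S"
  shows "openin bX (cl S)" and "topspace bX - cl S = cl (topspace X - S)"
proof -
  have S: "S \<subseteq> topspace X" using assms(1) by (rule openin_subset)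
  define f :: "'a \<Rightarrow> real" where "f x = (if x \<in> S then 0 else 1)" for x
  have "continuous_map X (top_of_set {0..1}) f"
  proof -
    have "openin X {x \<in> topspace X. f x \<in> U}" for U
    proof -
      have "{x \<in> topspace X. f x \<in> U} = (if 0 \<in> U then S else {}) \<union> (if 1 \<in> U then topspace X - S else {})"
        using S by (auto simp: f_def)
      then show ?thesis using assms by (simp add: openin_Un openin_diff)
    qed
    then show ?thesis by (auto simp: continuous_map_in_subtopology continuous_map_def f_def)
  qed
  then obtain g where g: "continuous_map bX (top_of_set {0..1}) g" "\<And>x. x \<in> topspace X \<Longrightarrow> g (e x) = f x"
    using stone_cech_extension by metis
  have gc: "continuous_map bX euclideanreal g" using g(1) by (simp add: continuous_map_in_subtopology)
  have level: "cl A \<subseteq> {z \<in> topspace bX. g z \<in> {c}}" if "A \<subseteq> topspace X" "\<And>x. x \<in> A \<Longrightarrow> f x = c" for A c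
    unfolding cl_def
  proof (rule closure_of_minimal)
    show "e ` A \<subseteq> {z \<in> topspace bX. g z \<in> {c}}" using that g(2) e_in by auto
    show "closedin bX {z \<in> topspace bX. g z \<in> {c}}"
      by (rule closedin_continuous_map_preimage[OF gc]) simp
  qed
  have "cl S \<subseteq> {z \<in> topspace bX. g z \<in> {0}}" using S by (rule level) (simp add: f_def)
  moreover have "cl (topspace X - S) \<subseteq> {z \<in> topspace bX. g z \<in> {1}}" by (rule level) (auto simp: f_def)
  ultimately have disj: "cl S \<inter> cl (topspace X - S) = {}" by fastforce
  have "topspace X = S \<union> (topspace X - S)" using S by blast
  then have "cl S \<union> cl (topspace X - S) = cl (topspace X)"
    unfolding cl_def by (metis closure_of_Un image_Un)
  then show eq: "topspace bX - cl S = cl (topspace X - S)"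
    unfolding cl_topspace using disj by blast
  have "cl S = topspace bX - cl (topspace X - S)"
    using eq closedin_subset[OF closedin_cl[of S]] by blast
  then show "openin bX (cl S)" using closedin_cl by (simp add: openin_diff)
qed

lemma clopen_sigmaD:
  assumes "clopen_sigma S"
  shows "openin X S" "closedin X S" "sigma_compactin X S" "S \<subseteq> topspace X" "openin bX (cl S)"
    "sc_trace X (cl S) = S"
  using assms cl_clopen(1) sc_trace_cl openin_subset[of X S] by (simp_all add: clopen_sigma_def)

lemma clopen_sigma_superset:
  assumes "sigma_compactin X A"
  obtains S where "clopen_sigma S" "A \<subseteq> S"
  using sigma_compact_clopen_superset[OF lc pc assms] unfolding clopen_sigma_def by metis

text \<open>Closed subspaces of \<open>X\<close> are locally compact and paracompact, so the
  coincidence hypothesis applies to them.\<close>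

lemma has_property_closedin_iff:
  assumes C: "closedin X C"
  shows "has_property P (subtopology X C) \<longleftrightarrow> sigma_compactin X C"
proof -
  have "has_property P (subtopology X C) \<longleftrightarrow> sigma_compact_space (subtopology X C)"
    using inj_i_Some P(1,5) locally_compact_space_closed_subset[OF lc C] paracompact_space_closed_subset[OF pc C]
    by (rule has_property_iff_sigma_compact)
  then show ?thesis
    using closedin_subset[OF C]
    by (simp add: sigma_compact_space_def sigma_compactin_subtopology Int_absorb1)
qed

text \<open>A \<sigma>-compact closure of a cozero-set lies in a clopen \<sigma>-compact set.
  Conversely such a set is a cozero-set equal to its closure in \<open>X\<close>, and its closure in
  \<open>\<beta>X\<close> is open.\<close>

lemma lambda_set_eq: "lambda_set P X = (\<Union>S\<in>Collect clopen_sigma. cl S)"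
proof
  show "lambda_set P X \<subseteq> (\<Union>S\<in>Collect clopen_sigma. cl S)"
  proof
    fix z assume "z \<in> lambda_set P X"
    then obtain C where C: "cozero_set X C" "has_property P (subtopology X (X closure_of C))"
      and z: "z \<in> bX interior_of (bX closure_of (e ` C))"
      unfolding lambda_set_def by blast
    have "sigma_compactin X (X closure_of C)"
      using C(2) has_property_closedin_iff[OF closedin_closure_of] by blast
    then obtain S where S: "clopen_sigma S" "X closure_of C \<subseteq> S" by (rule clopen_sigma_superset)
    have "C \<subseteq> topspace X" using C(1) by (auto simp: cozero_set_def)
    then have "C \<subseteq> S" using subset_trans[OF closure_of_subset S(2)] by blast
    then have "cl C \<subseteq> cl S" by (rule cl_mono)
    moreover have "z \<in> cl C" using z subsetD[OF interior_of_subset] unfolding cl_def by metis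
    ultimately have "z \<in> cl S" by blast
    then show "z \<in> (\<Union>S\<in>Collect clopen_sigma. cl S)" using S(1) by blast
  qed
  show "(\<Union>S\<in>Collect clopen_sigma. cl S) \<subseteq> lambda_set P X"
  proof (rule UN_least)
    fix S assume "S \<in> Collect clopen_sigma"
    then have "clopen_sigma S" by simp
    note S = clopen_sigmaD[OF this]
    have "cozero_set X S"
      unfolding cozero_set_def
    proof (intro exI conjI)
      define f :: "'a \<Rightarrow> real" where "f x = (if x \<in> S then 1 else 0)" for x
      have "openin X {x \<in> topspace X. f x \<in> U}" for U
      proof -
        have "{x \<in> topspace X. f x \<in> U} = (if 1 \<in> U then S else {}) \<union> (if 0 \<in> U then topspace X - S else {})"
          using S(4) by (auto simp: f_def)
        then show ?thesis using S(1,2) by (simp add: openin_Un openin_diff)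
      qed
      then show "continuous_map X (top_of_set {0..1}) f"
        by (auto simp: continuous_map_in_subtopology continuous_map_def f_def)
      show "S = topspace X - {x \<in> topspace X. f x = 0}" using S(4) by (auto simp: f_def)
    qed
    moreover have "X closure_of S = S" using S(2) by (simp add: closure_of_eq)
    moreover have "has_property P (subtopology X S)" using has_property_closedin_iff[OF S(2)] S(3) by blast
    moreover have "bX interior_of (bX closure_of (e ` S)) = cl S"
      using S(5) unfolding cl_def by (rule interior_of_openin)
    ultimately show "cl S \<subseteq> lambda_set P X"
      unfolding lambda_set_def by (intro Union_upper CollectI exI[of _ S]) simp
  qed
qed

lemma cl_subset_lambda: "clopen_sigma S \<Longrightarrow> cl S \<subseteq> lambda_set P X"
  unfolding lambda_set_eq by blast

lemma lambda_subset: "lambda_set P X \<subseteq> topspace bX"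
  unfolding lambda_set_eq using closedin_subset[OF closedin_cl] by blast

lemma openin_lambda: "openin bX (lambda_set P X)"
  unfolding lambda_set_eq using clopen_sigmaD(5) by blast

lemma topspace_lambda_remainder: "topspace (lambda_remainder P X) = L"
  using lambda_subset by (auto simp: lambda_remainder_def)

lemma openin_eX: "openin bX eX"
proof (rule dense_locally_compact_openin_Hausdorff_space[OF Hausdorff_stone_cech _ dense])
  show "eX \<subseteq> topspace bX" using e_in by blast
  have "X homeomorphic_space subtopology bX eX"
    using homeomorphic_e by (rule homeomorphic_map_imp_homeomorphic_space)
  then show "locally_compact_space (subtopology bX eX)"
    using lc homeomorphic_locally_compact_space by blast
qed

lemma compactin_subset_lambda:
  assumes "compactin bX C" "C \<subseteq> lambda_set P X"
  obtains S where "clopen_sigma S" "C \<subseteq> cl S"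
proof -
  have "\<And>U. U \<in> cl ` Collect clopen_sigma \<Longrightarrow> openin bX U" using clopen_sigmaD(5) by auto
  moreover have "C \<subseteq> \<Union>(cl ` Collect clopen_sigma)" using assms(2) by (simp add: lambda_set_eq)
  ultimately obtain \<F> where \<F>: "finite \<F>" "\<F> \<subseteq> cl ` Collect clopen_sigma" "C \<subseteq> \<Union>\<F>"
    using compactinD[OF assms(1)] by meson
  from finite_subset_image[OF \<F>(1,2)]
  obtain \<S> where \<S>: "\<S> \<subseteq> Collect clopen_sigma" "finite \<S>" "\<F> = cl ` \<S>"
    by (elim bexE exE conjE) (rule that)
  have "sigma_compactin X (\<Union>\<S>)"
    using \<S>(1,2) clopen_sigmaD(3) by (intro countable_union_of_Union) (auto simp: countable_finite)
  then obtain S where S: "clopen_sigma S" "\<Union>\<S> \<subseteq> S" by (rule clopen_sigma_superset)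
  have "cl T \<subseteq> cl S" if "T \<in> \<S>" for T using that S(2) by (intro cl_mono) blast
  then have "C \<subseteq> cl S" using \<F>(3) \<S>(3) by blast
  with S(1) show ?thesis by (rule that)
qed

text \<open>Countably many clopen \<sigma>-compact sets have a \<sigma>-compact union, which lies in
  one further such set; this is why countably many compact pieces fit into a single closure.\<close>

lemma sigma_compactin_subset_lambda:
  assumes "sigma_compactin bX C" "C \<subseteq> lambda_set P X"
  obtains S where "clopen_sigma S" "C \<subseteq> cl S"
proof -
  obtain \<K> where \<K>: "countable \<K>" "\<forall>K\<in>\<K>. compactin bX K" "\<Union>\<K> = C"
    using assms(1) by (rule countable_union_ofE)
  have "\<forall>K\<in>\<K>. \<exists>S. clopen_sigma S \<and> K \<subseteq> cl S"
  proof
    fix K assume K: "K \<in> \<K>"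
    then have "compactin bX K" "K \<subseteq> lambda_set P X" using \<K>(2,3) assms(2) by auto
    then show "\<exists>S. clopen_sigma S \<and> K \<subseteq> cl S" by (rule compactin_subset_lambda) blast
  qed
  then obtain s where s: "\<forall>K\<in>\<K>. clopen_sigma (s K) \<and> K \<subseteq> cl (s K)" by metis
  have "sigma_compactin X (\<Union>(s ` \<K>))"
    using \<K>(1) s clopen_sigmaD(3) by (intro countable_union_of_Union) auto
  then obtain S where S: "clopen_sigma S" "\<Union>(s ` \<K>) \<subseteq> S" by (rule clopen_sigma_superset)
  have "C \<subseteq> cl S"
    unfolding \<K>(3)[symmetric]
  proof (rule Union_least)
    fix K assume K: "K \<in> \<K>"
    have "cl (s K) \<subseteq> cl S" using K S(2) by (intro cl_mono) blast
    then show "K \<subseteq> cl S" using s K by blast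
  qed
  with S(1) show ?thesis by (rule that)
qed

text \<open>The compact open superset is \<open>cl S\<close> without \<open>X\<close>: it is closed
  in \<open>\<beta>X\<close> because \<open>X\<close> is open there, and relatively open because
  \<open>cl S\<close> is open.\<close>

lemma sigma_bounded_lambda_remainder: "sigma_bounded_space (lambda_remainder P X)"
  unfolding sigma_bounded_space_def
proof (intro conjI allI impI)
  show "Hausdorff_space (lambda_remainder P X)"
    unfolding lambda_remainder_def using Hausdorff_stone_cech by (rule Hausdorff_space_subtopology)
  fix A assume "sigma_compactin (lambda_remainder P X) A"
  then have A: "sigma_compactin bX A" "A \<subseteq> L"
    by (simp_all add: lambda_remainder_def sigma_compactin_subtopology)
  then have "A \<subseteq> lambda_set P X" by blast
  with A(1) obtain S where S: "clopen_sigma S" "A \<subseteq> cl S" by (rule sigma_compactin_subset_lambda)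
  have "closedin bX (cl S - eX)" using closedin_cl openin_eX by (rule closedin_diff)
  then have "compactin bX (cl S - eX)" by (rule closedin_compact_space[OF compact_stone_cech])
  moreover have "cl S - eX = cl S \<inter> L" using cl_subset_lambda[OF S(1)] by blast
  moreover have "A \<subseteq> cl S \<inter> L" using S(2) A(2) by blast
  ultimately show "\<exists>K. compactin (lambda_remainder P X) K \<and> openin (lambda_remainder P X) K \<and> A \<subseteq> K"
    unfolding lambda_remainder_def using clopen_sigmaD(5)[OF S(1)]
    by (intro exI[of _ "cl S \<inter> L"]) (simp add: compactin_subtopology openin_subtopology_Int)
qed

text \<open>If \<open>L\<close> is covered by a single \<open>cl S\<close>, then \<open>X\<close> is \<open>\<sigma>\<close>-compact, for otherwise
  the complement of \<open>S\<close> contributes a point to \<open>L\<close>.\<close>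

lemma lambda_remainder_bounded:
  assumes S: "clopen_sigma S" and sub: "L \<subseteq> cl S"
  shows "L = R"
proof -
  note S' = clopen_sigmaD[OF S]
  define Q where "Q = topspace X - S"
  have Q: "closedin X Q" unfolding Q_def using S'(1) by blast
  \<comment> \<open>Otherwise some clopen \<sigma>-compact \<open>S1\<close> has noncompact
    intersection with \<open>Q\<close>, whose closure in \<open>\<beta>X\<close> contains a point
    outside \<open>X\<close>. That point lies in \<open>L\<close> through \<open>cl S1\<close>, but
    also in \<open>cl Q\<close>, which is disjoint from \<open>cl S\<close>.\<close>
  have "compactin X Q"
  proof (rule ccontr)
    assume "\<not> compactin X Q"
    then obtain S1 where S1: "openin X S1" "closedin X S1" "sigma_compactin X S1" "\<not> compactin X (S1 \<inter> Q)"
      by (rule noncompact_sigma_compact_clopen[OF lc pc Q])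
    have cQ: "closedin X (S1 \<inter> Q)" using S1(2) Q by (rule closedin_Int)
    have sQ: "S1 \<inter> Q \<subseteq> topspace X" using cQ by (rule closedin_subset)
    have "\<not> compactin bX (e ` (S1 \<inter> Q))"
    proof
      assume "compactin bX (e ` (S1 \<inter> Q))"
      then have "compactin (subtopology bX eX) (e ` (S1 \<inter> Q))"
        using sQ by (auto simp: compactin_subtopology)
      then show False using homeomorphic_map_compactness[OF homeomorphic_e sQ] S1(4) by blast
    qed
    then have "cl (S1 \<inter> Q) \<noteq> e ` (S1 \<inter> Q)" using compactin_cl[of "S1 \<inter> Q"] by metis
    then obtain z where z: "z \<in> cl (S1 \<inter> Q)" "z \<notin> e ` (S1 \<inter> Q)"
      using image_subset_cl[OF sQ] by blast
    have "z \<notin> eX"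
    proof
      assume "z \<in> eX"
      then have "z \<in> e ` sc_trace X (cl (S1 \<inter> Q))" using z(1) by (auto simp: sc_trace_def)
      then show False using z(2) sc_trace_cl[OF cQ] by simp
    qed
    moreover have "z \<in> cl S1" using z(1) cl_mono[of "S1 \<inter> Q" S1] by blast
    moreover have "clopen_sigma S1" using S1 by (simp add: clopen_sigma_def)
    ultimately have "z \<in> L" using cl_subset_lambda by blast
    moreover have "z \<in> cl Q" using z(1) cl_mono[of "S1 \<inter> Q" Q] by blast
    ultimately show False using sub cl_clopen(2)[OF S'(1,2)] by (auto simp: Q_def)
  qed
  then have "sigma_compactin X (S \<union> Q)"
    by (intro countable_union_of_Un[OF S'(3)] countable_union_of_inc)
  moreover have "S \<union> Q = topspace X" using S'(4) by (auto simp: Q_def)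
  ultimately have "clopen_sigma (topspace X)" by (simp add: clopen_sigma_def)
  then have "topspace bX \<subseteq> lambda_set P X" using cl_subset_lambda cl_topspace by metis
  then show ?thesis using lambda_subset by blast
qed

end

section \<open>Extensions with the property\<close>

context sigma_compact_property
begin

section \<open>The property and its local form for extensions, in terms of fibres\<close>

lemma homeomorphic_Some_image:
  assumes T: "T \<in> ext_tychonoff X" and Q: "Q \<subseteq> topspace X"
  shows "subtopology X Q homeomorphic_space subtopology T (Some ` Q)"
proof -
  have "homeomorphic_map X (subtopology T (Some ` topspace X)) Some"
    using ext_tychonoffD(2)[OF T] unfolding embedding_map_def .
  from homeomorphic_map_subtopology_image[OF this Q]
  have "homeomorphic_map (subtopology X Q) (subtopology T (Some ` topspace X \<inter> Some ` Q)) Some"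
    unfolding subtopology_subtopology .
  moreover have "Some ` topspace X \<inter> Some ` Q = Some ` Q" using Q by blast
  ultimately show ?thesis
    by (metis homeomorphic_map_imp_homeomorphic_space)
qed

lemma closedin_ext_trace:
  assumes T: "T \<in> ext_tychonoff X" and C: "closedin T C"
  shows "closedin X (ext_trace X C)"
proof -
  have "openin T (topspace T - C)" using C by blast
  then have "openin X (ext_trace X (topspace T - C))" by (rule openin_ext_trace[OF T])
  moreover have "ext_trace X (topspace T - C) = topspace X - ext_trace X C"
    using ext_tychonoffD(1)[OF T] by (auto simp: ext_trace_def)
  ultimately show ?thesis using ext_trace_subset[of X C] by (simp add: closedin_def)
qed

text \<open>A closed set missing the added point is a copy of a closed subspace of \<open>X\<close>,
  where the property means \<sigma>-compactness.\<close>

lemma has_property_closedin_ext: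
  assumes T: "T \<in> ext_tychonoff X" and C: "closedin T C" "None \<notin> C"
    and "has_property P (subtopology T C)"
  shows "sigma_compactin X (ext_trace X C)"
proof -
  have "C \<subseteq> insert None (Some ` topspace X)"
    using closedin_subset[OF C(1)] ext_tychonoffD(1)[OF T] by simp
  then have "Some ` ext_trace X C = C" using C(2) by (auto simp: ext_trace_def)
  then have "subtopology X (ext_trace X C) homeomorphic_space subtopology T C"
    using homeomorphic_Some_image[OF T ext_trace_subset[of X C]] by simp
  then have "has_property P (subtopology X (ext_trace X C))"
    using assms(4) has_property_homeomorphic homeomorphic_space_sym by blast
  then show ?thesis using has_property_closedin_iff[OF closedin_ext_trace[OF T C(1)]] by blast
qed

lemma has_property_clopen_sigma_ext:
  assumes T: "T \<in> ext_tychonoff X" and S: "clopen_sigma S"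
  shows "has_property P (subtopology T (Some ` S))"
proof -
  have "has_property P (subtopology X S)"
    using has_property_closedin_iff clopen_sigmaD(2,3)[OF S] by blast
  then show ?thesis
    using has_property_homeomorphic homeomorphic_Some_image[OF T clopen_sigmaD(4)[OF S]] by blast
qed

lemma has_property_compactin:
  fixes T :: "'a option topology"
  assumes "Hausdorff_space T" "compactin T C"
  shows "has_property P (subtopology T C)"
  using inj_i P(2) compact_space_subtopology[OF assms(2)] Hausdorff_space_subtopology[OF assms(1)]
  by (rule has_property_compact)

lemma has_property_ext_iff:
  assumes T: "T \<in> ext_tychonoff X" and cech: "sigma_compactin bX (R - ext_fibre X T)"
  shows "has_property P T \<longleftrightarrow> R - ext_fibre X T \<subseteq> lambda_set P X"
proof
  note top = ext_tychonoffD(1)[OF T]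
  note F = ext_fibre_remainder_compact[OF T]
  assume hp: "has_property P T"
  show "R - ext_fibre X T \<subseteq> lambda_set P X"
  proof
    fix z assume z: "z \<in> R - ext_fibre X T"
    have "closedin bX {z}" using z by (intro closedin_bX_sing) blast
    moreover have "disjnt (ext_fibre X T) {z}" using z by (simp add: disjnt_def)
    ultimately obtain W V where WV: "openin bX W" "openin bX V" "ext_fibre X T \<subseteq> W" "{z} \<subseteq> V" "disjnt W V"
      using normal_bX remainder_compactsD(3)[OF F] unfolding normal_space_def by meson
    \<comment> \<open>Removing this neighbourhood of \<open>None\<close> leaves a closed, hence
      \<sigma>-compact, part of \<open>X\<close> that contains the trace of the neighbourhood
      \<open>V\<close> of \<open>z\<close>.\<close>
    define U where "U = insert None (Some ` sc_trace X W)"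
    have "openin T U" unfolding U_def by (rule openin_ext_of_nbhd[OF T WV(1,3)])
    then have C: "closedin T (topspace T - U)" by blast
    have "has_property P (subtopology T (topspace T - U))"
      using P(1,3) hp C by (rule has_property_closedin)
    moreover have "None \<notin> topspace T - U" by (simp add: U_def)
    ultimately have "sigma_compactin X (ext_trace X (topspace T - U))"
      using has_property_closedin_ext[OF T C] by blast
    then obtain S where S: "clopen_sigma S" "ext_trace X (topspace T - U) \<subseteq> S" by (rule clopen_sigma_superset)
    have "sc_trace X V \<subseteq> ext_trace X (topspace T - U)"
      using WV(5) top by (auto simp: sc_trace_def ext_trace_def U_def disjnt_def)
    then have "cl (sc_trace X V) \<subseteq> cl S" using S(2) by (intro cl_mono) blast
    moreover have "z \<in> cl (sc_trace X V)"
      using open_subset_closure_trace[OF WV(2)] WV(4) unfolding cl_def by blast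
    ultimately show "z \<in> lambda_set P X" using cl_subset_lambda[OF S(1)] by blast
  qed
next
  note top = ext_tychonoffD(1)[OF T]
  note F = ext_fibre_remainder_compact[OF T]
  assume "R - ext_fibre X T \<subseteq> lambda_set P X"
  with cech obtain S where S: "clopen_sigma S" "R - ext_fibre X T \<subseteq> cl S"
    by (rule sigma_compactin_subset_lambda)
  note S' = clopen_sigmaD[OF S(1)]
  \<comment> \<open>\<open>T\<close> is split into \<open>S\<close>, which has the property by
    \<sigma>-compactness, and \<open>B\<close>, which has it by compactness.\<close>
  define B where "B = insert None (Some ` (topspace X - S))"
  have "compactin T B"
    unfolding compactin_def
  proof (intro conjI allI impI)
    show "B \<subseteq> topspace T" using top by (auto simp: B_def)
    fix \<U> assume \<U>: "(\<forall>U\<in>\<U>. openin T U) \<and> B \<subseteq> \<Union>\<U>"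
    then obtain U\<^sub>0 where U\<^sub>0: "U\<^sub>0 \<in> \<U>" "None \<in> U\<^sub>0" unfolding B_def by blast
    then have "openin T U\<^sub>0" using \<U> by blast
    then obtain W where W: "openin bX W" "ext_fibre X T \<subseteq> W" "sc_trace X W \<subseteq> ext_trace X U\<^sub>0"
      using ext_fibre_nbhd_trace[OF T _ U\<^sub>0(2)] by blast
    define Q where "Q = topspace X - S - sc_trace X W"
    have Q: "Q \<subseteq> topspace X" by (auto simp: Q_def)
    \<comment> \<open>Outside \<open>cl S\<close> and \<open>W\<close> no point of the remainder is
      left, so the part of \<open>B\<close> not covered by \<open>U\<^sub>0\<close> lies in a set
      whose image is closed in \<open>\<beta>X\<close>, hence compact.\<close>
    have "e ` Q = topspace bX - cl S - W"
    proof
      show "e ` Q \<subseteq> topspace bX - cl S - W"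
        using S'(6) e_in by (auto simp: Q_def sc_trace_def)
      show "topspace bX - cl S - W \<subseteq> e ` Q"
      proof
        fix z assume z: "z \<in> topspace bX - cl S - W"
        then have "z \<in> eX" using S(2) W(2) by blast
        then obtain x where x: "z = e x" "x \<in> topspace X" by blast
        then have "x \<in> Q" using z S'(4) image_subset_cl[OF S'(4)] by (auto simp: Q_def sc_trace_def)
        then show "z \<in> e ` Q" using x(1) by blast
      qed
    qed
    moreover have "closedin bX (topspace bX - cl S - W)"
      using S'(5) W(1) by (intro closedin_diff) auto
    ultimately have "compactin bX (e ` Q)"
      using closedin_compact_space[OF compact_stone_cech] by simp
    then have "compactin (subtopology bX eX) (e ` Q)" using Q by (auto simp: compactin_subtopology)
    then have "compactin X Q" using homeomorphic_map_compactness[OF homeomorphic_e Q] by blast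
    then have "compactin T (Some ` Q)" using continuous_map_ext_Some[OF T] by (rule image_compactin)
    moreover have "Some ` Q \<subseteq> \<Union>\<U>" using \<U> by (auto simp: B_def Q_def)
    moreover have "\<And>U. U \<in> \<U> \<Longrightarrow> openin T U" using \<U> by blast
    ultimately obtain \<F> where \<F>: "finite \<F>" "\<F> \<subseteq> \<U>" "Some ` Q \<subseteq> \<Union>\<F>"
      using compactinD by metis
    have "B \<subseteq> \<Union>(insert U\<^sub>0 \<F>)"
    proof
      fix t assume "t \<in> B"
      then consider "t = None" | x where "t = Some x" "x \<in> topspace X - S" by (auto simp: B_def)
      then show "t \<in> \<Union>(insert U\<^sub>0 \<F>)"
      proof cases
        case 2
        show ?thesis
        proof (cases "x \<in> sc_trace X W")
          case True
          then have "Some x \<in> U\<^sub>0" using W(3) by (auto simp: ext_trace_def)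
          then show ?thesis using 2 by simp
        next
          case False
          then have "Some x \<in> Some ` Q" using 2 by (simp add: Q_def)
          then have "Some x \<in> \<Union>\<F>" using \<F>(3) by (rule subsetD[rotated])
          then show ?thesis using 2 by simp
        qed
      qed (use U\<^sub>0 in simp)
    qed
    then show "\<exists>\<F>. finite \<F> \<and> \<F> \<subseteq> \<U> \<and> B \<subseteq> \<Union>\<F>"
      using \<F>(1,2) U\<^sub>0(1) by (intro exI[of _ "insert U\<^sub>0 \<F>"]) simp
  qed
  then have "has_property P (subtopology T B)"
    by (rule has_property_compactin[OF ext_tychonoffD(5)[OF T]])
  moreover have "Some ` S \<union> B = topspace T" using top S'(4) by (auto simp: B_def)
  ultimately show "has_property P T"
    using has_property_Un[OF inj_i P(1,4) ext_tychonoffD(5)[OF T]] has_property_clopen_sigma_ext[OF T S(1)]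
    by blast
qed

lemma ext_cech_eq:
  "ext_cech P X = {T \<in> ext_tychonoff X. sigma_compactin bX (R - ext_fibre X T) \<and>
     R - ext_fibre X T \<subseteq> lambda_set P X}"
  unfolding ext_cech_def using cech_complete_iff_ext_fibre has_property_ext_iff by blast

text \<open>A neighbourhood of \<open>None\<close> with the property in its closure consists, apart
  from \<open>None\<close>, of countably many \<sigma>-compact closed pieces, obtained by removing
  the members of the base; its trace thus lies in one clopen \<sigma>-compact set.\<close>

lemma locally_property_ext_iff:
  assumes T: "T \<in> ext_tychonoff X" and base: "countable_local_base_at T None"
  shows "locally_property P T \<longleftrightarrow> ext_fibre X T \<subseteq> lambda_set P X"
proof
  note top = ext_tychonoffD(1)[OF T]
  assume "locally_property P T"
  moreover have "None \<in> topspace T" using top by simp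
  ultimately obtain U where U: "openin T U" "None \<in> U" "has_property P (subtopology T (T closure_of U))"
    unfolding locally_property_def by meson
  obtain \<B> where \<B>: "countable \<B>" "\<forall>B\<in>\<B>. openin T B \<and> None \<in> B"
    "\<forall>U. openin T U \<and> None \<in> U \<longrightarrow> (\<exists>B\<in>\<B>. B \<subseteq> U)"
    using base unfolding countable_local_base_at_def by (elim exE conjE) (rule that)
  let ?Z = "T closure_of U"
  have sc: "sigma_compactin X (ext_trace X (?Z - B))" if B: "B \<in> \<B>" for B
  proof (rule has_property_closedin_ext[OF T])
    show C: "closedin T (?Z - B)" using B \<B>(2) by (intro closedin_diff) auto
    show "None \<notin> ?Z - B" using B \<B>(2) by simp
    have "closedin (subtopology T ?Z) (?Z - B)"
      using C by (simp add: closedin_closed_subtopology)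
    with P(1,3) U(3) have "has_property P (subtopology (subtopology T ?Z) (?Z - B))"
      by (rule has_property_closedin)
    moreover have "?Z \<inter> (?Z - B) = ?Z - B" by blast
    ultimately show "has_property P (subtopology T (?Z - B))"
      by (simp add: subtopology_subtopology)
  qed
  have "sigma_compactin X (\<Union>((\<lambda>B. ext_trace X (?Z - B)) ` \<B>))"
    using \<B>(1) sc by (intro countable_union_of_Union) auto
  then obtain S where S: "clopen_sigma S" "\<Union>((\<lambda>B. ext_trace X (?Z - B)) ` \<B>) \<subseteq> S"
    by (rule clopen_sigma_superset)
  have "ext_trace X U \<subseteq> S"
  \<comment> \<open>Since points are closed, some member of the base misses \<open>Some x\<close>,
    so \<open>x\<close> is caught by the corresponding piece.\<close>
  proof
    fix x assume x: "x \<in> ext_trace X U"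
    then have xT: "Some x \<in> topspace T" using top by (auto simp: ext_trace_def)
    then have "closedin T {Some x}"
      using compactin_imp_closedin[OF ext_tychonoffD(5)[OF T], of "{Some x}"] by simp
    then have "openin T (topspace T - {Some x})" by blast
    moreover have "None \<in> topspace T - {Some x}" using top by simp
    ultimately obtain B where B: "B \<in> \<B>" "B \<subseteq> topspace T - {Some x}" using \<B>(3) by meson
    have "U \<subseteq> ?Z" using openin_subset[OF U(1)] by (rule closure_of_subset)
    then have "x \<in> ext_trace X (?Z - B)" using x B(2) by (auto simp: ext_trace_def)
    then show "x \<in> S" using S(2) B(1) by blast
  qed
  then have "cl (ext_trace X U) \<subseteq> cl S" by (rule cl_mono)
  moreover have "ext_fibre X T \<subseteq> cl (ext_trace X U)"
    unfolding cl_def by (rule ext_fibre_subset_closure[OF U(1,2)])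
  ultimately show "ext_fibre X T \<subseteq> lambda_set P X" using cl_subset_lambda[OF S(1)] by blast
next
  note top = ext_tychonoffD(1)[OF T]
  note H = ext_tychonoffD(5)[OF T]
  note F = ext_fibre_remainder_compact[OF T]
  assume "ext_fibre X T \<subseteq> lambda_set P X"
  with remainder_compactsD(2)[OF F] obtain S where S: "clopen_sigma S" "ext_fibre X T \<subseteq> cl S"
    by (rule compactin_subset_lambda)
  note S' = clopen_sigmaD[OF S(1)]
  show "locally_property P T"
    unfolding locally_property_def
  proof
    fix t assume t: "t \<in> topspace T"
    show "\<exists>U. openin T U \<and> t \<in> U \<and> has_property P (subtopology T (T closure_of U))"
    proof (cases t)
      case None
      \<comment> \<open>As \<open>cl S\<close> is an open neighbourhood of the fibre with trace
        \<open>S\<close>, and \<open>S\<close> is closed in \<open>X\<close>, this set is clopen. It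
        is the union of a \<sigma>-compact closed subspace of \<open>X\<close> and a point.\<close>
      define U where "U = insert None (Some ` S)"
      have op: "openin T U"
        unfolding U_def using openin_ext_of_nbhd[OF T S'(5) S(2)] S'(6) by simp
      have UT: "U \<subseteq> topspace T" using op by (rule openin_subset)
      have "openin T (Some ` (topspace X - S))" using S'(2) by (intro openin_ext_Some[OF T]) blast
      moreover have "topspace T - U = Some ` (topspace X - S)" using top by (auto simp: U_def)
      ultimately have "closedin T U" using UT by (simp add: closedin_def)
      then have clU: "T closure_of U = U" by (simp add: closure_of_eq)
      have "has_property P (subtopology T U)"
      proof (rule has_property_Un[OF inj_i P(1,4)])
        show "Hausdorff_space (subtopology T U)" using H by (rule Hausdorff_space_subtopology)
        show "Some ` S \<union> {None} = topspace (subtopology T U)" using UT by (auto simp: U_def)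
        have "U \<inter> Some ` S = Some ` S" "U \<inter> {None} = {None}" by (auto simp: U_def)
        then show "has_property P (subtopology (subtopology T U) (Some ` S))"
          "has_property P (subtopology (subtopology T U) {None})"
          using has_property_clopen_sigma_ext[OF T S(1)] has_property_compactin[OF H, of "{None}"] top
          by (simp_all add: subtopology_subtopology)
      qed
      then show ?thesis using op clU None by (intro exI[of _ U]) (simp add: U_def)
    next
      case (Some x)
      then have "x \<in> topspace X" using t top by auto
      then obtain V K where V: "openin X V" "compactin X K" "x \<in> V" "V \<subseteq> K"
        using lc unfolding locally_compact_space_def by meson
      have K: "compactin T (Some ` K)"
        using V(2) continuous_map_ext_Some[OF T] by (rule image_compactin)
      have "T closure_of (Some ` V) \<subseteq> Some ` K"
        using V(4) by (intro closure_of_minimal compactin_imp_closedin[OF H K]) blast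
      then have "compactin T (T closure_of (Some ` V))"
        by (rule closed_compactin[OF K _ closedin_closure_of])
      then have "has_property P (subtopology T (T closure_of (Some ` V)))"
        by (rule has_property_compactin[OF H])
      then show ?thesis using openin_ext_Some[OF T V(1)] V(3) Some by blast
    qed
  qed
qed

lemma ext_local_eq:
  "ext_local P X = {T \<in> ext_tychonoff X. gdelta_in bX (ext_fibre X T) \<and> ext_fibre X T \<subseteq> lambda_set P X}"
  unfolding ext_local_def using countable_local_base_iff_ext_fibre locally_property_ext_iff by blast

section \<open>The two posets of extensions as posets of \<open>L\<close>\<close>

lemma bij_betw_restrict_Collect:
  assumes "bij_betw f A B"
  shows "bij_betw f {a \<in> A. Q (f a)} {b \<in> B. Q b}"
  using assms unfolding bij_betw_def by (auto intro: inj_on_subset)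

text \<open>A relative G-delta of \<open>L\<close> need not be one of \<open>\<beta>X\<close>, but a
  compact one lies in some \<open>cl S\<close>. There \<open>L\<close> is cut out by removing the
  \<sigma>-compact image of \<open>S\<close> from an open set, which is a G-delta of
  \<open>\<beta>X\<close>.\<close>

lemma compact_gdeltas_lambda_remainder:
  "compact_gdeltas (lambda_remainder P X) =
     {F \<in> remainder_compacts X. gdelta_in bX F \<and> F \<subseteq> lambda_set P X}"
proof (intro set_eqI iffI)
  fix F assume "F \<in> compact_gdeltas (lambda_remainder P X)"
  then have F: "F \<noteq> {}" "compactin bX F" "F \<subseteq> L" "gdelta_in (subtopology bX L) F"
    by (auto simp: compact_gdeltas_def lambda_remainder_def compactin_subtopology)
  obtain G where G: "gdelta_in bX G" "F = G \<inter> L" using F(4) unfolding gdelta_in_subtopology by blast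
  have "F \<subseteq> lambda_set P X" using F(3) by blast
  with F(2) obtain S where S: "clopen_sigma S" "F \<subseteq> cl S" by (rule compactin_subset_lambda)
  note S' = clopen_sigmaD[OF S(1)]
  have "sigma_compactin bX (e ` S)" using continuous_e S'(3) by (rule sigma_compactin_image)
  then have "gdelta_in bX (cl S - e ` S)"
    by (rule gdelta_in_Diff_sigma_compactin[OF Hausdorff_stone_cech open_imp_gdelta_in[OF S'(5)]])
  then have "gdelta_in bX (G \<inter> (cl S - e ` S))" using G(1) by (intro gdelta_in_Int)
  moreover have "G \<inter> (cl S - e ` S) = F"
  proof
    have "e ` S = e ` sc_trace X (cl S)" using S'(6) by simp
    then have "cl S - e ` S = cl S - eX" unfolding image_sc_trace by blast
    then show "G \<inter> (cl S - e ` S) \<subseteq> F" using G(2) cl_subset_lambda[OF S(1)] by blast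
    show "F \<subseteq> G \<inter> (cl S - e ` S)" using G(2) S(2) S'(4) by blast
  qed
  ultimately show "F \<in> {F \<in> remainder_compacts X. gdelta_in bX F \<and> F \<subseteq> lambda_set P X}"
    using F(1-3) by (auto simp: remainder_compacts_def)
next
  fix F assume "F \<in> {F \<in> remainder_compacts X. gdelta_in bX F \<and> F \<subseteq> lambda_set P X}"
  then have F: "F \<noteq> {}" "compactin bX F" "F \<subseteq> L" "gdelta_in bX F"
    by (auto simp: remainder_compacts_def)
  then have "gdelta_in (subtopology bX L) F"
    unfolding gdelta_in_subtopology by (intro exI[of _ F]) blast
  then show "F \<in> compact_gdeltas (lambda_remainder P X)"
    using F by (simp add: compact_gdeltas_def lambda_remainder_def compactin_subtopology)
qed

lemma ext_local_isomorphic: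
  "order_isomorphic (ext_local P X) (extension_le X) (compact_gdeltas (lambda_remainder P X)) (\<supseteq>)"
  unfolding order_isomorphic_iff
proof (intro exI conjI ballI)
  show "bij_betw (ext_fibre X) (ext_local P X) (compact_gdeltas (lambda_remainder P X))"
    unfolding ext_local_eq compact_gdeltas_lambda_remainder
    using bij_betw_ext_fibre by (rule bij_betw_restrict_Collect)
  fix T T' assume "T \<in> ext_local P X" "T' \<in> ext_local P X"
  then show "extension_le X T T' \<longleftrightarrow> ext_fibre X T \<supseteq> ext_fibre X T'"
    by (intro extension_le_iff_ext_fibre) (auto simp: ext_local_eq)
qed

lemma bij_betw_proper_sigma_opens:
  "bij_betw ((-) R) {F \<in> remainder_compacts X. sigma_compactin bX (R - F) \<and> R - F \<subseteq> lambda_set P X}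
     (proper_sigma_opens (lambda_remainder P X))"
proof (rule bij_betw_byWitness[where f' = "(-) R"])
  have L_R: "L \<subseteq> R" using lambda_subset by blast
  have FR: "F \<subseteq> R" if "F \<in> remainder_compacts X" for F
    using remainder_compactsD(4,5)[OF that] by blast
  have AL: "A \<subseteq> L" if "A \<in> proper_sigma_opens (lambda_remainder P X)" for A
    using that openin_subset topspace_lambda_remainder unfolding proper_sigma_opens_def by blast
  show "\<forall>F\<in>{F \<in> remainder_compacts X. sigma_compactin bX (R - F) \<and> R - F \<subseteq> lambda_set P X}. R - (R - F) = F"
    using FR by (simp add: double_diff)
  show "\<forall>A\<in>proper_sigma_opens (lambda_remainder P X). R - (R - A) = A"
  proof
    fix A assume "A \<in> proper_sigma_opens (lambda_remainder P X)"
    from subset_trans[OF AL[OF this] L_R] have "A \<subseteq> R" .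
    then show "R - (R - A) = A" by (simp add: double_diff)
  qed
  show "(-) R ` {F \<in> remainder_compacts X. sigma_compactin bX (R - F) \<and> R - F \<subseteq> lambda_set P X}
      \<subseteq> proper_sigma_opens (lambda_remainder P X)"
  proof (rule image_subsetI)
    fix F assume "F \<in> {F \<in> remainder_compacts X. sigma_compactin bX (R - F) \<and> R - F \<subseteq> lambda_set P X}"
    then have F: "F \<in> remainder_compacts X" "sigma_compactin bX (R - F)" "R - F \<subseteq> lambda_set P X" by auto
    have "R - F = (topspace bX - F) \<inter> L" using F(3) L_R by blast
    moreover have "openin bX (topspace bX - F)" using remainder_compactsD(3)[OF F(1)] by blast
    ultimately have "openin (subtopology bX L) (R - F)" by (simp add: openin_subtopology_Int)
    \<comment> \<open>Equality would make \<open>L\<close> \<sigma>-compact and hence contained in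
      one \<open>cl S\<close>; then \<open>L\<close> is the whole remainder and \<open>F\<close> is
      empty.\<close>
    moreover have "R - F \<noteq> L"
    proof
      assume eq: "R - F = L"
      from F(2,3) obtain S where S: "clopen_sigma S" "R - F \<subseteq> cl S" by (rule sigma_compactin_subset_lambda)
      have "R - F = R" using eq lambda_remainder_bounded[OF S(1)] S(2) by simp
      then show False using FR[OF F(1)] remainder_compactsD(1)[OF F(1)] by blast
    qed
    moreover have "R - F \<subseteq> L" using F(3) by blast
    ultimately show "R - F \<in> proper_sigma_opens (lambda_remainder P X)"
      using F(2) lambda_subset topspace_lambda_remainder
      by (simp add: proper_sigma_opens_def lambda_remainder_def sigma_compactin_subtopology)
  qed
  show "(-) R ` proper_sigma_opens (lambda_remainder P X)
      \<subseteq> {F \<in> remainder_compacts X. sigma_compactin bX (R - F) \<and> R - F \<subseteq> lambda_set P X}"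
  proof (rule image_subsetI)
    fix A assume A: "A \<in> proper_sigma_opens (lambda_remainder P X)"
    then have A': "openin (subtopology bX L) A" "sigma_compactin bX A" "A \<noteq> L" "A \<subseteq> L"
      using topspace_lambda_remainder AL[OF A]
      by (auto simp: proper_sigma_opens_def lambda_remainder_def sigma_compactin_subtopology)
    obtain W where W: "openin bX W" "A = W \<inter> L" using A'(1) unfolding openin_subtopology by blast
    \<comment> \<open>Written in this form, the set is visibly closed in \<open>\<beta>X\<close>,
      because \<open>X\<close> and the \<lambda>-set are open there.\<close>
    have "R - A = R - (W \<inter> lambda_set P X)" using W(2) by blast
    moreover have "closedin bX (R - (W \<inter> lambda_set P X))"
      using W(1) openin_lambda openin_eX by (intro closedin_diff openin_Int) auto
    ultimately have "compactin bX (R - A)" using closedin_compact_space[OF compact_stone_cech] by simp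
    moreover have "R - A \<noteq> {}" using A'(3,4) L_R by blast
    ultimately have "R - A \<in> remainder_compacts X" by (auto simp: remainder_compacts_def)
    moreover have "R - (R - A) = A" using A'(4) L_R by (simp add: double_diff)
    ultimately show "R - A \<in> {F \<in> remainder_compacts X. sigma_compactin bX (R - F) \<and> R - F \<subseteq> lambda_set P X}"
      using A'(2,4) by auto
  qed
qed

text \<open>Complementation in the remainder undoes the order reversal of the fibres, so inclusion
  is not reversed here.\<close>

lemma ext_cech_isomorphic:
  "order_isomorphic (ext_cech P X) (extension_le X) (proper_sigma_opens (lambda_remainder P X)) (\<subseteq>)"
  unfolding order_isomorphic_iff
proof (intro exI conjI ballI)
  have "bij_betw (ext_fibre X) (ext_cech P X)
     {F \<in> remainder_compacts X. sigma_compactin bX (R - F) \<and> R - F \<subseteq> lambda_set P X}"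
    unfolding ext_cech_eq using bij_betw_ext_fibre by (rule bij_betw_restrict_Collect)
  then show "bij_betw ((-) R \<circ> ext_fibre X) (ext_cech P X) (proper_sigma_opens (lambda_remainder P X))"
    using bij_betw_proper_sigma_opens by (rule bij_betw_trans)
  fix T T' assume "T \<in> ext_cech P X" "T' \<in> ext_cech P X"
  then have T: "T \<in> ext_tychonoff X" "T' \<in> ext_tychonoff X" by (auto simp: ext_cech_eq)
  have "ext_fibre X T' \<subseteq> R"
    using remainder_compactsD(4,5)[OF ext_fibre_remainder_compact[OF T(2)]] by blast
  then have "ext_fibre X T' \<subseteq> ext_fibre X T \<longleftrightarrow> R - ext_fibre X T \<subseteq> R - ext_fibre X T'" by blast
  then show "extension_le X T T' \<longleftrightarrow> ((-) R \<circ> ext_fibre X) T \<subseteq> ((-) R \<circ> ext_fibre X) T'"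
    using extension_le_iff_ext_fibre[OF T] by simp
qed

end

theorem theorem2p5:
  fixes X :: "'a topology" and Y :: "'b topology" and P :: "'u topology \<Rightarrow> bool"
  assumes univ_X: "\<exists>i :: 'a option \<Rightarrow> 'u. inj i"
    and univ_Y: "\<exists>j :: 'b option \<Rightarrow> 'u. inj j"
    and X: "locally_compact_space X" "paracompact_space X"
    and Y: "locally_compact_space Y" "paracompact_space Y"
    and "topological_property P"
    and "property_of_compact_spaces P"
    and "closed_hereditary P"
    and "preserved_under_finite_sums P"
    and "coincides_with_sigma_compactness P"
  shows "(lambda_remainder P X homeomorphic_space lambda_remainder P Y
            \<longleftrightarrow> order_isomorphic (ext_cech P X) (extension_le X) (ext_cech P Y) (extension_le Y))
       \<and> (order_isomorphic (ext_cech P X) (extension_le X) (ext_cech P Y) (extension_le Y)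
            \<longleftrightarrow> order_isomorphic (ext_local P X) (extension_le X) (ext_local P Y) (extension_le Y))"
proof -
  have tych: "tychonoff_space Z" if Z: "locally_compact_space Z" "paracompact_space Z" for Z :: "'z topology"
  proof -
    have H: "Hausdorff_space Z" using Z(2) by (simp add: paracompact_space_def)
    show ?thesis
      unfolding tychonoff_space_def
      using H locally_compact_regular_imp_completely_regular_space[OF Z(1)]
        locally_compact_Hausdorff_imp_regular_space[OF Z(1) H] by simp
  qed
  obtain i :: "'a option \<Rightarrow> 'u" where i: "inj i" using univ_X by blast
  obtain j :: "'b option \<Rightarrow> 'u" where j: "inj j" using univ_Y by blast
  interpret X: sigma_compact_property X P i
    by unfold_locales (use X i assms(7-11) tych in auto)
  interpret Y: sigma_compact_property Y P j
    by unfold_locales (use Y j assms(7-11) tych in auto)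
  let ?LX = "lambda_remainder P X" and ?LY = "lambda_remainder P Y"
  note bounded = X.sigma_bounded_lambda_remainder Y.sigma_bounded_lambda_remainder
  have cech: "order_isomorphic (ext_cech P X) (extension_le X) (ext_cech P Y) (extension_le Y) \<longleftrightarrow>
      order_isomorphic (proper_sigma_opens ?LX) (\<subseteq>) (proper_sigma_opens ?LY) (\<subseteq>)"
    by (rule order_isomorphic_cong[OF X.ext_cech_isomorphic Y.ext_cech_isomorphic])
  have loc: "order_isomorphic (ext_local P X) (extension_le X) (ext_local P Y) (extension_le Y) \<longleftrightarrow>
      order_isomorphic (compact_gdeltas ?LX) (\<supseteq>) (compact_gdeltas ?LY) (\<supseteq>)"
    by (rule order_isomorphic_cong[OF X.ext_local_isomorphic Y.ext_local_isomorphic])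
  have "?LX homeomorphic_space ?LY \<longleftrightarrow>
      order_isomorphic (ext_cech P X) (extension_le X) (ext_cech P Y) (extension_le Y)"
    unfolding cech
    by (rule iffI[OF homeomorphic_space_imp_posets_isomorphic(2)
          proper_sigma_opens_isomorphic_imp_homeomorphic[OF bounded]])
  moreover have "?LX homeomorphic_space ?LY \<longleftrightarrow>
      order_isomorphic (ext_local P X) (extension_le X) (ext_local P Y) (extension_le Y)"
    unfolding loc
    by (rule iffI[OF homeomorphic_space_imp_posets_isomorphic(1)
          compact_gdeltas_isomorphic_imp_homeomorphic[OF bounded]])
  ultimately show ?thesis by blast
qed

end
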